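(* Let $k\in\mathbb{N}$, let $\mathcal{R}$ be a finite set of real linear relations in the variables $e,p_1,\dots,p_N$, let $\mathcal{U}_{\mathcal{R}}$ be the associated universal $*$-vector space with generators $e,p_1,\dots,p_N$, and let $E^{\mathrm{proj}(k)}\subseteq M_k(\mathcal{U}_{\mathcal{R}})_h$ be the cone defined in the context. Then $(\mathcal{U}_{\mathcal{R}},E^{\mathrm{proj}(k)},e)$ is a $k$-AOU space whenever there exists a $k$-AOU space $(\mathcal{V},\tilde{C},f)$ with abstract projections (in the $k$-AOU sense) $q_1,\dots,q_N$ such that $f,q_1,\dots,q_N$ satisfy $\mathcal{R}$, $\mathcal{V}=\operatorname{span}\{f,q_1,\dots,q_N\}$ and $\dim(\mathcal{U}_{\mathcal{R}})=\dim(\mathcal{V})$. Moreover, whenever $\mathcal{V}$ is a $k$-AOU space with unit $f$ and cone $\tilde C$, and $q_1,\dots,q_N\in\mathcal{V}$ are abstract projections (in the $k$-AOU sense) such that $f,q_1,\dots,q_N$ satisfy $\mathcal{R}$, the map $\pi:\mathcal{U}_{\mathcal{R}}\to\mathcal{V}$ defined by $\pi(e)=f$ and $\pi(p_i)=q_i$ for all $i\in[N]$ is a unital $k$-positive map (that is, $\pi_k(E^{\mathrm{proj}(k)})\subseteq\tilde{C}$).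
   Context: Notation: $[N]=\{1,\dots,N\}$; $M_{n,m}$ is the space of complex $n\times m$ matrices, $M_n=M_{n,n}$. For a $*$-vector space $\mathcal{V}$, $M_n(\mathcal{V})_h$ is the set of hermitian elements of $M_n(\mathcal{V})$, where $(a_{ij})^*=(a_{ji}^* )$; a cone is a set of hermitian elements closed under sums and nonnegative scalars, and is proper if $C\cap-C=\{0\}$. For linear $\phi$, $\phi_n((a_{ij}))=(\phi(a_{ij}))$. A $k$-AOU space is $(\mathcal{V},C,e)$ with $\mathcal{V}$ a $*$-vector space, $C\subseteq M_k(\mathcal{V})_h$ a proper cone with $\alpha^*C\alpha\subseteq C$ for all $\alpha\in M_k$, and $e\in\mathcal{V}$ such that $I_k\otimes e$ is an Archimedean order unit for $(M_k(\mathcal{V}),C)$. A linear map $\phi:(\mathcal{V},C)\to(\mathcal{W},D)$ is $k$-positive if $\phi_k(C)\subseteq D$. A positive contraction is a hermitian $p\in\mathcal{V}$ with $I_k\otimes p\in C$ and $I_k\otimes p^\perp\in C$, where $p^\perp=e-p$. For such $p$, $C[p]$ is the set of $x\in M_k(\mathcal{V})_h$ such that for every $\epsilon>0$ there exists $t>0$ with $$(\alpha+\beta)^*x(\alpha+\beta)+(\epsilon\alpha^*\alpha+t\beta^*\beta)\otimes p+(\epsilon\beta^*\beta+t\alpha^*\alpha)\otimes p^\perp\in C\quad\text{for all }\alpha,\beta\in M_k.$$ A positive contraction $p$ is an abstract projection in the $k$-AOU sense if $C=C[p]$. (The formula for $C[p]$ is also used when $C$ is not known to be proper.) The space $\mathcal{U}_{\mathcal{R}}$.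 The relations $\mathcal{R}$ consist of $l$ linear equations encoded by $M_{\mathcal{R}}\in M_{l,N+1}(\mathbb{R})$ with rows $r_1,\dots,r_l$. Vectors $f,q_1,\dots,q_N$ satisfy $\mathcal{R}$ if $M_{\mathcal{R}}(f\ q_1\cdots q_N)^T=0$. Put $J_{\mathcal{R}}=\operatorname{span}\{r_i^T\}\subseteq\mathbb{C}^{N+1}$, $\mathcal{U}_{\mathcal{R}}=\mathbb{C}^{N+1}/J_{\mathcal{R}}$, $e=e_0+J_{\mathcal{R}}$, $p_i=e_i+J_{\mathcal{R}}$ with $e_0,\dots,e_N$ the standard basis; the involution is induced by entrywise conjugation. $\widetilde{E}=\{r_0e+\sum_{i=1}^N t_ip_i+\sum_{i=1}^N s_ip_i^\perp:r_0,t_i,s_i\ge0\}$; $E=\{x\in\mathcal U_{\mathcal R}:x=x^*,\ x+\epsilon e\in\widetilde{E}\ \forall\epsilon>0\}$; $D_n^{\max}=\{\alpha^*\operatorname{diag}(s_1,\dots,s_m)\alpha:m\in\mathbb{N},\alpha\in M_{m,n},s_i\in E\}$; $E_n^{\max}=\{x\in M_n(\mathcal{U}_{\mathcal{R}})_h:x+\epsilon I_n\otimes e\in D_n^{\max}\ \forall\epsilon>0\}$. The cone $E^{\mathrm{proj}(k)}$. Set $E^0=E_k^{\max}\subseteq M_k(\mathcal{U}_{\mathcal{R}})_h$ and $E^n=E^{n-1}[p_i]$ for $n\ge1$, where $i\in[N]$, $i\equiv n\pmod N$. Then $E^{\mathrm{proj}(k)}$ is the Archimedean closure of $\bigcup_nE^n$,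 i.e. the set of $x\in M_k(\mathcal{U}_{\mathcal{R}})_h$ such that for every $\epsilon>0$ there is $n$ with $x+\epsilon I_k\otimes e\in E^n$. *)

theory Defs
  imports
    "HOL-Algebra.AbelCoset"
    "Jordan_Normal_Form.VS_Connect"
    "Jordan_Normal_Form.Schur_Decomposition"
begin

section \<open>Star-vector spaces and matrices over them\<close>

text \<open>
  Complex vector spaces are \<^locale>\<open>vectorspace\<close>s over \<open>class_ring :: complex ring\<close>, with an
  explicit carrier; the ring fields \<open>mult\<close> and \<open>one\<close> of the module record play no role.
\<close>

record 'v star_vs = "(complex, 'v) module" +
  star :: "'v \<Rightarrow> 'v"

locale star_vector_space = vectorspace "class_ring :: complex ring" V
  for V :: "'v star_vs" +
  assumes star_closed: "x \<in> carrier V \<Longrightarrow> star V x \<in> carrier V"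
    and star_star: "x \<in> carrier V \<Longrightarrow> star V (star V x) = x"
    and star_add: "x \<in> carrier V \<Longrightarrow> y \<in> carrier V \<Longrightarrow> star V (x \<oplus>\<^bsub>V\<^esub> y) = star V x \<oplus>\<^bsub>V\<^esub> star V y"
    and star_smult: "x \<in> carrier V \<Longrightarrow> star V (c \<odot>\<^bsub>V\<^esub> x) = cnj c \<odot>\<^bsub>V\<^esub> star V x"

text \<open>
  Matrices over \<open>V\<close> are matrices in the sense of \<^theory>\<open>Jordan_Normal_Form.Matrix\<close> with entries
  in the carrier. The operations on them go through the operations of \<open>V\<close>, since the element
  type need not carry any algebraic structure.
\<close>

definition mats :: "nat \<Rightarrow> 'v star_vs \<Rightarrow> 'v mat set" where
  "mats n V = {x \<in> carrier_mat n n. \<forall>i<n. \<forall>j<n. x $$ (i, j) \<in> carrier V}"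

definition mat_star :: "'v star_vs \<Rightarrow> 'v mat \<Rightarrow> 'v mat" where
  "mat_star V x = map_mat (star V) (transpose_mat x)"

definition herm :: "nat \<Rightarrow> 'v star_vs \<Rightarrow> 'v mat set" where
  "herm n V = {x \<in> mats n V. mat_star V x = x}"

definition mat_zero :: "nat \<Rightarrow> 'v star_vs \<Rightarrow> 'v mat" where
  "mat_zero n V = mat n n (\<lambda>_. \<zero>\<^bsub>V\<^esub>)"

definition mat_add :: "'v star_vs \<Rightarrow> 'v mat \<Rightarrow> 'v mat \<Rightarrow> 'v mat" where
  "mat_add V x y = mat (dim_row x) (dim_col x) (\<lambda>ij. x $$ ij \<oplus>\<^bsub>V\<^esub> y $$ ij)"

definition mat_neg :: "'v star_vs \<Rightarrow> 'v mat \<Rightarrow> 'v mat" where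
  "mat_neg V x = map_mat (\<lambda>v. \<ominus>\<^bsub>V\<^esub> v) x"

definition mat_scale :: "'v star_vs \<Rightarrow> real \<Rightarrow> 'v mat \<Rightarrow> 'v mat" where
  "mat_scale V r x = map_mat (\<lambda>v. complex_of_real r \<odot>\<^bsub>V\<^esub> v) x"

text \<open>\<open>tensor V A v\<close> is \<open>A \<otimes> v\<close>, and \<open>compress V \<alpha> x\<close> is \<open>\<alpha>\<^sup>* x \<alpha>\<close> (for \<open>x\<close> of size \<open>m\<close>
  and \<open>\<alpha>\<close> of size \<open>m \<times> n\<close>).\<close>

definition tensor :: "'v star_vs \<Rightarrow> complex mat \<Rightarrow> 'v \<Rightarrow> 'v mat" where
  "tensor V A v = map_mat (\<lambda>c. c \<odot>\<^bsub>V\<^esub> v) A"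

definition compress :: "'v star_vs \<Rightarrow> complex mat \<Rightarrow> 'v mat \<Rightarrow> 'v mat" where
  "compress V \<alpha> x = mat (dim_col \<alpha>) (dim_col \<alpha>) (\<lambda>(i, j).
     \<Oplus>\<^bsub>V\<^esub>a\<in>{..<dim_row x}. \<Oplus>\<^bsub>V\<^esub>b\<in>{..<dim_col x}.
       (cnj (\<alpha> $$ (a, i)) * \<alpha> $$ (b, j)) \<odot>\<^bsub>V\<^esub> x $$ (a, b))"

definition diag_matrix :: "'v star_vs \<Rightarrow> nat \<Rightarrow> (nat \<Rightarrow> 'v) \<Rightarrow> 'v mat" where
  "diag_matrix V m s = mat m m (\<lambda>(i, j). if i = j then s i else \<zero>\<^bsub>V\<^esub>)"


section \<open>\<open>k\<close>-AOU spaces, \<open>k\<close>-positive maps and abstract projections\<close>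

definition cone :: "nat \<Rightarrow> 'v star_vs \<Rightarrow> 'v mat set \<Rightarrow> bool" where
  "cone k V C \<longleftrightarrow> C \<subseteq> herm k V \<and>
     (\<forall>x\<in>C. \<forall>y\<in>C. mat_add V x y \<in> C) \<and> (\<forall>r\<ge>0. \<forall>x\<in>C. mat_scale V r x \<in> C)"

definition proper_cone :: "nat \<Rightarrow> 'v star_vs \<Rightarrow> 'v mat set \<Rightarrow> bool" where
  "proper_cone k V C \<longleftrightarrow> cone k V C \<and> C \<inter> mat_neg V ` C = {mat_zero k V}"

definition archimedean_order_unit :: "nat \<Rightarrow> 'v star_vs \<Rightarrow> 'v mat set \<Rightarrow> 'v mat \<Rightarrow> bool" where
  "archimedean_order_unit k V C u \<longleftrightarrow> u \<in> herm k V \<and>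
     (\<forall>x\<in>herm k V. \<exists>r>0. mat_add V (mat_scale V r u) (mat_neg V x) \<in> C) \<and>
     (\<forall>x\<in>herm k V. (\<forall>r>0. mat_add V x (mat_scale V r u) \<in> C) \<longrightarrow> x \<in> C)"

definition k_AOU :: "nat \<Rightarrow> 'v star_vs \<Rightarrow> 'v mat set \<Rightarrow> 'v \<Rightarrow> bool" where
  "k_AOU k V C e \<longleftrightarrow> star_vector_space V \<and> proper_cone k V C \<and>
     (\<forall>\<alpha>\<in>carrier_mat k k. \<forall>x\<in>C. compress V \<alpha> x \<in> C) \<and>
     e \<in> carrier V \<and> archimedean_order_unit k V C (tensor V (1\<^sub>m k) e)"

definition k_positive ::
  "nat \<Rightarrow> 'v star_vs \<Rightarrow> 'v mat set \<Rightarrow> 'w star_vs \<Rightarrow> 'w mat set \<Rightarrow> ('v \<Rightarrow> 'w) \<Rightarrow> bool" where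
  "k_positive k V C W D \<phi> \<longleftrightarrow>
     linear_map (class_ring :: complex ring) V W \<phi> \<and> map_mat \<phi> ` C \<subseteq> D"

definition positive_contraction ::
  "nat \<Rightarrow> 'v star_vs \<Rightarrow> 'v mat set \<Rightarrow> 'v \<Rightarrow> 'v \<Rightarrow> bool" where
  "positive_contraction k V C e p \<longleftrightarrow> p \<in> carrier V \<and> star V p = p \<and>
     tensor V (1\<^sub>m k) p \<in> C \<and> tensor V (1\<^sub>m k) (e \<ominus>\<^bsub>V\<^esub> p) \<in> C"

text \<open>\<open>proj_cone k V e p C\<close> is \<open>C[p]\<close>.\<close>

definition proj_cone ::
  "nat \<Rightarrow> 'v star_vs \<Rightarrow> 'v \<Rightarrow> 'v \<Rightarrow> 'v mat set \<Rightarrow> 'v mat set" where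
  "proj_cone k V e p C = {x \<in> herm k V. \<forall>\<epsilon>>0. \<exists>t>0.
     \<forall>\<alpha>\<in>carrier_mat k k. \<forall>\<beta>\<in>carrier_mat k k.
       mat_add V
         (mat_add V (compress V (\<alpha> + \<beta>) x)
           (tensor V (complex_of_real \<epsilon> \<cdot>\<^sub>m (mat_adjoint \<alpha> * \<alpha>)
                      + complex_of_real t \<cdot>\<^sub>m (mat_adjoint \<beta> * \<beta>)) p))
         (tensor V (complex_of_real \<epsilon> \<cdot>\<^sub>m (mat_adjoint \<beta> * \<beta>)
                      + complex_of_real t \<cdot>\<^sub>m (mat_adjoint \<alpha> * \<alpha>)) (e \<ominus>\<^bsub>V\<^esub> p)) \<in> C}"

definition abstract_projection ::
  "nat \<Rightarrow> 'v star_vs \<Rightarrow> 'v mat set \<Rightarrow> 'v \<Rightarrow> 'v \<Rightarrow> bool" where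
  "abstract_projection k V C e p \<longleftrightarrow>
     positive_contraction k V C e p \<and> C = proj_cone k V e p C"


section \<open>The universal space of a family of linear relations\<close>

text \<open>
  Row \<open>i\<close> (counted from \<open>0\<close>) of the real \<open>l \<times> (N+1)\<close> matrix \<open>M\<close> is the \<open>i\<close>-th relation; column
  \<open>0\<close> belongs to the unit and column \<open>j\<close> with \<open>1 \<le> j \<le> N\<close> to the \<open>j\<close>-th generator.
\<close>

definition satisfies_relations ::
  "nat \<Rightarrow> real mat \<Rightarrow> 'v star_vs \<Rightarrow> 'v \<Rightarrow> (nat \<Rightarrow> 'v) \<Rightarrow> bool" where
  "satisfies_relations N M V f q \<longleftrightarrow> (\<forall>i<dim_row M.
     complex_of_real (M $$ (i, 0)) \<odot>\<^bsub>V\<^esub> f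
       \<oplus>\<^bsub>V\<^esub> (\<Oplus>\<^bsub>V\<^esub>j\<in>{1..N}. complex_of_real (M $$ (i, j)) \<odot>\<^bsub>V\<^esub> q j) = \<zero>\<^bsub>V\<^esub>)"

abbreviation ambient :: "nat \<Rightarrow> (complex, complex vec) module" where
  "ambient N \<equiv> module_vec TYPE(complex) (N + 1)"

definition rel_span :: "nat \<Rightarrow> real mat \<Rightarrow> complex vec set" where
  "rel_span N M = LinearCombinations.module.span class_ring (ambient N) (set (rows (map_mat complex_of_real M)))"

text \<open>
  The quotient of \<open>\<complex>\<^sup>N\<^sup>+\<^sup>1\<close> by \<open>rel_span N M\<close>: elements are cosets, and scalar multiplication and
  involution are induced from representatives. The image of a coset under \<open>conjugate\<close> is again
  a coset because the relations are real.
\<close>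

definition univ_space :: "nat \<Rightarrow> real mat \<Rightarrow> complex vec set star_vs" where
  "univ_space N M = (let A = ambient N; J = rel_span N M in
     \<lparr> carrier = a_rcosets\<^bsub>A\<^esub> J,
       monoid.mult = undefined,
       one = undefined,
       zero = J,
       add = set_add A,
       module.smult = (\<lambda>c X. \<Union>x\<in>X. J +>\<^bsub>A\<^esub> (c \<odot>\<^bsub>A\<^esub> x)),
       star = (\<lambda>X. conjugate ` X) \<rparr>)"

definition univ_gen :: "nat \<Rightarrow> real mat \<Rightarrow> nat \<Rightarrow> complex vec set" where
  "univ_gen N M j = rel_span N M +>\<^bsub>ambient N\<^esub> unit_vec (N + 1) j"

abbreviation univ_unit :: "nat \<Rightarrow> real mat \<Rightarrow> complex vec set" where
  "univ_unit N M \<equiv> univ_gen N M 0"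


section \<open>The cones generated by a unit \<open>e\<close> and vectors \<open>p 1, \<dots>, p N\<close>\<close>

definition E_tilde :: "'v star_vs \<Rightarrow> nat \<Rightarrow> 'v \<Rightarrow> (nat \<Rightarrow> 'v) \<Rightarrow> 'v set" where
  "E_tilde V N e p =
     {complex_of_real r \<odot>\<^bsub>V\<^esub> e
        \<oplus>\<^bsub>V\<^esub> (\<Oplus>\<^bsub>V\<^esub>i\<in>{1..N}. complex_of_real (t i) \<odot>\<^bsub>V\<^esub> p i)
        \<oplus>\<^bsub>V\<^esub> (\<Oplus>\<^bsub>V\<^esub>i\<in>{1..N}. complex_of_real (s i) \<odot>\<^bsub>V\<^esub> (e \<ominus>\<^bsub>V\<^esub> p i))
      | (r :: real) (t :: nat \<Rightarrow> real) (s :: nat \<Rightarrow> real).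
        0 \<le> r \<and> (\<forall>i\<in>{1..N}. 0 \<le> t i \<and> 0 \<le> s i)}"

definition E_cone :: "'v star_vs \<Rightarrow> nat \<Rightarrow> 'v \<Rightarrow> (nat \<Rightarrow> 'v) \<Rightarrow> 'v set" where
  "E_cone V N e p = {x \<in> carrier V. star V x = x \<and>
     (\<forall>\<epsilon>>0. x \<oplus>\<^bsub>V\<^esub> complex_of_real \<epsilon> \<odot>\<^bsub>V\<^esub> e \<in> E_tilde V N e p)}"

definition D_max :: "'v star_vs \<Rightarrow> nat \<Rightarrow> 'v \<Rightarrow> (nat \<Rightarrow> 'v) \<Rightarrow> nat \<Rightarrow> 'v mat set" where
  "D_max V N e p n =
     {compress V \<alpha> (diag_matrix V m s) | m \<alpha> s.
        1 \<le> m \<and> \<alpha> \<in> carrier_mat m n \<and> (\<forall>i<m. s i \<in> E_cone V N e p)}"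

definition E_max :: "'v star_vs \<Rightarrow> nat \<Rightarrow> 'v \<Rightarrow> (nat \<Rightarrow> 'v) \<Rightarrow> nat \<Rightarrow> 'v mat set" where
  "E_max V N e p n = {x \<in> herm n V. \<forall>\<epsilon>>0.
     mat_add V x (mat_scale V \<epsilon> (tensor V (1\<^sub>m n) e)) \<in> D_max V N e p n}"

text \<open>\<open>n mod N + 1\<close> is the index in \<open>{1..N}\<close> that is congruent to \<open>n + 1\<close> modulo \<open>N\<close>.\<close>

primrec E_seq :: "nat \<Rightarrow> 'v star_vs \<Rightarrow> nat \<Rightarrow> 'v \<Rightarrow> (nat \<Rightarrow> 'v) \<Rightarrow> nat \<Rightarrow> 'v mat set" where
  "E_seq k V N e p 0 = E_max V N e p k"
| "E_seq k V N e p (Suc n) = proj_cone k V e (p (n mod N + 1)) (E_seq k V N e p n)"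

definition E_proj :: "nat \<Rightarrow> nat \<Rightarrow> real mat \<Rightarrow> complex vec set mat set" where
  "E_proj k N M = (let U = univ_space N M; e = univ_unit N M in
     {x \<in> herm k U. \<forall>\<epsilon>>0. \<exists>n.
        mat_add U x (mat_scale U \<epsilon> (tensor U (1\<^sub>m k) e)) \<in> E_seq k U N e (univ_gen N M) n})"

end

theory Submission
  imports Defs
begin

text \<open>
Both claims rest on one observation: the construction of \<open>E_proj\<close> is a sequence of monotone steps, each
of which turns a set of hermitian matrices that is closed under sums and under compressions
\<open>x \<mapsto> \<alpha>\<^sup>* x \<alpha>\<close> into a set of the same kind. Such sets are called compression cones below
(\<open>compress_cone\<close>); properness and the Archimedean property are not part of the notion, because they
are only available at the end.

\<^emph>\<open>The steps preserve compression cones.\<close> A compression cone that contains \<open>I \<otimes> v\<close> contains \<open>A \<otimes> v\<close>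
for every positive semidefinite \<open>A\<close>, since \<open>\<beta>\<^sup>*\<beta> \<otimes> v\<close> is the compression of \<open>I \<otimes> v\<close> by \<open>\<beta>\<close>. So \<open>C \<subseteq> C[p]\<close>
when \<open>C\<close> contains \<open>I \<otimes> p\<close> and \<open>I \<otimes> (e - p)\<close>. The Archimedean closure and \<open>C[p]\<close> are again compression
cones: compressing by \<open>\<gamma>\<close> turns an error term \<open>\<epsilon> \<alpha>\<^sup>*\<alpha>\<close> into \<open>\<epsilon> (\<gamma>\<alpha>)\<^sup>*(\<gamma>\<alpha>)\<close>, which is at most \<open>\<epsilon> s \<alpha>\<^sup>*\<alpha>\<close>
once \<open>\<gamma>\<^sup>*\<gamma> \<le> s\<close>, and the missing part is a positive semidefinite matrix that can be added
(\<open>compress_cone_proj_cone\<close>, \<open>compress_cone_arch_closure\<close>). A bound \<open>s\<close> comes from the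
parallelogram law (\<open>psd_gram_bound\<close>).

\<^emph>\<open>The unit.\<close> Every hermitian matrix over the universal space is \<open>\<Sum>\<^sub>l A\<^sub>l \<otimes> p\<^sub>l\<close> with hermitian \<open>A\<^sub>l\<close> and \<open>p\<^sub>0 = e\<close>, and
\<open>t I \<otimes> e - A\<^sub>l \<otimes> p\<^sub>l = (t - A\<^sub>l) \<otimes> p\<^sub>l + t I \<otimes> (e - p\<^sub>l)\<close> lies in the cone for large \<open>t\<close>. Hence \<open>I \<otimes> e\<close> is an
order unit (\<open>dominated_by_unit\<close>); it is Archimedean because \<open>E_proj\<close> is an Archimedean closure.

\<^emph>\<open>The universal map.\<close> Let \<open>\<pi>\<close> send the generators to abstract projections of a \<open>k\<close>-AOU space with cone
\<open>C\<close>. The matrices that \<open>\<pi>\<close> maps into \<open>C\<close> form an Archimedean compression cone, which contains the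
amplified generators and their complements and is stable under each \<open>C \<mapsto> C[p\<^sub>i]\<close>, because \<open>C = C[q\<^sub>i]\<close> and the
conditions defining \<open>C[p]\<close> are transported by \<open>\<pi>\<close>. Since the steps are monotone, it contains \<open>E_proj\<close>
(\<open>E_seq_minimal\<close>, \<open>E_proj_limit_in_preimage\<close>), so \<open>\<pi>\<close> is \<open>k\<close>-positive.

\<^emph>\<open>Properness.\<close> If the unit and the projections span a space whose dimension is that of the universal space, then
\<open>\<pi>\<close> is a linear bijection. If \<open>x\<close> and \<open>-x\<close> lie in \<open>E_proj\<close>, then \<open>\<pi>(x)\<close> and \<open>-\<pi>(x)\<close> lie in the proper cone
\<open>C\<close>, so \<open>\<pi>(x) = 0\<close> and \<open>x = 0\<close>.
\<close>

section \<open>Sums of Gram matrices\<close>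

lemma mat_adjoint_carrier [simp, intro]:
  "A \<in> carrier_mat m n \<Longrightarrow> mat_adjoint A \<in> carrier_mat n m"
  unfolding mat_adjoint_def by auto

lemma mat_adjoint_dims [simp]: "dim_row (mat_adjoint A) = dim_col A" "dim_col (mat_adjoint A) = dim_row A"
  unfolding mat_adjoint_def by auto

lemma mat_adjoint_index [simp]:
  fixes A :: "complex mat"
  shows "i < dim_col A \<Longrightarrow> j < dim_row A \<Longrightarrow> mat_adjoint A $$ (i, j) = cnj (A $$ (j, i))"
  unfolding mat_adjoint_def mat_of_rows_def by (simp add: conjugate_complex_def)

lemma mat_adjoint_mult:
  fixes A B :: "complex mat"
  assumes "A \<in> carrier_mat l m" "B \<in> carrier_mat m n"
  shows "mat_adjoint (A * B) = mat_adjoint B * mat_adjoint A"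
  using assms by (intro eq_matI) (auto simp: scalar_prod_def mult.commute intro!: sum.cong)

lemma gram_index:
  fixes A :: "complex mat"
  assumes "A \<in> carrier_mat m n" "i < n" "j < n"
  shows "(mat_adjoint A * A) $$ (i, j) = (\<Sum>l<m. cnj (A $$ (l, i)) * A $$ (l, j))"
  using assms by (auto simp: scalar_prod_def lessThan_atLeast0 intro!: sum.cong)

text \<open>
The positive semidefinite matrices. Describing them as sums of Gram matrices lets membership of
\<open>A \<otimes> v\<close> in a cone follow from closure under compressions and sums, without a spectral theorem.
\<close>

inductive psd :: "nat \<Rightarrow> complex mat \<Rightarrow> bool" for k where
  gram: "\<beta> \<in> carrier_mat k k \<Longrightarrow> psd k (mat_adjoint \<beta> * \<beta>)"
| add: "psd k A \<Longrightarrow> psd k B \<Longrightarrow> psd k (A + B)"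

lemma psd_carrier: "psd k A \<Longrightarrow> A \<in> carrier_mat k k"
  by (induction rule: psd.induct) auto

lemma psd_compress:
  assumes "psd k A" "\<gamma> \<in> carrier_mat k k"
  shows "psd k (mat_adjoint \<gamma> * A * \<gamma>)"
  using assms
proof (induction rule: psd.induct)
  case (gram \<beta>)
  then have "mat_adjoint \<gamma> * (mat_adjoint \<beta> * \<beta>) * \<gamma> = mat_adjoint (\<beta> * \<gamma>) * (\<beta> * \<gamma>)"
    by (simp add: mat_adjoint_mult[of _ k k _ k] assoc_mult_mat[of _ k k _ k _ k]
        mult_carrier_mat[of _ k k _ k])
  then show ?case using psd.gram[of "\<beta> * \<gamma>" k] gram by simp
next
  case (add A B)
  have "mat_adjoint \<gamma> * (A + B) * \<gamma> = mat_adjoint \<gamma> * A * \<gamma> + mat_adjoint \<gamma> * B * \<gamma>"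
    using psd_carrier[OF add.hyps(1)] psd_carrier[OF add.hyps(2)] add.prems
    by (simp add: mult_add_distrib_mat[of _ k k _ k] add_mult_distrib_mat[of _ k k _ _ k]
        mult_carrier_mat[of _ k k _ k])
  then show ?case using add by (simp add: psd.add)
qed

text \<open>
Scaling by \<open>r\<close> is compression by \<open>\<surd>r\<close> times the identity.
\<close>

lemma psd_smult:
  assumes "psd k A" "0 \<le> r"
  shows "psd k (complex_of_real r \<cdot>\<^sub>m A)"
proof -
  define \<gamma> :: "complex mat" where "\<gamma> = complex_of_real (sqrt r) \<cdot>\<^sub>m 1\<^sub>m k"
  have A: "A \<in> carrier_mat k k" using psd_carrier assms(1) by blast
  have adj: "mat_adjoint \<gamma> = \<gamma>"
    unfolding \<gamma>_def by (rule eq_matI) auto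
  have "mat_adjoint \<gamma> * A * \<gamma> = complex_of_real r \<cdot>\<^sub>m A"
    unfolding adj unfolding \<gamma>_def using A assms(2)
    by (simp add: mult_smult_distrib[of _ k k _ k] mult_smult_assoc_mat[of _ k k _ k] 
)
      (auto intro!: eq_matI simp flip: of_real_mult mult.assoc)
  then show ?thesis using psd_compress[OF assms(1), of \<gamma>] by (simp add: \<gamma>_def)
qed

text \<open>
A matrix is built from \<open>0\<close> by adding its entries one at a time; the proof runs through them in the
row-major order given by \<open>i * k + j\<close>.
\<close>

lemma matrix_induct [consumes 1, case_names zero add unit]:
  fixes A :: "complex mat"
  assumes A: "A \<in> carrier_mat k k"
    and zero: "P (0\<^sub>m k k)"
    and add: "\<And>A B. A \<in> carrier_mat k k \<Longrightarrow> B \<in> carrier_mat k k \<Longrightarrow> P A \<Longrightarrow> P B \<Longrightarrow> P (A + B)"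
    and unit: "\<And>a b c. a < k \<Longrightarrow> b < k \<Longrightarrow> P (mat k k (\<lambda>ij. if ij = (a, b) then c else 0))"
  shows "P A"
proof -
  define T where "T n = mat k k (\<lambda>(i, j). if i * k + j < n then A $$ (i, j) else 0)" for n
  have "n \<le> k * k \<Longrightarrow> P (T n)" for n
  proof (induction n)
    case 0
    have "T 0 = 0\<^sub>m k k" unfolding T_def by (rule eq_matI) auto
    then show ?case using zero by simp
  next
    case (Suc n)
    define a b where "a = n div k" and "b = n mod k"
    have k: "k > 0" using Suc.prems by (cases k) auto
    have ab: "a < k" "b < k" "n = a * k + b"
      unfolding a_def b_def using k Suc.prems by (auto simp: less_mult_imp_div_less)
    have iff: "i * k + j = n \<longleftrightarrow> i = a \<and> j = b" if "j < k" for i j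
    proof -
      have "(i * k + j) div k = i" "(i * k + j) mod k = j" using that by auto
      then show ?thesis unfolding a_def b_def by auto
    qed
    have n: "\<not> a * k + b < n" using ab by simp
    have "T (Suc n) = T n + mat k k (\<lambda>ij. if ij = (a, b) then A $$ (a, b) else 0)"
      unfolding T_def using iff n by (intro eq_matI) (auto simp: less_Suc_eq)
    then show ?case
      using add[OF _ _ Suc.IH unit[of a b "A $$ (a, b)"]] Suc.prems ab by (simp add: T_def)
  qed
  moreover have "T (k * k) = A"
  proof (rule eq_matI)
    fix i j assume "i < dim_row A" "j < dim_col A"
    then have ij: "i < k" "j < k" using A by auto
    have "i * k + j < Suc i * k" using ij by simp
    also have "\<dots> \<le> k * k" using ij by (intro mult_le_mono1) simp
    finally show "T (k * k) $$ (i, j) = A $$ (i, j)" using ij by (simp add: T_def)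
  qed (use A in \<open>auto simp: T_def\<close>)
  ultimately show ?thesis by (metis le_refl)
qed

text \<open>
A substitute for \<open>\<gamma>\<^sup>*\<gamma> \<le> \<parallel>\<gamma>\<parallel>\<^sup>2\<close>. The matrices \<open>\<gamma>\<close> that admit some bound include those with a single nonzero
entry, and they are closed under sums by the parallelogram law
\<open>(A + B)\<^sup>*(A + B) + (A - B)\<^sup>*(A - B) = 2 A\<^sup>*A + 2 B\<^sup>*B\<close>.
\<close>

lemma psd_gram_bound:
  assumes "\<gamma> \<in> carrier_mat k k"
  shows "\<exists>t>0. psd k (complex_of_real t \<cdot>\<^sub>m 1\<^sub>m k - mat_adjoint \<gamma> * \<gamma>)"
  using assms
proof (induction rule: matrix_induct)
  case zero
  have "complex_of_real 1 \<cdot>\<^sub>m 1\<^sub>m k - mat_adjoint (0\<^sub>m k k) * 0\<^sub>m k k = mat_adjoint (1\<^sub>m k) * 1\<^sub>m k"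
    by (intro eq_matI) (auto simp: scalar_prod_def)
  then show ?case using psd.gram[of "1\<^sub>m k" k] by (intro exI[of _ 1]) simp
next
  case (add A B)
  obtain s t where s: "s > 0" "psd k (complex_of_real s \<cdot>\<^sub>m 1\<^sub>m k - mat_adjoint A * A)"
    and t: "t > 0" "psd k (complex_of_real t \<cdot>\<^sub>m 1\<^sub>m k - mat_adjoint B * B)"
    using add.IH by blast
  have "complex_of_real (2 * s + 2 * t) \<cdot>\<^sub>m 1\<^sub>m k - mat_adjoint (A + B) * (A + B)
      = complex_of_real 2 \<cdot>\<^sub>m (complex_of_real s \<cdot>\<^sub>m 1\<^sub>m k - mat_adjoint A * A)
      + complex_of_real 2 \<cdot>\<^sub>m (complex_of_real t \<cdot>\<^sub>m 1\<^sub>m k - mat_adjoint B * B)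
      + mat_adjoint (A - B) * (A - B)" (is "?L = ?R")
  proof (rule eq_matI)
    fix i j assume "i < dim_row ?R" "j < dim_col ?R"
    then have ij: "i < k" "j < k" using add by auto
    have g: "(mat_adjoint C * C) $$ (i, j) = (\<Sum>l<k. cnj (C $$ (l, i)) * C $$ (l, j))"
      if "C \<in> carrier_mat k k" for C using gram_index[OF that ij] .
    have pointwise: "cnj ((A + B) $$ (l, i)) * (A + B) $$ (l, j)
        = 2 * (cnj (A $$ (l, i)) * A $$ (l, j)) + 2 * (cnj (B $$ (l, i)) * B $$ (l, j))
        - cnj ((A - B) $$ (l, i)) * (A - B) $$ (l, j)" if "l < k" for l
    proof -
      have "cnj (x + y) * (z + w) = 2 * (cnj x * z) + 2 * (cnj y * w) - cnj (x - y) * (z - w)"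
        for x y z w :: complex by (simp add: ring_distribs)
      then show ?thesis using add.hyps ij that by simp
    qed
    have AB: "A + B \<in> carrier_mat k k" "A - B \<in> carrier_mat k k" using add.hyps by auto
    have "(mat_adjoint (A + B) * (A + B)) $$ (i, j)
       = 2 * (mat_adjoint A * A) $$ (i, j) + 2 * (mat_adjoint B * B) $$ (i, j)
       - (mat_adjoint (A - B) * (A - B)) $$ (i, j)"
      unfolding g[OF AB(1)] g[OF AB(2)] g[OF add.hyps(1)] g[OF add.hyps(2)]
      by (simp only: sum_distrib_left flip: sum.distrib sum_subtractf)
         (intro sum.cong refl pointwise, simp)
    then show "?L $$ (i, j) = ?R $$ (i, j)"
      using add.hyps ij by (simp add: ring_distribs del: index_mult_mat(1))
  qed (use add in auto)
  moreover have "psd k ?R"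
    using s t add by (intro psd.add psd_smult psd.gram) auto
  ultimately show ?case using s(1) t(1) by (metis add_pos_pos mult_pos_pos zero_less_numeral)
next
  case (unit a b c)
  let ?\<gamma> = "mat k k (\<lambda>ij. if ij = (a, b) then c else 0)"
  \<comment> \<open>The bound is \<open>1 + |c|\<^sup>2\<close>, and the difference is the square of a diagonal matrix: the Gram matrix has its only nonzero entry, \<open>|c|\<^sup>2\<close>, at \<open>(b, b)\<close>.\<close>
  define \<eta> where "\<eta> = mat k k (\<lambda>(i, j). if i = j then (if i = b then 1 else complex_of_real (sqrt (1 + (cmod c)\<^sup>2))) else 0)"
  have "complex_of_real (1 + (cmod c)\<^sup>2) \<cdot>\<^sub>m 1\<^sub>m k - mat_adjoint ?\<gamma> * ?\<gamma> = mat_adjoint \<eta> * \<eta>" (is "?L = ?R")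
  proof (rule eq_matI)
    fix i j assume "i < dim_row ?R" "j < dim_col ?R"
    then have ij: "i < k" "j < k" by (auto simp: \<eta>_def)
    have sq: "complex_of_real (sqrt (1 + (cmod c)\<^sup>2)) * complex_of_real (sqrt (1 + (cmod c)\<^sup>2)) = 1 + (complex_of_real (cmod c))\<^sup>2"
      by (simp flip: of_real_mult)
    have 1: "(mat_adjoint ?\<gamma> * ?\<gamma>) $$ (i, j) = (if i = b \<and> j = b then cnj c * c else 0)"
    proof -
      have "(mat_adjoint ?\<gamma> * ?\<gamma>) $$ (i, j) = (\<Sum>l<k. cnj (?\<gamma> $$ (l, i)) * ?\<gamma> $$ (l, j))"
        by (rule gram_index) (use ij in auto)
      also have "\<dots> = (\<Sum>l<k. if l = a then (if i = b \<and> j = b then cnj c * c else 0) else 0)"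
        by (rule sum.cong) (use ij in auto)
      finally show ?thesis using unit by simp
    qed
    have 2: "?R $$ (i, j) = (\<Sum>l<k. if l = i then cnj (\<eta> $$ (i, i)) * \<eta> $$ (i, j) else 0)"
    proof -
      have "?R $$ (i, j) = (\<Sum>l<k. cnj (\<eta> $$ (l, i)) * \<eta> $$ (l, j))"
        by (rule gram_index) (use ij in \<open>auto simp: \<eta>_def\<close>)
      also have "\<dots> = (\<Sum>l<k. if l = i then cnj (\<eta> $$ (i, i)) * \<eta> $$ (i, j) else 0)"
        by (rule sum.cong) (use ij in \<open>auto simp: \<eta>_def\<close>)
      finally show ?thesis .
    qed
    have norm: "(complex_of_real (cmod c))\<^sup>2 = c * cnj c"
      by (metis complex_norm_square of_real_power)
    show "?L $$ (i, j) = ?R $$ (i, j)"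
      using ij unfolding 2
      by (simp add: 1 \<eta>_def sq norm mult.commute del: index_mult_mat(1))
  qed (auto simp: \<eta>_def)
  moreover have "psd k ?R" by (rule psd.gram) (simp add: \<eta>_def)
  ultimately show ?case
    by (intro exI[of _ "1 + (cmod c)\<^sup>2"]) (simp add: add_pos_nonneg)
qed

text \<open>
For hermitian \<open>A\<close> the Gram matrix \<open>(1 - A)\<^sup>*(1 - A) = 1 - 2 A + A\<^sup>*A\<close> gives \<open>2 A \<le> 1 + A\<^sup>*A\<close>, and \<open>A\<^sup>*A\<close> is
bounded.
\<close>

lemma psd_hermitian_bound:
  assumes A: "A \<in> carrier_mat k k" and h: "mat_adjoint A = A"
  shows "\<exists>t>0. psd k (complex_of_real t \<cdot>\<^sub>m 1\<^sub>m k - A)"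
proof -
  obtain t where t: "t > 0" "psd k (complex_of_real t \<cdot>\<^sub>m 1\<^sub>m k - mat_adjoint A * A)"
    using psd_gram_bound[OF A] by blast
  let ?B = "1\<^sub>m k - A"
  have "complex_of_real ((t + 1) / 2) \<cdot>\<^sub>m 1\<^sub>m k - A
      = complex_of_real (1 / 2) \<cdot>\<^sub>m ((complex_of_real t \<cdot>\<^sub>m 1\<^sub>m k - mat_adjoint A * A) + mat_adjoint ?B * ?B)"
    (is "?L = ?R")
  proof (rule eq_matI)
    fix i j assume "i < dim_row ?R" "j < dim_col ?R"
    then have ij: "i < k" "j < k" using A by auto
    have cnj: "cnj (A $$ (j, i)) = A $$ (i, j)" if "i < k" "j < k" for i j
      using arg_cong[OF h, of "\<lambda>B. B $$ (i, j)"] A that by simp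
    have adj: "mat_adjoint ?B = 1\<^sub>m k - A"
      using A by (intro eq_matI) (auto simp: cnj)
    have "mat_adjoint ?B * ?B = 1\<^sub>m k - A - A + A * A"
      unfolding adj using A
      by (auto intro!: eq_matI simp: minus_mult_distrib_mat[of "1\<^sub>m k" k k A "1\<^sub>m k - A" k]
          minus_mult_distrib_mat[of "1\<^sub>m k" k k A A k]
          mult_minus_distrib_mat[of _ k k "1\<^sub>m k" k A] minus_carrier_mat[of A k k])
    then show "?L $$ (i, j) = ?R $$ (i, j)"
      using A ij by (simp add: h field_simps)
  qed (use A in auto)
  moreover have "psd k ?R"
    using t A by (intro psd_smult psd.add psd.gram) auto
  ultimately show ?thesis using t(1) by (intro exI[of _ "(t + 1) / 2"]) simp
qed

section \<open>Matrices over a star-vector space\<close>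

context star_vector_space
begin

text \<open>
The module axioms speak of the operations of the record \<open>class_ring\<close>, which the simplifier unfolds to
plain complex arithmetic; the following restatements are usable in that form.
\<close>

lemma scale_closed [simp, intro]: "v \<in> carrier V \<Longrightarrow> c \<odot>\<^bsub>V\<^esub> v \<in> carrier V"
  by (rule smult_closed) simp_all

lemma scale_left_distrib:
  "v \<in> carrier V \<Longrightarrow> (c + d) \<odot>\<^bsub>V\<^esub> v = c \<odot>\<^bsub>V\<^esub> v \<oplus>\<^bsub>V\<^esub> d \<odot>\<^bsub>V\<^esub> v"
  using smult_l_distr[of c d v] by simp

lemma scale_right_distrib:
  "v \<in> carrier V \<Longrightarrow> w \<in> carrier V \<Longrightarrow> c \<odot>\<^bsub>V\<^esub> (v \<oplus>\<^bsub>V\<^esub> w) = c \<odot>\<^bsub>V\<^esub> v \<oplus>\<^bsub>V\<^esub> c \<odot>\<^bsub>V\<^esub> w"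
  using smult_r_distr[of c v w] by simp

lemma scale_scale [simp]: "v \<in> carrier V \<Longrightarrow> c \<odot>\<^bsub>V\<^esub> (d \<odot>\<^bsub>V\<^esub> v) = (c * d) \<odot>\<^bsub>V\<^esub> v"
  using smult_assoc1[of c d v] by simp

lemma scale_one [simp]: "v \<in> carrier V \<Longrightarrow> 1 \<odot>\<^bsub>V\<^esub> v = v"
  using smult_one[of v] by simp

lemma scale_zero_left [simp]: "v \<in> carrier V \<Longrightarrow> 0 \<odot>\<^bsub>V\<^esub> v = \<zero>\<^bsub>V\<^esub>"
  using lmult_0[of v] by simp

lemma scale_zero_right [simp]: "c \<odot>\<^bsub>V\<^esub> \<zero>\<^bsub>V\<^esub> = \<zero>\<^bsub>V\<^esub>"
  using rmult_0[of c] by simp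

lemma scale_minus_one: "v \<in> carrier V \<Longrightarrow> (- 1) \<odot>\<^bsub>V\<^esub> v = \<ominus>\<^bsub>V\<^esub> v"
  using smult_minus_1[of v] by (simp add: class_ring_simps)

lemma neg_scale: "v \<in> carrier V \<Longrightarrow> \<ominus>\<^bsub>V\<^esub> (c \<odot>\<^bsub>V\<^esub> v) = (- c) \<odot>\<^bsub>V\<^esub> v"
  using scale_minus_one[of "c \<odot>\<^bsub>V\<^esub> v"] by simp

lemma scale_finsum:
  "(\<And>i. i \<in> I \<Longrightarrow> f i \<in> carrier V) \<Longrightarrow> c \<odot>\<^bsub>V\<^esub> (\<Oplus>\<^bsub>V\<^esub>i\<in>I. f i) = (\<Oplus>\<^bsub>V\<^esub>i\<in>I. c \<odot>\<^bsub>V\<^esub> f i)"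
  using finsum_smult[of c f I] by (simp add: Pi_def)

lemma sum_scale:
  "v \<in> carrier V \<Longrightarrow> (\<Sum>i\<in>I. c i) \<odot>\<^bsub>V\<^esub> v = (\<Oplus>\<^bsub>V\<^esub>i\<in>I. c i \<odot>\<^bsub>V\<^esub> v)"
  using finsum_smult_r[of v c I] by (simp add: class_ring_simps)

lemma finsum_mem: "(\<And>i. i \<in> I \<Longrightarrow> f i \<in> carrier V) \<Longrightarrow> (\<Oplus>\<^bsub>V\<^esub>i\<in>I. f i) \<in> carrier V"
  by (rule M.finsum_closed) auto

lemma finsum_plus:
  "(\<And>i. i \<in> I \<Longrightarrow> f i \<in> carrier V) \<Longrightarrow> (\<And>i. i \<in> I \<Longrightarrow> g i \<in> carrier V) \<Longrightarrow>
   (\<Oplus>\<^bsub>V\<^esub>i\<in>I. f i \<oplus>\<^bsub>V\<^esub> g i) = (\<Oplus>\<^bsub>V\<^esub>i\<in>I. f i) \<oplus>\<^bsub>V\<^esub> (\<Oplus>\<^bsub>V\<^esub>i\<in>I. g i)"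
  by (rule M.finsum_addf) auto

lemma finsum_eq:
  "(\<And>i. i \<in> I \<Longrightarrow> f i = g i) \<Longrightarrow> (\<And>i. i \<in> I \<Longrightarrow> g i \<in> carrier V) \<Longrightarrow>
   (\<Oplus>\<^bsub>V\<^esub>i\<in>I. f i) = (\<Oplus>\<^bsub>V\<^esub>i\<in>I. g i)"
  by (rule M.finsum_cong') auto

lemma finsum_lessThan_Suc:
  "(\<And>i. i \<le> n \<Longrightarrow> f i \<in> carrier V) \<Longrightarrow> (\<Oplus>\<^bsub>V\<^esub>i\<in>{..<Suc n}. f i) = (\<Oplus>\<^bsub>V\<^esub>i\<in>{..<n}. f i) \<oplus>\<^bsub>V\<^esub> f n"
  unfolding lessThan_Suc
  by (subst M.finsum_insert) (auto intro!: M.add.m_comm finsum_mem)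

lemma finsum_single:
  assumes "finite I" "i \<in> I" "f i \<in> carrier V" "\<And>j. j \<in> I \<Longrightarrow> j \<noteq> i \<Longrightarrow> f j = \<zero>\<^bsub>V\<^esub>"
  shows "(\<Oplus>\<^bsub>V\<^esub>j\<in>I. f j) = f i"
proof -
  have "(\<Oplus>\<^bsub>V\<^esub>j\<in>I. f j) = (\<Oplus>\<^bsub>V\<^esub>j\<in>I. if i = j then f i else \<zero>\<^bsub>V\<^esub>)"
    using assms by (intro finsum_eq) auto
  also have "\<dots> = f i"
    using M.finsum_singleton[of i I "\<lambda>_. f i"] assms by auto
  finally show ?thesis .
qed

lemma finsum_swap:
  fixes m :: nat
  assumes "\<And>a b. a < m \<Longrightarrow> b \<in> J \<Longrightarrow> f a b \<in> carrier V"
  shows "(\<Oplus>\<^bsub>V\<^esub>a\<in>{..<m}. \<Oplus>\<^bsub>V\<^esub>b\<in>J. f a b) = (\<Oplus>\<^bsub>V\<^esub>b\<in>J. \<Oplus>\<^bsub>V\<^esub>a\<in>{..<m}. f a b)"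
  using assms
proof (induction m)
  case 0
  then show ?case by (simp add: M.finsum_zero)
next
  case (Suc m)
  have "(\<Oplus>\<^bsub>V\<^esub>b\<in>J. \<Oplus>\<^bsub>V\<^esub>a\<in>{..<Suc m}. f a b) = (\<Oplus>\<^bsub>V\<^esub>b\<in>J. (\<Oplus>\<^bsub>V\<^esub>a\<in>{..<m}. f a b) \<oplus>\<^bsub>V\<^esub> f m b)"
    using Suc.prems by (intro finsum_eq finsum_lessThan_Suc M.a_closed finsum_mem) auto
  also have "\<dots> = (\<Oplus>\<^bsub>V\<^esub>b\<in>J. \<Oplus>\<^bsub>V\<^esub>a\<in>{..<m}. f a b) \<oplus>\<^bsub>V\<^esub> (\<Oplus>\<^bsub>V\<^esub>b\<in>J. f m b)"
    using Suc.prems by (intro finsum_plus finsum_mem) auto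
  also have "\<dots> = (\<Oplus>\<^bsub>V\<^esub>a\<in>{..<Suc m}. \<Oplus>\<^bsub>V\<^esub>b\<in>J. f a b)"
    using Suc by (subst finsum_lessThan_Suc) (auto intro!: finsum_mem)
  finally show ?case by simp
qed

lemma star_zero [simp]: "star V \<zero>\<^bsub>V\<^esub> = \<zero>\<^bsub>V\<^esub>"
  using star_smult[of "\<zero>\<^bsub>V\<^esub>" 0] star_closed[of "\<zero>\<^bsub>V\<^esub>"] by simp

lemma star_finsum:
  assumes "\<And>i. i \<in> I \<Longrightarrow> f i \<in> carrier V"
  shows "star V (\<Oplus>\<^bsub>V\<^esub>i\<in>I. f i) = (\<Oplus>\<^bsub>V\<^esub>i\<in>I. star V (f i))"
  using assms
proof (induction I rule: infinite_finite_induct)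
  case (insert i I)
  then show ?case
    by (simp add: M.finsum_insert star_closed Pi_def star_add finsum_mem)
qed (auto simp: M.finsum_infinite)

lemma star_minus:
  "v \<in> carrier V \<Longrightarrow> w \<in> carrier V \<Longrightarrow> star V (v \<ominus>\<^bsub>V\<^esub> w) = star V v \<ominus>\<^bsub>V\<^esub> star V w"
  using scale_minus_one[of w] scale_minus_one[of "star V w"] star_smult[of w "-1"]
  by (simp add: a_minus_def star_add star_closed)

lemma matsD:
  assumes "x \<in> mats n V"
  shows "dim_row x = n" "dim_col x = n" "i < n \<Longrightarrow> j < n \<Longrightarrow> x $$ (i, j) \<in> carrier V"
  using assms unfolding mats_def by auto

lemma matsI:
  assumes "dim_row x = n" "dim_col x = n" "\<And>i j. i < n \<Longrightarrow> j < n \<Longrightarrow> x $$ (i, j) \<in> carrier V"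
  shows "x \<in> mats n V"
  using assms unfolding mats_def by auto

lemma hermD: "x \<in> herm n V \<Longrightarrow> x \<in> mats n V"
  "x \<in> herm n V \<Longrightarrow> i < n \<Longrightarrow> j < n \<Longrightarrow> star V (x $$ (i, j)) = x $$ (j, i)"
proof -
  show *: "x \<in> mats n V" if "x \<in> herm n V" for x using that by (simp add: herm_def)
  show "star V (x $$ (i, j)) = x $$ (j, i)" if x: "x \<in> herm n V" and ij: "i < n" "j < n" for i j
  proof -
    have "mat_star V x $$ (j, i) = x $$ (j, i)" using x by (simp add: herm_def)
    then show ?thesis using matsD(1,2)[OF *[OF x]] ij by (simp add: mat_star_def)
  qed
qed

lemma hermI:
  assumes "x \<in> mats n V" "\<And>i j. i < n \<Longrightarrow> j < n \<Longrightarrow> star V (x $$ (i, j)) = x $$ (j, i)"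
  shows "x \<in> herm n V"
  unfolding herm_def mat_star_def using assms matsD(1,2)[OF assms(1)]
  by (simp, intro eq_matI) simp_all

lemma mat_operation_dims [simp]:
  "dim_row (mat_add V x y) = dim_row x" "dim_col (mat_add V x y) = dim_col x"
  "dim_row (mat_scale V r x) = dim_row x" "dim_col (mat_scale V r x) = dim_col x"
  "dim_row (mat_neg V x) = dim_row x" "dim_col (mat_neg V x) = dim_col x"
  "dim_row (tensor V A v) = dim_row A" "dim_col (tensor V A v) = dim_col A"
  "dim_row (compress V \<alpha> x) = dim_col \<alpha>" "dim_col (compress V \<alpha> x) = dim_col \<alpha>"
  "dim_row (diag_matrix V m s) = m" "dim_col (diag_matrix V m s) = m"
  by (simp_all add: mat_add_def mat_scale_def mat_neg_def tensor_def compress_def diag_matrix_def)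

lemma mat_operation_index [simp]:
  assumes "i < dim_row x" "j < dim_col x"
  shows "mat_add V x y $$ (i, j) = x $$ (i, j) \<oplus>\<^bsub>V\<^esub> y $$ (i, j)"
    and "mat_scale V r x $$ (i, j) = complex_of_real r \<odot>\<^bsub>V\<^esub> x $$ (i, j)"
    and "mat_neg V x $$ (i, j) = \<ominus>\<^bsub>V\<^esub> x $$ (i, j)"
  using assms by (simp_all add: mat_add_def mat_scale_def mat_neg_def)

lemma mat_add_mats [simp, intro]:
  assumes "x \<in> mats n V" "y \<in> mats n V"
  shows "mat_add V x y \<in> mats n V"
  using matsD[OF assms(1)] matsD[OF assms(2)]
  by (intro matsI) simp_all

lemma tensor_index [simp]:
  "i < dim_row A \<Longrightarrow> j < dim_col A \<Longrightarrow> tensor V A v $$ (i, j) = A $$ (i, j) \<odot>\<^bsub>V\<^esub> v"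
  by (simp add: tensor_def)

lemma tensor_mats [simp, intro]: "A \<in> carrier_mat n n \<Longrightarrow> v \<in> carrier V \<Longrightarrow> tensor V A v \<in> mats n V"
  by (rule matsI) (simp_all add: tensor_def)

lemma mat_scale_mats [simp, intro]:
  assumes "x \<in> mats n V"
  shows "mat_scale V r x \<in> mats n V"
  using matsD[OF assms] by (intro matsI) simp_all

lemma diag_matrix_mats [simp, intro]:
  "(\<And>i. i < m \<Longrightarrow> s i \<in> carrier V) \<Longrightarrow> diag_matrix V m s \<in> mats m V"
  by (rule matsI) (simp_all add: diag_matrix_def)

lemma mats_eqI:
  assumes "x \<in> mats n V" "y \<in> mats n V" "\<And>i j. i < n \<Longrightarrow> j < n \<Longrightarrow> x $$ (i, j) = y $$ (i, j)"
  shows "x = y"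
  using assms(3) matsD(1,2)[OF assms(1)] matsD(1,2)[OF assms(2)] by (intro eq_matI) simp_all

text \<open>
Every entry of a compression of \<open>x\<close> is such a combination of the entries of \<open>x\<close>, so identities between
compressions reduce to identities between complex coefficients.
\<close>

definition entry_sum :: "(nat \<Rightarrow> nat \<Rightarrow> complex) \<Rightarrow> 'v mat \<Rightarrow> nat \<Rightarrow> 'v" where
  "entry_sum c x m = (\<Oplus>\<^bsub>V\<^esub>a\<in>{..<m}. \<Oplus>\<^bsub>V\<^esub>b\<in>{..<m}. c a b \<odot>\<^bsub>V\<^esub> x $$ (a, b))"

lemma entry_sum_closed:
  "x \<in> mats m V \<Longrightarrow> entry_sum c x m \<in> carrier V"
  unfolding entry_sum_def by (intro finsum_mem scale_closed) (simp add: matsD)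

lemma entry_sum_eq:
  assumes "x \<in> mats m V" "\<And>a b. a < m \<Longrightarrow> b < m \<Longrightarrow> c a b = d a b"
  shows "entry_sum c x m = entry_sum d x m"
  unfolding entry_sum_def using assms
  by (intro finsum_eq finsum_mem scale_closed) (simp_all add: matsD)

lemma entry_sum_add:
  assumes "x \<in> mats m V"
  shows "entry_sum (\<lambda>a b. c a b + d a b) x m = entry_sum c x m \<oplus>\<^bsub>V\<^esub> entry_sum d x m"
proof -
  have "entry_sum (\<lambda>a b. c a b + d a b) x m
      = (\<Oplus>\<^bsub>V\<^esub>a\<in>{..<m}. (\<Oplus>\<^bsub>V\<^esub>b\<in>{..<m}. c a b \<odot>\<^bsub>V\<^esub> x $$ (a, b)) \<oplus>\<^bsub>V\<^esub> (\<Oplus>\<^bsub>V\<^esub>b\<in>{..<m}. d a b \<odot>\<^bsub>V\<^esub> x $$ (a, b)))"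
    unfolding entry_sum_def
  proof (rule finsum_eq)
    fix a assume "a \<in> {..<m}"
    then have *: "x $$ (a, b) \<in> carrier V" if "b \<in> {..<m}" for b
      using that matsD(3)[OF assms] by simp
    have "(\<Oplus>\<^bsub>V\<^esub>b\<in>{..<m}. (c a b + d a b) \<odot>\<^bsub>V\<^esub> x $$ (a, b))
        = (\<Oplus>\<^bsub>V\<^esub>b\<in>{..<m}. c a b \<odot>\<^bsub>V\<^esub> x $$ (a, b) \<oplus>\<^bsub>V\<^esub> d a b \<odot>\<^bsub>V\<^esub> x $$ (a, b))"
      by (intro finsum_eq M.a_closed scale_closed scale_left_distrib) (use * in simp_all)
    also have "\<dots> = (\<Oplus>\<^bsub>V\<^esub>b\<in>{..<m}. c a b \<odot>\<^bsub>V\<^esub> x $$ (a, b)) \<oplus>\<^bsub>V\<^esub> (\<Oplus>\<^bsub>V\<^esub>b\<in>{..<m}. d a b \<odot>\<^bsub>V\<^esub> x $$ (a, b))"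
      by (intro finsum_plus scale_closed) (use * in simp_all)
    finally show "(\<Oplus>\<^bsub>V\<^esub>b\<in>{..<m}. (c a b + d a b) \<odot>\<^bsub>V\<^esub> x $$ (a, b)) = \<dots>" .
    show "\<dots> \<in> carrier V" by (intro M.a_closed finsum_mem scale_closed) (use * in simp_all)
  qed
  also have "\<dots> = entry_sum c x m \<oplus>\<^bsub>V\<^esub> entry_sum d x m"
    unfolding entry_sum_def
    by (intro finsum_plus finsum_mem scale_closed) (use matsD(3)[OF assms] in simp_all)
  finally show ?thesis .
qed

lemma entry_sum_scale:
  assumes "x \<in> mats m V"
  shows "r \<odot>\<^bsub>V\<^esub> entry_sum c x m = entry_sum (\<lambda>a b. r * c a b) x m"
proof -
  have x: "x $$ (a, b) \<in> carrier V" if "a \<in> {..<m}" "b \<in> {..<m}" for a b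
    using that matsD(3)[OF assms] by simp
  have "r \<odot>\<^bsub>V\<^esub> entry_sum c x m = (\<Oplus>\<^bsub>V\<^esub>a\<in>{..<m}. r \<odot>\<^bsub>V\<^esub> (\<Oplus>\<^bsub>V\<^esub>b\<in>{..<m}. c a b \<odot>\<^bsub>V\<^esub> x $$ (a, b)))"
    unfolding entry_sum_def by (intro scale_finsum finsum_mem scale_closed x)
  also have "\<dots> = (\<Oplus>\<^bsub>V\<^esub>a\<in>{..<m}. \<Oplus>\<^bsub>V\<^esub>b\<in>{..<m}. r \<odot>\<^bsub>V\<^esub> (c a b \<odot>\<^bsub>V\<^esub> x $$ (a, b)))"
    by (intro finsum_eq scale_finsum finsum_mem scale_closed x)
  also have "\<dots> = entry_sum (\<lambda>a b. r * c a b) x m"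
    unfolding entry_sum_def by (intro finsum_eq finsum_mem scale_closed scale_scale x)
  finally show ?thesis .
qed

lemma entry_sum_zero:
  assumes "x \<in> mats m V"
  shows "entry_sum (\<lambda>a b. 0) x m = \<zero>\<^bsub>V\<^esub>"
  using entry_sum_scale[OF assms, of 0 "\<lambda>a b. 0"] entry_sum_closed[OF assms] by simp

lemma entry_sum_sum:
  assumes "x \<in> mats m V"
  shows "finite I \<Longrightarrow> entry_sum (\<lambda>a b. \<Sum>i\<in>I. c i a b) x m = (\<Oplus>\<^bsub>V\<^esub>i\<in>I. entry_sum (c i) x m)"
proof (induction I rule: finite_induct)
  case empty
  then show ?case using entry_sum_zero[OF assms] by simp
next
  case (insert i I)
  then show ?case
    using entry_sum_add[OF assms, of "c i" "\<lambda>a b. \<Sum>i\<in>I. c i a b"] entry_sum_closed[OF assms]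
    by (simp add: M.finsum_insert Pi_def)
qed

lemma entry_sum_plus:
  assumes "x \<in> mats m V" "y \<in> mats m V"
  shows "entry_sum c (mat_add V x y) m = entry_sum c x m \<oplus>\<^bsub>V\<^esub> entry_sum c y m"
proof -
  have x: "x $$ (a, b) \<in> carrier V" and y: "y $$ (a, b) \<in> carrier V" if "a \<in> {..<m}" "b \<in> {..<m}" for a b
    using that matsD(3)[OF assms(1)] matsD(3)[OF assms(2)] by simp_all
  have "entry_sum c (mat_add V x y) m
      = (\<Oplus>\<^bsub>V\<^esub>a\<in>{..<m}. \<Oplus>\<^bsub>V\<^esub>b\<in>{..<m}. c a b \<odot>\<^bsub>V\<^esub> x $$ (a, b) \<oplus>\<^bsub>V\<^esub> c a b \<odot>\<^bsub>V\<^esub> y $$ (a, b))"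
    unfolding entry_sum_def
    by (intro finsum_eq finsum_mem M.a_closed scale_closed)
       (use x y matsD(1,2)[OF assms(1)] in \<open>simp_all add: scale_right_distrib\<close>)
  also have "\<dots> = (\<Oplus>\<^bsub>V\<^esub>a\<in>{..<m}. (\<Oplus>\<^bsub>V\<^esub>b\<in>{..<m}. c a b \<odot>\<^bsub>V\<^esub> x $$ (a, b)) \<oplus>\<^bsub>V\<^esub> (\<Oplus>\<^bsub>V\<^esub>b\<in>{..<m}. c a b \<odot>\<^bsub>V\<^esub> y $$ (a, b)))"
    by (intro finsum_eq finsum_plus finsum_mem M.a_closed scale_closed x y)
  also have "\<dots> = entry_sum c x m \<oplus>\<^bsub>V\<^esub> entry_sum c y m"
    unfolding entry_sum_def by (intro finsum_plus finsum_mem M.a_closed scale_closed x y)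
  finally show ?thesis .
qed

lemma star_entry_sum:
  assumes "x \<in> herm m V"
  shows "star V (entry_sum c x m) = entry_sum (\<lambda>a b. cnj (c b a)) x m"
proof -
  have x: "x $$ (a, b) \<in> carrier V" if "a \<in> {..<m}" "b \<in> {..<m}" for a b
    using that matsD(3)[OF hermD(1)[OF assms]] by simp
  have "star V (entry_sum c x m) = (\<Oplus>\<^bsub>V\<^esub>a\<in>{..<m}. star V (\<Oplus>\<^bsub>V\<^esub>b\<in>{..<m}. c a b \<odot>\<^bsub>V\<^esub> x $$ (a, b)))"
    unfolding entry_sum_def by (intro star_finsum finsum_mem scale_closed x)
  also have "\<dots> = (\<Oplus>\<^bsub>V\<^esub>a\<in>{..<m}. \<Oplus>\<^bsub>V\<^esub>b\<in>{..<m}. star V (c a b \<odot>\<^bsub>V\<^esub> x $$ (a, b)))"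
    by (intro finsum_eq star_finsum finsum_mem scale_closed star_closed x)
  also have "\<dots> = (\<Oplus>\<^bsub>V\<^esub>a\<in>{..<m}. \<Oplus>\<^bsub>V\<^esub>b\<in>{..<m}. cnj (c a b) \<odot>\<^bsub>V\<^esub> x $$ (b, a))"
    by (intro finsum_eq finsum_mem scale_closed) (use x hermD(2)[OF assms] in \<open>simp_all add: star_smult\<close>)
  also have "\<dots> = entry_sum (\<lambda>a b. cnj (c b a)) x m"
    unfolding entry_sum_def by (intro finsum_swap scale_closed x) simp_all
  finally show ?thesis .
qed

lemma compress_index:
  assumes "\<alpha> \<in> carrier_mat m n" "x \<in> mats m V" "i < n" "j < n"
  shows "compress V \<alpha> x $$ (i, j) = entry_sum (\<lambda>a b. cnj (\<alpha> $$ (a, i)) * \<alpha> $$ (b, j)) x m"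
  using assms(1,3,4) matsD(1,2)[OF assms(2)] by (simp add: compress_def entry_sum_def)

lemma compress_mats [simp, intro]:
  assumes "\<alpha> \<in> carrier_mat m n" "x \<in> mats m V"
  shows "compress V \<alpha> x \<in> mats n V"
  using compress_index[OF assms] entry_sum_closed[OF assms(2)] assms(1)
  by (intro matsI) (simp_all add: compress_def)

lemma compress_herm:
  assumes "\<alpha> \<in> carrier_mat m n" "x \<in> herm m V"
  shows "compress V \<alpha> x \<in> herm n V"
proof (rule hermI)
  have x: "x \<in> mats m V" using assms(2) by (rule hermD)
  show "compress V \<alpha> x \<in> mats n V" using assms(1) x by auto
  fix i j assume ij: "i < n" "j < n"
  show "star V (compress V \<alpha> x $$ (i, j)) = compress V \<alpha> x $$ (j, i)"
    unfolding compress_index[OF assms(1) x ij] compress_index[OF assms(1) x ij(2,1)] star_entry_sum[OF assms(2)]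
    by (rule entry_sum_eq[OF x]) simp
qed

lemma compress_add:
  assumes "\<alpha> \<in> carrier_mat m n" "x \<in> mats m V" "y \<in> mats m V"
  shows "compress V \<alpha> (mat_add V x y) = mat_add V (compress V \<alpha> x) (compress V \<alpha> y)"
proof (rule mats_eqI[of _ n])
  fix i j assume ij: "i < n" "j < n"
  show "compress V \<alpha> (mat_add V x y) $$ (i, j) = mat_add V (compress V \<alpha> x) (compress V \<alpha> y) $$ (i, j)"
    using assms(1) ij
    by (simp add: compress_index[OF assms(1) _ ij] assms(2,3) entry_sum_plus[OF assms(2,3)] mat_add_mats)
qed (intro mat_add_mats compress_mats[OF assms(1)] assms(2,3))+

text \<open>
The coefficients of the two nested sums multiply out to those of \<open>\<alpha> * \<beta>\<close>.
\<close>

lemma compress_compress: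
  assumes \<alpha>: "\<alpha> \<in> carrier_mat m n" and \<beta>: "\<beta> \<in> carrier_mat n l" and x: "x \<in> mats m V"
  shows "compress V \<beta> (compress V \<alpha> x) = compress V (\<alpha> * \<beta>) x"
proof (rule mats_eqI[of _ l])
  fix i j assume ij: "i < l" "j < l"
  have \<alpha>\<beta>: "\<alpha> * \<beta> \<in> carrier_mat m l" using \<alpha> \<beta> by simp
  have \<alpha>x: "compress V \<alpha> x \<in> mats n V" using \<alpha> x by auto
  let ?k = "\<lambda>c d. cnj (\<beta> $$ (c, i)) * \<beta> $$ (d, j)"
  let ?c = "\<lambda>c d a b. ?k c d * (cnj (\<alpha> $$ (a, c)) * \<alpha> $$ (b, d))"
  have "compress V \<beta> (compress V \<alpha> x) $$ (i, j)
      = (\<Oplus>\<^bsub>V\<^esub>c\<in>{..<n}. \<Oplus>\<^bsub>V\<^esub>d\<in>{..<n}. entry_sum (?c c d) x m)"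
    unfolding compress_index[OF \<beta> \<alpha>x ij] unfolding entry_sum_def[of _ "compress V \<alpha> x"]
  proof (intro finsum_eq finsum_mem entry_sum_closed x)
    fix c d assume cd: "c \<in> {..<n}" "d \<in> {..<n}"
    then have "c < n" "d < n" by simp_all
    then show "?k c d \<odot>\<^bsub>V\<^esub> compress V \<alpha> x $$ (c, d) = entry_sum (?c c d) x m"
      by (simp only: compress_index[OF \<alpha> x] entry_sum_scale[OF x])
  qed
  also have "\<dots> = (\<Oplus>\<^bsub>V\<^esub>c\<in>{..<n}. entry_sum (\<lambda>a b. \<Sum>d<n. ?c c d a b) x m)"
    by (intro finsum_eq entry_sum_sum[OF x, symmetric] entry_sum_closed x) simp
  also have "\<dots> = entry_sum (\<lambda>a b. \<Sum>c<n. \<Sum>d<n. ?c c d a b) x m"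
    by (rule entry_sum_sum[OF x, symmetric]) simp
  also have "\<dots> = compress V (\<alpha> * \<beta>) x $$ (i, j)"
    unfolding compress_index[OF \<alpha>\<beta> x ij]
  proof (rule entry_sum_eq[OF x])
    fix a b assume "a < m" "b < m"
    then have "(\<alpha> * \<beta>) $$ (a, i) = (\<Sum>c<n. \<alpha> $$ (a, c) * \<beta> $$ (c, i))"
      "(\<alpha> * \<beta>) $$ (b, j) = (\<Sum>c<n. \<alpha> $$ (b, c) * \<beta> $$ (c, j))"
      using \<alpha> \<beta> ij by (auto simp: scalar_prod_def lessThan_atLeast0)
    then show "(\<Sum>c<n. \<Sum>d<n. ?c c d a b) = cnj ((\<alpha> * \<beta>) $$ (a, i)) * (\<alpha> * \<beta>) $$ (b, j)"
      by (simp only: cnj_sum sum_product complex_cnj_mult) (intro sum.cong refl, simp add: mult_ac)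
  qed
  finally show "compress V \<beta> (compress V \<alpha> x) $$ (i, j) = compress V (\<alpha> * \<beta>) x $$ (i, j)" .
qed (intro compress_mats[OF \<beta>] compress_mats[OF \<alpha>] compress_mats[OF mult_carrier_mat[OF \<alpha> \<beta>]] x)+

lemma compress_diag_index:
  assumes \<alpha>: "\<alpha> \<in> carrier_mat m n" and s: "\<And>a. a < m \<Longrightarrow> s a \<in> carrier V" and ij: "i < n" "j < n"
  shows "compress V \<alpha> (diag_matrix V m s) $$ (i, j)
    = (\<Oplus>\<^bsub>V\<^esub>a\<in>{..<m}. (cnj (\<alpha> $$ (a, i)) * \<alpha> $$ (a, j)) \<odot>\<^bsub>V\<^esub> s a)"
proof -
  have d: "diag_matrix V m s \<in> mats m V" using s by auto
  show ?thesis
    unfolding compress_index[OF \<alpha> d ij] entry_sum_def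
  proof (rule finsum_eq)
    fix a assume a: "a \<in> {..<m}"
    show "(\<Oplus>\<^bsub>V\<^esub>b\<in>{..<m}. (cnj (\<alpha> $$ (a, i)) * \<alpha> $$ (b, j)) \<odot>\<^bsub>V\<^esub> diag_matrix V m s $$ (a, b))
        = (cnj (\<alpha> $$ (a, i)) * \<alpha> $$ (a, j)) \<odot>\<^bsub>V\<^esub> s a"
      using a s by (subst finsum_single[where i = a]) (auto simp: diag_matrix_def)
  qed (use s in auto)
qed

lemma tensor_one_diag: "v \<in> carrier V \<Longrightarrow> tensor V (1\<^sub>m n) v = diag_matrix V n (\<lambda>_. v)"
  by (rule eq_matI) (simp_all add: diag_matrix_def)

lemma compress_tensor_one:
  assumes \<alpha>: "\<alpha> \<in> carrier_mat m n" and v: "v \<in> carrier V"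
  shows "compress V \<alpha> (tensor V (1\<^sub>m m) v) = tensor V (mat_adjoint \<alpha> * \<alpha>) v"
  unfolding tensor_one_diag[OF v]
proof (rule mats_eqI[of _ n])
  fix i j assume ij: "i < n" "j < n"
  have "tensor V (mat_adjoint \<alpha> * \<alpha>) v $$ (i, j) = (mat_adjoint \<alpha> * \<alpha>) $$ (i, j) \<odot>\<^bsub>V\<^esub> v"
    using \<alpha> ij by (intro tensor_index) auto
  then show "compress V \<alpha> (diag_matrix V m (\<lambda>_. v)) $$ (i, j) = tensor V (mat_adjoint \<alpha> * \<alpha>) v $$ (i, j)"
    by (simp only: compress_diag_index[OF \<alpha> v ij] gram_index[OF \<alpha> ij] sum_scale[OF v])
qed (intro compress_mats[OF \<alpha>] diag_matrix_mats tensor_mats mult_carrier_mat[OF mat_adjoint_carrier[OF \<alpha>] \<alpha>] v)+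

text \<open>
Because of this, closure under compressions includes closure under nonnegative scalars.
\<close>

lemma mat_scale_compress:
  assumes x: "x \<in> mats n V" and r: "0 \<le> r"
  shows "mat_scale V r x = compress V (complex_of_real (sqrt r) \<cdot>\<^sub>m 1\<^sub>m n) x"
proof (rule mats_eqI[of _ n])
  fix i j assume ij: "i < n" "j < n"
  let ?\<gamma> = "complex_of_real (sqrt r) \<cdot>\<^sub>m 1\<^sub>m n :: complex mat"
  have \<gamma>: "?\<gamma> \<in> carrier_mat n n" by simp
  have sq: "complex_of_real (sqrt r) * complex_of_real (sqrt r) = complex_of_real r"
    using r by (simp flip: of_real_mult)
  have "compress V ?\<gamma> x $$ (i, j) = (\<Oplus>\<^bsub>V\<^esub>b\<in>{..<n}. (cnj (?\<gamma> $$ (i, i)) * ?\<gamma> $$ (b, j)) \<odot>\<^bsub>V\<^esub> x $$ (i, b))"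
    unfolding compress_index[OF \<gamma> x ij] entry_sum_def
    using ij matsD(3)[OF x] by (intro finsum_single[where i = i] finsum_mem) (auto intro!: M.add.finprod_one_eqI)
  also have "\<dots> = (cnj (?\<gamma> $$ (i, i)) * ?\<gamma> $$ (j, j)) \<odot>\<^bsub>V\<^esub> x $$ (i, j)"
    using ij matsD(3)[OF x] by (intro finsum_single[where i = j]) auto
  finally show "mat_scale V r x $$ (i, j) = compress V ?\<gamma> x $$ (i, j)"
    using ij matsD(1,2)[OF x] matsD(3)[OF x ij] sq by simp
qed (rule mat_scale_mats[OF x], rule compress_mats[OF _ x], simp)

lemma mat_add_comm:
  assumes "x \<in> mats n V" "y \<in> mats n V"
  shows "mat_add V x y = mat_add V y x"
  using matsD[OF assms(1)] matsD[OF assms(2)]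
  by (intro eq_matI) (simp_all add: M.add.m_comm)

lemma mat_add_assoc:
  assumes "x \<in> mats n V" "y \<in> mats n V" "z \<in> mats n V"
  shows "mat_add V (mat_add V x y) z = mat_add V x (mat_add V y z)"
  using matsD[OF assms(1)] matsD[OF assms(2)] matsD[OF assms(3)]
  by (intro eq_matI) (simp_all add: M.add.m_assoc)

lemma mat_add_left_comm:
  assumes "x \<in> mats n V" "y \<in> mats n V" "z \<in> mats n V"
  shows "mat_add V x (mat_add V y z) = mat_add V y (mat_add V x z)"
  by (simp only: mat_add_assoc[OF assms, symmetric] mat_add_comm[OF assms(1,2)] mat_add_assoc[OF assms(2,1,3)])

lemma mat_add_herm:
  assumes "x \<in> herm n V" "y \<in> herm n V"
  shows "mat_add V x y \<in> herm n V"
proof -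
  have x: "x \<in> mats n V" and y: "y \<in> mats n V" using assms hermD(1) by auto
  show ?thesis
    using matsD[OF x] matsD[OF y] hermD(2)[OF assms(1)] hermD(2)[OF assms(2)] x y
    by (intro hermI mat_add_mats) (simp_all add: star_add)
qed

lemma tensor_add_left:
  assumes "A \<in> carrier_mat n n" "B \<in> carrier_mat n n" "v \<in> carrier V"
  shows "tensor V (A + B) v = mat_add V (tensor V A v) (tensor V B v)"
  using assms by (intro eq_matI) (simp_all add: scale_left_distrib)

lemma tensor_add_right:
  assumes "v \<in> carrier V" "w \<in> carrier V"
  shows "tensor V A (v \<oplus>\<^bsub>V\<^esub> w) = mat_add V (tensor V A v) (tensor V A w)"
  using assms by (intro eq_matI) (simp_all add: scale_right_distrib)

lemma tensor_scale:
  assumes "v \<in> carrier V"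
  shows "tensor V A (complex_of_real r \<odot>\<^bsub>V\<^esub> v) = mat_scale V r (tensor V A v)"
  using assms by (intro eq_matI) (simp_all add: mult.commute)

lemma tensor_one_herm:
  assumes "v \<in> carrier V" "star V v = v"
  shows "tensor V (1\<^sub>m n) v \<in> herm n V"
  using assms by (intro hermI) (auto simp: star_smult)

lemma tensor_one_herm_imp:
  assumes "tensor V (1\<^sub>m n) v \<in> herm n V" "v \<in> carrier V" "1 \<le> n"
  shows "star V v = v"
  using hermD(2)[OF assms(1), of 0 0] assms(2,3) by simp

end

section \<open>Matrix cones closed under compression\<close>

lemma weighted_gram_add:
  assumes "X \<in> carrier_mat k k" "Y \<in> carrier_mat k k"
  shows "(complex_of_real a \<cdot>\<^sub>m X + complex_of_real b \<cdot>\<^sub>m Y) + (complex_of_real c \<cdot>\<^sub>m X + complex_of_real d \<cdot>\<^sub>m Y)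
    = complex_of_real (a + c) \<cdot>\<^sub>m X + complex_of_real (b + d) \<cdot>\<^sub>m Y"
  using assms by (intro eq_matI) (simp_all add: ring_distribs)

lemma weighted_sum_split:
  fixes X X' Y Y' :: "complex mat"
  assumes "X \<in> carrier_mat k k" "X' \<in> carrier_mat k k" "Y \<in> carrier_mat k k" "Y' \<in> carrier_mat k k"
  shows "a \<cdot>\<^sub>m (X + X') + b \<cdot>\<^sub>m (Y + Y') = (a \<cdot>\<^sub>m X + b \<cdot>\<^sub>m Y) + (a \<cdot>\<^sub>m X' + b \<cdot>\<^sub>m Y')"
  using assms by (intro eq_matI) (simp_all add: ring_distribs)

text \<open>
The inequality \<open>(\<gamma>\<alpha>)\<^sup>*(\<gamma>\<alpha>) \<le> s \<alpha>\<^sup>*\<alpha>\<close> for \<open>\<gamma>\<^sup>*\<gamma> \<le> s\<close>, with its defect made explicit.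
\<close>

lemma gram_complement:
  fixes \<alpha> \<gamma> :: "complex mat"
  assumes \<alpha>: "\<alpha> \<in> carrier_mat k k" and \<gamma>: "\<gamma> \<in> carrier_mat k k"
  shows "mat_adjoint (\<gamma> * \<alpha>) * (\<gamma> * \<alpha>) + mat_adjoint \<alpha> * (complex_of_real s \<cdot>\<^sub>m 1\<^sub>m k - mat_adjoint \<gamma> * \<gamma>) * \<alpha>
    = complex_of_real s \<cdot>\<^sub>m (mat_adjoint \<alpha> * \<alpha>)"
proof -
  let ?A = "mat_adjoint \<alpha>" and ?G = "mat_adjoint \<gamma> * \<gamma>" and ?S = "complex_of_real s \<cdot>\<^sub>m (1\<^sub>m k :: complex mat)"
  have A: "?A \<in> carrier_mat k k" and G: "?G \<in> carrier_mat k k" and S: "?S \<in> carrier_mat k k"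
    using \<alpha> \<gamma> by auto
  have "mat_adjoint (\<gamma> * \<alpha>) * (\<gamma> * \<alpha>) = ?A * ?G * \<alpha>"
    using \<alpha> \<gamma> A by (simp add: mat_adjoint_mult[of _ k k _ k] assoc_mult_mat[of _ k k _ k _ k] mult_carrier_mat[of _ k k _ k])
  moreover have "?A * (?S - ?G) * \<alpha> = ?A * ?S * \<alpha> - ?A * ?G * \<alpha>"
    unfolding mult_minus_distrib_mat[OF A S G]
    by (rule minus_mult_distrib_mat[OF mult_carrier_mat[OF A S] mult_carrier_mat[OF A G] \<alpha>])
  moreover have "?A * ?S * \<alpha> = complex_of_real s \<cdot>\<^sub>m (?A * \<alpha>)"
    using A \<alpha> by (simp add: mult_smult_distrib[of _ k k _ k] mult_smult_assoc_mat[of _ k k _ k])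
  moreover have "?A * ?G * \<alpha> \<in> carrier_mat k k" "?A * \<alpha> \<in> carrier_mat k k"
    using A G \<alpha> by (auto intro!: mult_carrier_mat)
  ultimately show ?thesis
    by (simp only:) (intro eq_matI, simp_all del: index_mult_mat(1))
qed

text \<open>
The part of the \<open>k\<close>-AOU axioms that holds at every stage of the construction of \<open>E_proj\<close>.
\<close>

definition compress_cone :: "nat \<Rightarrow> 'v star_vs \<Rightarrow> 'v mat set \<Rightarrow> bool" where
  "compress_cone k V C \<longleftrightarrow> C \<subseteq> herm k V \<and> (\<forall>x\<in>C. \<forall>y\<in>C. mat_add V x y \<in> C) \<and>
     (\<forall>\<alpha>\<in>carrier_mat k k. \<forall>x\<in>C. compress V \<alpha> x \<in> C)"

lemma compress_coneD:
  assumes "compress_cone k V C"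
  shows "x \<in> C \<Longrightarrow> x \<in> herm k V"
    and "x \<in> C \<Longrightarrow> y \<in> C \<Longrightarrow> mat_add V x y \<in> C"
    and "\<alpha> \<in> carrier_mat k k \<Longrightarrow> x \<in> C \<Longrightarrow> compress V \<alpha> x \<in> C"
  using assms unfolding compress_cone_def by auto

definition arch_closure :: "nat \<Rightarrow> 'v star_vs \<Rightarrow> 'v \<Rightarrow> 'v mat set \<Rightarrow> 'v mat set" where
  "arch_closure k V e D = {x \<in> herm k V. \<forall>\<epsilon>>0. mat_add V x (mat_scale V \<epsilon> (tensor V (1\<^sub>m k) e)) \<in> D}"

lemma arch_closure_mono: "C \<subseteq> D \<Longrightarrow> arch_closure k V e C \<subseteq> arch_closure k V e D"
  unfolding arch_closure_def by auto

lemma proj_cone_mono: "C \<subseteq> D \<Longrightarrow> proj_cone k V e p C \<subseteq> proj_cone k V e p D"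
  unfolding proj_cone_def by blast

context star_vector_space
begin

lemma cone_mats: "compress_cone k V C \<Longrightarrow> x \<in> C \<Longrightarrow> x \<in> mats k V"
  using compress_coneD(1) hermD(1) by blast

lemma cone_scale:
  assumes "compress_cone k V C" "x \<in> C" "0 \<le> r"
  shows "mat_scale V r x \<in> C"
  using mat_scale_compress[OF cone_mats[OF assms(1,2)] assms(3)] compress_coneD(3)[OF assms(1) _ assms(2)]
  by simp

lemma cone_zero:
  assumes "compress_cone k V C" "x \<in> C"
  shows "mat_zero k V \<in> C"
proof -
  have x: "x \<in> mats k V" using cone_mats[OF assms] .
  have "mat_scale V 0 x = mat_zero k V"
    using matsD[OF x] by (intro eq_matI) (simp_all add: mat_zero_def)
  then show ?thesis using cone_scale[OF assms, of 0] by simp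
qed

text \<open>
\<open>\<beta>\<^sup>*\<beta> \<otimes> v\<close> is the compression of \<open>I \<otimes> v\<close> by \<open>\<beta>\<close>.
\<close>

lemma cone_tensor_psd:
  assumes C: "compress_cone k V C" and v: "v \<in> carrier V" "tensor V (1\<^sub>m k) v \<in> C"
  shows "psd k A \<Longrightarrow> tensor V A v \<in> C"
proof (induction rule: psd.induct)
  case (gram \<beta>)
  then show ?case using compress_coneD(3)[OF C gram v(2)] compress_tensor_one[OF gram v(1)] by simp
next
  case (add A B)
  then show ?case
    using compress_coneD(2)[OF C add.IH] tensor_add_left[OF psd_carrier psd_carrier v(1)] by simp
qed

lemma mat_add_interchange:
  assumes "u \<in> mats k V" "a \<in> mats k V" "b \<in> mats k V" "u' \<in> mats k V" "a' \<in> mats k V" "b' \<in> mats k V"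
  shows "mat_add V (mat_add V (mat_add V u a) b) (mat_add V (mat_add V u' a') b')
    = mat_add V (mat_add V (mat_add V u u') (mat_add V a a')) (mat_add V b b')"
proof -
  note m = assms mat_add_mats
  show ?thesis
    by (simp add: m mat_add_assoc[of _ k] mat_add_left_comm[of _ k] mat_add_comm[of _ k])
qed

text \<open>
For \<open>x \<in> C\<close> each of the three summands in the condition defining \<open>C[p]\<close> lies in \<open>C\<close>, whatever \<open>t\<close> is.
\<close>

lemma proj_cone_extensive:
  assumes C: "compress_cone k V C" and p: "p \<in> carrier V" "tensor V (1\<^sub>m k) p \<in> C"
    and q: "e \<ominus>\<^bsub>V\<^esub> p \<in> carrier V" "tensor V (1\<^sub>m k) (e \<ominus>\<^bsub>V\<^esub> p) \<in> C"
  shows "C \<subseteq> proj_cone k V e p C"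
proof
  fix x assume x: "x \<in> C"
  have psd: "psd k (complex_of_real s \<cdot>\<^sub>m (mat_adjoint \<alpha> * \<alpha>) + complex_of_real t \<cdot>\<^sub>m (mat_adjoint \<beta> * \<beta>))"
    if "0 \<le> s" "0 \<le> t" "\<alpha> \<in> carrier_mat k k" "\<beta> \<in> carrier_mat k k" for s t \<alpha> \<beta>
    using that by (intro psd.add psd_smult psd.gram)
  show "x \<in> proj_cone k V e p C"
    unfolding proj_cone_def
  proof (intro CollectI conjI allI impI)
    show "x \<in> herm k V" using compress_coneD(1)[OF C x] .
    fix \<epsilon> :: real assume "\<epsilon> > 0"
    then show "\<exists>t>0. \<forall>\<alpha>\<in>carrier_mat k k. \<forall>\<beta>\<in>carrier_mat k k.
       mat_add V
         (mat_add V (compress V (\<alpha> + \<beta>) x)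
           (tensor V (complex_of_real \<epsilon> \<cdot>\<^sub>m (mat_adjoint \<alpha> * \<alpha>)
                      + complex_of_real t \<cdot>\<^sub>m (mat_adjoint \<beta> * \<beta>)) p))
         (tensor V (complex_of_real \<epsilon> \<cdot>\<^sub>m (mat_adjoint \<beta> * \<beta>)
                      + complex_of_real t \<cdot>\<^sub>m (mat_adjoint \<alpha> * \<alpha>)) (e \<ominus>\<^bsub>V\<^esub> p)) \<in> C"
      by (intro exI[of _ 1] conjI ballI compress_coneD(2)[OF C] compress_coneD(3)[OF C] x
          cone_tensor_psd[OF C p] cone_tensor_psd[OF C q] psd) auto
  qed
qed

text \<open>
For a sum, the tolerance \<open>\<epsilon>\<close> is split in halves and the constants \<open>t\<close> are added. For the compression by
\<open>\<gamma>\<close> with \<open>\<gamma>\<^sup>*\<gamma> \<le> s\<close>, the condition for \<open>x\<close> with tolerance \<open>\<epsilon>/s\<close> and constant \<open>t\<close> is applied to \<open>\<gamma>\<alpha>\<close> and \<open>\<gamma>\<beta>\<close>.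
The error terms obtained are at most those with \<open>\<epsilon>\<close> and \<open>t s\<close>, and the difference is
positive semidefinite.
\<close>

lemma compress_cone_proj_cone:
  assumes C: "compress_cone k V C" and p: "p \<in> carrier V" "tensor V (1\<^sub>m k) p \<in> C"
    and q: "e \<ominus>\<^bsub>V\<^esub> p \<in> carrier V" "tensor V (1\<^sub>m k) (e \<ominus>\<^bsub>V\<^esub> p) \<in> C"
  shows "compress_cone k V (proj_cone k V e p C)"
proof -
  define W where "W s t \<alpha> \<beta> = complex_of_real s \<cdot>\<^sub>m (mat_adjoint \<alpha> * \<alpha>) + complex_of_real t \<cdot>\<^sub>m (mat_adjoint \<beta> * \<beta>)"
    for s t and \<alpha> \<beta> :: "complex mat"
  define T where "T x s t \<alpha> \<beta> = mat_add V (mat_add V (compress V (\<alpha> + \<beta>) x) (tensor V (W s t \<alpha> \<beta>) p))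
     (tensor V (W s t \<beta> \<alpha>) (e \<ominus>\<^bsub>V\<^esub> p))" for x s t \<alpha> \<beta>
  let ?M = "carrier_mat k k :: complex mat set"
  have mem: "x \<in> proj_cone k V e p C \<longleftrightarrow> x \<in> herm k V \<and> (\<forall>\<epsilon>>0. \<exists>t>0. \<forall>\<alpha>\<in>?M. \<forall>\<beta>\<in>?M. T x \<epsilon> t \<alpha> \<beta> \<in> C)" for x
    unfolding proj_cone_def T_def W_def by simp
  have W: "W s t \<alpha> \<beta> \<in> ?M" if "\<alpha> \<in> ?M" "\<beta> \<in> ?M" for s t \<alpha> \<beta>
    using that unfolding W_def by auto
  have T_add: "mat_add V (T x s t \<alpha> \<beta>) (T y s' t' \<alpha> \<beta>) = T (mat_add V x y) (s + s') (t + t') \<alpha> \<beta>"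
    if "x \<in> mats k V" "y \<in> mats k V" "\<alpha> \<in> ?M" "\<beta> \<in> ?M" for x y s s' t t' \<alpha> \<beta>
  proof -
    have ab: "\<alpha> + \<beta> \<in> ?M" using that by simp
    have W_add: "W s t \<alpha> \<beta> + W s' t' \<alpha> \<beta> = W (s + s') (t + t') \<alpha> \<beta>"
      if "\<alpha> \<in> ?M" "\<beta> \<in> ?M" for s s' t t' \<alpha> \<beta>
      unfolding W_def using that by (intro weighted_gram_add[of _ k]) auto
    show ?thesis
      unfolding T_def compress_add[OF ab that(1,2)] W_add[OF that(3,4), symmetric] W_add[OF that(4,3), symmetric]
        tensor_add_left[OF W[OF that(3,4)] W[OF that(3,4)] p(1)] tensor_add_left[OF W[OF that(4,3)] W[OF that(4,3)] q(1)]
      by (intro mat_add_interchange[where k = k] compress_mats[OF ab] tensor_mats W that p(1) q(1))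
  qed
  show ?thesis
    unfolding compress_cone_def
  proof (intro conjI ballI)
    show "proj_cone k V e p C \<subseteq> herm k V" unfolding proj_cone_def by auto
  next
    fix x y assume x: "x \<in> proj_cone k V e p C" and y: "y \<in> proj_cone k V e p C"
    show "mat_add V x y \<in> proj_cone k V e p C"
      unfolding mem
    proof (intro conjI allI impI)
      show "mat_add V x y \<in> herm k V" using x y mem mat_add_herm by blast
      fix \<epsilon> :: real assume "\<epsilon> > 0"
      then have e2: "\<epsilon> / 2 > 0" by simp
      obtain t where t: "t > 0" "\<forall>\<alpha>\<in>?M. \<forall>\<beta>\<in>?M. T x (\<epsilon> / 2) t \<alpha> \<beta> \<in> C" using x e2 unfolding mem by blast
      obtain t' where t': "t' > 0" "\<forall>\<alpha>\<in>?M. \<forall>\<beta>\<in>?M. T y (\<epsilon> / 2) t' \<alpha> \<beta> \<in> C" using y e2 unfolding mem by blast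
      have xy: "x \<in> mats k V" "y \<in> mats k V" using x y mem hermD(1) by blast+
      have "T (mat_add V x y) \<epsilon> (t + t') \<alpha> \<beta> \<in> C" if "\<alpha> \<in> ?M" "\<beta> \<in> ?M" for \<alpha> \<beta>
        using T_add[OF xy that, of "\<epsilon> / 2" t "\<epsilon> / 2" t'] compress_coneD(2)[OF C] t(2) t'(2) that
        by (metis field_sum_of_halves)
      then show "\<exists>t>0. \<forall>\<alpha>\<in>?M. \<forall>\<beta>\<in>?M. T (mat_add V x y) \<epsilon> t \<alpha> \<beta> \<in> C"
        using t(1) t'(1) by (intro exI[of _ "t + t'"]) simp
    qed
  next
    fix \<gamma> x assume \<gamma>: "\<gamma> \<in> ?M" and x: "x \<in> proj_cone k V e p C"
    have xm: "x \<in> mats k V" using x mem hermD(1) by blast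
    obtain s where s: "s > 0" "psd k (complex_of_real s \<cdot>\<^sub>m 1\<^sub>m k - mat_adjoint \<gamma> * \<gamma>)"
      using psd_gram_bound[OF \<gamma>] by blast
    let ?S = "complex_of_real s \<cdot>\<^sub>m 1\<^sub>m k - mat_adjoint \<gamma> * \<gamma>"
    show "compress V \<gamma> x \<in> proj_cone k V e p C"
      unfolding mem
    proof (intro conjI allI impI)
      show "compress V \<gamma> x \<in> herm k V" using x \<gamma> mem compress_herm by blast
      fix \<epsilon> :: real assume \<epsilon>: "\<epsilon> > 0"
      then have "\<epsilon> / s > 0" using s(1) by simp
      then obtain t where t: "t > 0" "\<forall>\<alpha>\<in>?M. \<forall>\<beta>\<in>?M. T x (\<epsilon> / s) t \<alpha> \<beta> \<in> C" using x unfolding mem by blast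
      have "T (compress V \<gamma> x) \<epsilon> (t * s) \<alpha> \<beta> \<in> C" if \<alpha>: "\<alpha> \<in> ?M" and \<beta>: "\<beta> \<in> ?M" for \<alpha> \<beta>
      proof -
        \<comment> \<open>\<open>R\<close> collects the positive semidefinite defects that \<open>gram_complement\<close> provides.\<close>
        define R where "R \<alpha> \<beta> = complex_of_real (\<epsilon> / s) \<cdot>\<^sub>m (mat_adjoint \<alpha> * ?S * \<alpha>) + complex_of_real t \<cdot>\<^sub>m (mat_adjoint \<beta> * ?S * \<beta>)"
          for \<alpha> \<beta> :: "complex mat"
        have R: "psd k (R \<alpha> \<beta>)" if "\<alpha> \<in> ?M" "\<beta> \<in> ?M" for \<alpha> \<beta>
          unfolding R_def using that \<epsilon> s t by (intro psd.add psd_smult psd_compress) auto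
        have split: "W \<epsilon> (t * s) \<alpha> \<beta> = W (\<epsilon> / s) t (\<gamma> * \<alpha>) (\<gamma> * \<beta>) + R \<alpha> \<beta>" if \<alpha>: "\<alpha> \<in> ?M" and \<beta>: "\<beta> \<in> ?M" for \<alpha> \<beta>
        proof -
          have A: "mat_adjoint (\<gamma> * \<alpha>) * (\<gamma> * \<alpha>) \<in> ?M" "mat_adjoint \<alpha> * ?S * \<alpha> \<in> ?M"
            and B: "mat_adjoint (\<gamma> * \<beta>) * (\<gamma> * \<beta>) \<in> ?M" "mat_adjoint \<beta> * ?S * \<beta> \<in> ?M"
            using \<alpha> \<beta> \<gamma> by (intro mult_carrier_mat[of _ k k] mat_adjoint_carrier minus_carrier_mat; simp)+
          have r: "complex_of_real \<epsilon> \<cdot>\<^sub>m Z = complex_of_real (\<epsilon> / s) \<cdot>\<^sub>m (complex_of_real s \<cdot>\<^sub>m Z)"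
            "complex_of_real (t * s) \<cdot>\<^sub>m Z = complex_of_real t \<cdot>\<^sub>m (complex_of_real s \<cdot>\<^sub>m Z)" for Z :: "complex mat"
            using s(1) by (auto intro!: eq_matI)
          show ?thesis
            unfolding W_def R_def r gram_complement[OF \<alpha> \<gamma>, of s, symmetric] gram_complement[OF \<beta> \<gamma>, of s, symmetric]
            by (rule weighted_sum_split[OF A B])
        qed
        have \<gamma>\<alpha>: "\<gamma> * \<alpha> \<in> ?M" and \<gamma>\<beta>: "\<gamma> * \<beta> \<in> ?M" and sum: "\<alpha> + \<beta> \<in> ?M" using \<alpha> \<beta> \<gamma> by auto
        have "compress V (\<alpha> + \<beta>) (compress V \<gamma> x) = compress V (\<gamma> * \<alpha> + \<gamma> * \<beta>) x"
          using compress_compress[OF \<gamma> sum xm] mult_add_distrib_mat[OF \<gamma> \<alpha> \<beta>] by simp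
        moreover have "compress V (\<gamma> * \<alpha> + \<gamma> * \<beta>) x \<in> mats k V"
          using \<gamma>\<alpha> \<gamma>\<beta> xm by (intro compress_mats[of _ k]) auto
        ultimately have "T (compress V \<gamma> x) \<epsilon> (t * s) \<alpha> \<beta>
            = mat_add V (mat_add V (T x (\<epsilon> / s) t (\<gamma> * \<alpha>) (\<gamma> * \<beta>)) (tensor V (R \<alpha> \<beta>) p)) (tensor V (R \<beta> \<alpha>) (e \<ominus>\<^bsub>V\<^esub> p))"
          unfolding T_def split[OF \<alpha> \<beta>] split[OF \<beta> \<alpha>]
            tensor_add_left[OF W[OF \<gamma>\<alpha> \<gamma>\<beta>] psd_carrier[OF R[OF \<alpha> \<beta>]] p(1)]
            tensor_add_left[OF W[OF \<gamma>\<beta> \<gamma>\<alpha>] psd_carrier[OF R[OF \<beta> \<alpha>]] q(1)]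
          using tensor_mats[OF W[OF \<gamma>\<alpha> \<gamma>\<beta>] p(1)] tensor_mats[OF W[OF \<gamma>\<beta> \<gamma>\<alpha>] q(1)]
            tensor_mats[OF psd_carrier[OF R[OF \<alpha> \<beta>]] p(1)] tensor_mats[OF psd_carrier[OF R[OF \<beta> \<alpha>]] q(1)]
          by (simp add: mat_add_assoc[of _ k] mat_add_left_comm[of _ k] mat_add_comm[of _ k] mat_add_mats)
        also have "\<dots> \<in> C"
          using t(2) \<gamma>\<alpha> \<gamma>\<beta> R \<alpha> \<beta>
          by (intro compress_coneD(2)[OF C] cone_tensor_psd[OF C p] cone_tensor_psd[OF C q]) auto
        finally show ?thesis .
      qed
      then show "\<exists>t>0. \<forall>\<alpha>\<in>?M. \<forall>\<beta>\<in>?M. T (compress V \<gamma> x) \<epsilon> t \<alpha> \<beta> \<in> C"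
        using t(1) s(1) by (intro exI[of _ "t * s"]) simp
    qed
  qed
qed

lemma cone_subset_arch_closure:
  assumes C: "compress_cone k V C" and e: "tensor V (1\<^sub>m k) e \<in> C"
  shows "C \<subseteq> arch_closure k V e C"
  unfolding arch_closure_def
  using compress_coneD(1,2)[OF C] cone_scale[OF C e] by auto

lemma mat_scale_add:
  assumes "x \<in> mats k V"
  shows "mat_add V (mat_scale V r x) (mat_scale V s x) = mat_scale V (r + s) x"
  using matsD[OF assms] by (intro eq_matI) (simp_all add: scale_left_distrib)

text \<open>
The Archimedean closure is itself Archimedean: half of the tolerance is spent on each closure.
\<close>

lemma arch_closure_arch:
  assumes e: "tensor V (1\<^sub>m k) e \<in> mats k V" and x: "x \<in> herm k V"
    and lim: "\<And>r. r > 0 \<Longrightarrow> mat_add V x (mat_scale V r (tensor V (1\<^sub>m k) e)) \<in> arch_closure k V e C"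
  shows "x \<in> arch_closure k V e C"
proof -
  let ?u = "tensor V (1\<^sub>m k) e"
  have "mat_add V x (mat_scale V \<epsilon> ?u) \<in> C" if "\<epsilon> > 0" for \<epsilon>
  proof -
    have "mat_add V (mat_add V x (mat_scale V (\<epsilon> / 2) ?u)) (mat_scale V (\<epsilon> / 2) ?u) \<in> C"
      using lim[of "\<epsilon> / 2"] that unfolding arch_closure_def by auto
    then show ?thesis
      using mat_add_assoc[OF hermD(1)[OF x] mat_scale_mats[OF e] mat_scale_mats[OF e]] mat_scale_add[OF e]
      by simp
  qed
  then show ?thesis using x unfolding arch_closure_def by simp
qed

text \<open>
Compressing \<open>x + (\<epsilon>/s) I \<otimes> e\<close> by \<open>\<gamma>\<close> with \<open>\<gamma>\<^sup>*\<gamma> \<le> s\<close> gives at most \<open>\<gamma>\<^sup>* x \<gamma> + \<epsilon> I \<otimes> e\<close>.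
\<close>

lemma compress_cone_arch_closure:
  assumes C: "compress_cone k V C" and e: "e \<in> carrier V" and u: "tensor V (1\<^sub>m k) e \<in> C"
  shows "compress_cone k V (arch_closure k V e C)"
proof -
  let ?u = "tensor V (1\<^sub>m k) e"
  have um: "?u \<in> mats k V" using cone_mats[OF C u] .
  have mem: "x \<in> arch_closure k V e C \<longleftrightarrow> x \<in> herm k V \<and> (\<forall>\<epsilon>>0. mat_add V x (mat_scale V \<epsilon> ?u) \<in> C)" for x
    unfolding arch_closure_def by simp
  show ?thesis
    unfolding compress_cone_def
  proof (intro conjI ballI)
    show "arch_closure k V e C \<subseteq> herm k V" using mem by blast
  next
    fix x y assume x: "x \<in> arch_closure k V e C" and y: "y \<in> arch_closure k V e C"
    have xm: "x \<in> mats k V" and ym: "y \<in> mats k V" using x y mem hermD(1) by blast+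
    show "mat_add V x y \<in> arch_closure k V e C"
      unfolding mem
    proof (intro conjI allI impI)
      show "mat_add V x y \<in> herm k V" using x y mem mat_add_herm by blast
      fix \<epsilon> :: real assume "\<epsilon> > 0"
      then have "\<epsilon> / 2 > 0" by simp
      then have "mat_add V (mat_add V x (mat_scale V (\<epsilon> / 2) ?u)) (mat_add V y (mat_scale V (\<epsilon> / 2) ?u)) \<in> C"
        using x y mem compress_coneD(2)[OF C] by blast
      moreover have "mat_add V (mat_add V x (mat_scale V (\<epsilon> / 2) ?u)) (mat_add V y (mat_scale V (\<epsilon> / 2) ?u))
          = mat_add V (mat_add V x y) (mat_scale V (\<epsilon> / 2 + \<epsilon> / 2) ?u)"
        unfolding mat_scale_add[OF um, symmetric] using xm ym mat_scale_mats[OF um, of "\<epsilon> / 2"]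
        by (simp add: mat_add_assoc[of _ k] mat_add_left_comm[of _ k] mat_add_comm[of _ k] mat_add_mats)
      ultimately show "mat_add V (mat_add V x y) (mat_scale V \<epsilon> ?u) \<in> C" by simp
    qed
  next
    fix \<gamma> :: "complex mat" and x assume \<gamma>: "\<gamma> \<in> carrier_mat k k" and x: "x \<in> arch_closure k V e C"
    have xm: "x \<in> mats k V" using x mem hermD(1) by blast
    obtain s where s: "s > 0" "psd k (complex_of_real s \<cdot>\<^sub>m 1\<^sub>m k - mat_adjoint \<gamma> * \<gamma>)"
      using psd_gram_bound[OF \<gamma>] by blast
    let ?S = "complex_of_real s \<cdot>\<^sub>m 1\<^sub>m k - mat_adjoint \<gamma> * \<gamma>"
    show "compress V \<gamma> x \<in> arch_closure k V e C"
      unfolding mem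
    proof (intro conjI allI impI)
      show "compress V \<gamma> x \<in> herm k V" using x \<gamma> mem compress_herm by blast
      fix \<epsilon> :: real assume \<epsilon>: "\<epsilon> > 0"
      have G: "mat_adjoint \<gamma> * \<gamma> \<in> carrier_mat k k" using \<gamma> by auto
      define f where "f = complex_of_real (\<epsilon> / s) \<odot>\<^bsub>V\<^esub> e"
      have f: "f \<in> carrier V" "tensor V (1\<^sub>m k) f \<in> C"
        using cone_scale[OF C u, of "\<epsilon> / s"] e \<epsilon> s(1) unfolding f_def tensor_scale[OF e] by auto
      have "mat_add V x (tensor V (1\<^sub>m k) f) \<in> C"
        using x \<epsilon> s(1) unfolding mem f_def tensor_scale[OF e] by simp
      then have "compress V \<gamma> (mat_add V x (tensor V (1\<^sub>m k) f)) \<in> C"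
        using compress_coneD(3)[OF C \<gamma>] by blast
      then have "mat_add V (mat_add V (compress V \<gamma> x) (tensor V (mat_adjoint \<gamma> * \<gamma>) f)) (tensor V ?S f) \<in> C"
        using compress_coneD(2)[OF C] cone_tensor_psd[OF C f s(2)] f
        by (simp add: compress_add[OF \<gamma> xm tensor_mats] compress_tensor_one[OF \<gamma>])
      moreover have "mat_add V (mat_add V (compress V \<gamma> x) (tensor V (mat_adjoint \<gamma> * \<gamma>) f)) (tensor V ?S f)
          = mat_add V (compress V \<gamma> x) (tensor V (mat_adjoint \<gamma> * \<gamma> + ?S) f)"
        unfolding tensor_add_left[OF G psd_carrier[OF s(2)] f(1)]
        by (rule mat_add_assoc[OF compress_mats[OF \<gamma> xm] tensor_mats[OF G f(1)] tensor_mats[OF psd_carrier[OF s(2)] f(1)]])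
      moreover have "tensor V (mat_adjoint \<gamma> * \<gamma> + ?S) f = mat_scale V \<epsilon> ?u"
      proof -
        have "mat_adjoint \<gamma> * \<gamma> + ?S = complex_of_real s \<cdot>\<^sub>m 1\<^sub>m k"
          using \<gamma> by (intro eq_matI) (simp_all del: index_mult_mat(1))
        then show ?thesis
          unfolding f_def using e s(1) by (intro eq_matI) (simp_all add: mult.assoc[symmetric] flip: of_real_mult)
      qed
      ultimately show "mat_add V (compress V \<gamma> x) (mat_scale V \<epsilon> ?u) \<in> C" by simp
    qed
  qed
qed

section \<open>The cones generated by the unit and the generators\<close>

lemma finsum_lessThan_add:
  fixes m n :: nat
  assumes "\<And>i. i < m + n \<Longrightarrow> f i \<in> carrier V"
  shows "(\<Oplus>\<^bsub>V\<^esub>i\<in>{..<m + n}. f i) = (\<Oplus>\<^bsub>V\<^esub>i\<in>{..<m}. f i) \<oplus>\<^bsub>V\<^esub> (\<Oplus>\<^bsub>V\<^esub>i\<in>{..<n}. f (m + i))"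
  using assms
proof (induction n)
  case 0
  then have "(\<Oplus>\<^bsub>V\<^esub>i\<in>{..<m}. f i) \<in> carrier V" by (intro finsum_mem) simp
  then show ?case by simp
next
  case (Suc n)
  have "(\<Oplus>\<^bsub>V\<^esub>i\<in>{..<m}. f i) \<in> carrier V" "(\<Oplus>\<^bsub>V\<^esub>i\<in>{..<n}. f (m + i)) \<in> carrier V" "f (m + n) \<in> carrier V"
    using Suc.prems by (auto intro!: finsum_mem)
  moreover have "(\<Oplus>\<^bsub>V\<^esub>i\<in>{..<m + Suc n}. f i) = (\<Oplus>\<^bsub>V\<^esub>i\<in>{..<m + n}. f i) \<oplus>\<^bsub>V\<^esub> f (m + n)"
    using finsum_lessThan_Suc[of "m + n" f] Suc.prems by simp
  moreover have "(\<Oplus>\<^bsub>V\<^esub>i\<in>{..<Suc n}. f (m + i)) = (\<Oplus>\<^bsub>V\<^esub>i\<in>{..<n}. f (m + i)) \<oplus>\<^bsub>V\<^esub> f (m + n)"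
    by (rule finsum_lessThan_Suc) (use Suc.prems in simp)
  ultimately show ?case using Suc by (simp add: M.a_assoc)
qed

text \<open>
Adding \<open>\<epsilon> e\<close> to one of these vectors gives a combination of the kind listed in \<open>E_tilde\<close>.
\<close>

lemma generators_in_E_cone:
  assumes e: "e \<in> carrier V" "star V e = e" and p: "\<And>i. i \<in> {1..N} \<Longrightarrow> p i \<in> carrier V"
    "\<And>i. i \<in> {1..N} \<Longrightarrow> star V (p i) = p i"
  shows "e \<in> E_cone V N e p"
    and "i \<in> {1..N} \<Longrightarrow> p i \<in> E_cone V N e p"
    and "i \<in> {1..N} \<Longrightarrow> e \<ominus>\<^bsub>V\<^esub> p i \<in> E_cone V N e p"
proof -
  have q: "e \<ominus>\<^bsub>V\<^esub> p i \<in> carrier V" "star V (e \<ominus>\<^bsub>V\<^esub> p i) = e \<ominus>\<^bsub>V\<^esub> p i" if "i \<in> {1..N}" for i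
    using that e p by (auto simp: star_minus intro!: M.minus_closed)
  have zero: "(\<Oplus>\<^bsub>V\<^esub>i\<in>{1..N}. complex_of_real 0 \<odot>\<^bsub>V\<^esub> v i) = \<zero>\<^bsub>V\<^esub>"
    if "\<And>i. i \<in> {1..N} \<Longrightarrow> v i \<in> carrier V" for v
  proof -
    have "(\<Oplus>\<^bsub>V\<^esub>i\<in>{1..N}. complex_of_real 0 \<odot>\<^bsub>V\<^esub> v i) = (\<Oplus>\<^bsub>V\<^esub>i\<in>{1..N}. \<zero>\<^bsub>V\<^esub>)"
      by (rule finsum_eq) (use that in simp_all)
    then show ?thesis by simp
  qed
  have single: "(\<Oplus>\<^bsub>V\<^esub>j\<in>{1..N}. complex_of_real (if j = i then 1 else 0) \<odot>\<^bsub>V\<^esub> v j) = v i"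
    if "\<And>i. i \<in> {1..N} \<Longrightarrow> v i \<in> carrier V" "i \<in> {1..N}" for v i
    using that by (subst finsum_single[where i = i]) auto
  have tilde: "complex_of_real r \<odot>\<^bsub>V\<^esub> e \<oplus>\<^bsub>V\<^esub> u \<oplus>\<^bsub>V\<^esub> w \<in> E_tilde V N e p"
    if "u = (\<Oplus>\<^bsub>V\<^esub>i\<in>{1..N}. complex_of_real (t i) \<odot>\<^bsub>V\<^esub> p i)"
      "w = (\<Oplus>\<^bsub>V\<^esub>i\<in>{1..N}. complex_of_real (s i) \<odot>\<^bsub>V\<^esub> (e \<ominus>\<^bsub>V\<^esub> p i))"
      "0 \<le> r" "\<And>i. 0 \<le> t i" "\<And>i. 0 \<le> s i" for r t s u w
    unfolding E_tilde_def using that by blast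
  show "e \<in> E_cone V N e p"
    unfolding E_cone_def
  proof (intro CollectI conjI allI impI e)
    fix \<epsilon> :: real assume "\<epsilon> > 0"
    then have "complex_of_real (1 + \<epsilon>) \<odot>\<^bsub>V\<^esub> e \<oplus>\<^bsub>V\<^esub> \<zero>\<^bsub>V\<^esub> \<oplus>\<^bsub>V\<^esub> \<zero>\<^bsub>V\<^esub> \<in> E_tilde V N e p"
      by (intro tilde[OF zero[OF p(1), symmetric] zero[OF q(1), symmetric]]) auto
    then show "e \<oplus>\<^bsub>V\<^esub> complex_of_real \<epsilon> \<odot>\<^bsub>V\<^esub> e \<in> E_tilde V N e p"
      using e(1) by (simp add: scale_left_distrib)
  qed
  show "p i \<in> E_cone V N e p" if i: "i \<in> {1..N}"
    unfolding E_cone_def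
  proof (intro CollectI conjI allI impI p i)
    fix \<epsilon> :: real assume "\<epsilon> > 0"
    then have "complex_of_real \<epsilon> \<odot>\<^bsub>V\<^esub> e \<oplus>\<^bsub>V\<^esub> p i \<oplus>\<^bsub>V\<^esub> \<zero>\<^bsub>V\<^esub> \<in> E_tilde V N e p"
      by (intro tilde[OF single[OF p(1) i, symmetric] zero[OF q(1), symmetric]]) auto
    then show "p i \<oplus>\<^bsub>V\<^esub> complex_of_real \<epsilon> \<odot>\<^bsub>V\<^esub> e \<in> E_tilde V N e p"
      using e(1) p(1)[OF i] by (simp add: M.add.m_comm)
  qed
  show "e \<ominus>\<^bsub>V\<^esub> p i \<in> E_cone V N e p" if i: "i \<in> {1..N}"
    unfolding E_cone_def
  proof (intro CollectI conjI allI impI q i)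
    fix \<epsilon> :: real assume "\<epsilon> > 0"
    then have "complex_of_real \<epsilon> \<odot>\<^bsub>V\<^esub> e \<oplus>\<^bsub>V\<^esub> \<zero>\<^bsub>V\<^esub> \<oplus>\<^bsub>V\<^esub> (e \<ominus>\<^bsub>V\<^esub> p i) \<in> E_tilde V N e p"
      by (intro tilde[OF zero[OF p(1), symmetric] single[OF q(1) i, symmetric]]) auto
    then show "e \<ominus>\<^bsub>V\<^esub> p i \<oplus>\<^bsub>V\<^esub> complex_of_real \<epsilon> \<odot>\<^bsub>V\<^esub> e \<in> E_tilde V N e p"
      using e(1) q(1)[OF i] by (simp add: M.add.m_comm)
  qed
qed

lemma tensor_one_in_D_max:
  assumes "1 \<le> k" "s \<in> E_cone V N e p"
  shows "tensor V (1\<^sub>m k) s \<in> D_max V N e p k"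
proof -
  have s: "s \<in> carrier V" using assms(2) unfolding E_cone_def by simp
  have "mat_adjoint (1\<^sub>m k :: complex mat) * 1\<^sub>m k = 1\<^sub>m k"
    by (intro eq_matI) (auto simp: scalar_prod_def)
  then have "compress V (1\<^sub>m k) (diag_matrix V k (\<lambda>_. s)) = tensor V (1\<^sub>m k) s"
    using compress_tensor_one[of "1\<^sub>m k" k k s] s by (simp add: tensor_one_diag)
  then show ?thesis
    unfolding D_max_def using assms
    by (intro CollectI exI[of _ k] exI[of _ "1\<^sub>m k"] exI[of _ "\<lambda>_. s"]) simp
qed

lemma compress_cone_D_max: "compress_cone k V (D_max V N e p k)"
  unfolding compress_cone_def
proof (intro conjI ballI subsetI)
  have diag: "diag_matrix V m s \<in> herm m V" if "\<forall>i<m. s i \<in> E_cone V N e p" for m s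
    using that by (intro hermI diag_matrix_mats) (auto simp: E_cone_def diag_matrix_def)
  fix x assume x: "x \<in> D_max V N e p k"
  then obtain m \<alpha> s where ms: "1 \<le> m" "\<alpha> \<in> carrier_mat m k" "\<forall>i<m. s i \<in> E_cone V N e p"
    and x_eq: "x = compress V \<alpha> (diag_matrix V m s)"
    unfolding D_max_def by blast
  have sc: "s i \<in> carrier V" if "i < m" for i using that ms(3) unfolding E_cone_def by simp
  show "x \<in> herm k V" unfolding x_eq by (intro compress_herm[OF ms(2)] diag ms(3))
  show "compress V \<gamma> x \<in> D_max V N e p k" if "\<gamma> \<in> carrier_mat k k" for \<gamma>
    unfolding x_eq compress_compress[OF ms(2) that hermD(1)[OF diag[OF ms(3)]]] D_max_def
    using ms that by (intro CollectI exI[of _ m] exI[of _ "\<alpha> * \<gamma>"] exI[of _ s]) simp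
  fix y assume "y \<in> D_max V N e p k"
  then obtain n \<beta> u where nu: "1 \<le> n" "\<beta> \<in> carrier_mat n k" "\<forall>i<n. u i \<in> E_cone V N e p"
    and y_eq: "y = compress V \<beta> (diag_matrix V n u)"
    unfolding D_max_def by blast
  have uc: "u i \<in> carrier V" if "i < n" for i using that nu(3) unfolding E_cone_def by simp
  \<comment> \<open>The sum is the compression by the block column of the two coefficient matrices.\<close>
  define \<gamma> where "\<gamma> = mat (m + n) k (\<lambda>(a, i). if a < m then \<alpha> $$ (a, i) else \<beta> $$ (a - m, i))"
  define w where "w a = (if a < m then s a else u (a - m))" for a
  have \<gamma>: "\<gamma> \<in> carrier_mat (m + n) k" unfolding \<gamma>_def by simp
  have w: "w a \<in> E_cone V N e p" if "a < m + n" for a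
    using that ms(3) nu(3) unfolding w_def by auto
  have wc: "w a \<in> carrier V" if "a < m + n" for a using w[OF that] unfolding E_cone_def by simp
  have xm: "x \<in> mats k V" unfolding x_eq by (intro compress_mats[OF ms(2)] diag_matrix_mats sc)
  have ym: "y \<in> mats k V" unfolding y_eq by (intro compress_mats[OF nu(2)] diag_matrix_mats uc)
  have "mat_add V x y = compress V \<gamma> (diag_matrix V (m + n) w)"
  proof (rule mats_eqI[of _ k])
    fix i j assume ij: "i < k" "j < k"
    have "compress V \<gamma> (diag_matrix V (m + n) w) $$ (i, j)
        = (\<Oplus>\<^bsub>V\<^esub>a\<in>{..<m}. (cnj (\<gamma> $$ (a, i)) * \<gamma> $$ (a, j)) \<odot>\<^bsub>V\<^esub> w a)
        \<oplus>\<^bsub>V\<^esub> (\<Oplus>\<^bsub>V\<^esub>a\<in>{..<n}. (cnj (\<gamma> $$ (m + a, i)) * \<gamma> $$ (m + a, j)) \<odot>\<^bsub>V\<^esub> w (m + a))"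
    proof -
      have "compress V \<gamma> (diag_matrix V (m + n) w) $$ (i, j)
          = (\<Oplus>\<^bsub>V\<^esub>a\<in>{..<m + n}. (cnj (\<gamma> $$ (a, i)) * \<gamma> $$ (a, j)) \<odot>\<^bsub>V\<^esub> w a)"
        by (rule compress_diag_index[OF \<gamma> wc ij])
      also have "\<dots> = (\<Oplus>\<^bsub>V\<^esub>a\<in>{..<m}. (cnj (\<gamma> $$ (a, i)) * \<gamma> $$ (a, j)) \<odot>\<^bsub>V\<^esub> w a)
          \<oplus>\<^bsub>V\<^esub> (\<Oplus>\<^bsub>V\<^esub>a\<in>{..<n}. (cnj (\<gamma> $$ (m + a, i)) * \<gamma> $$ (m + a, j)) \<odot>\<^bsub>V\<^esub> w (m + a))"
        by (rule finsum_lessThan_add) (simp add: wc)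
      finally show ?thesis .
    qed
    also have "(\<Oplus>\<^bsub>V\<^esub>a\<in>{..<m}. (cnj (\<gamma> $$ (a, i)) * \<gamma> $$ (a, j)) \<odot>\<^bsub>V\<^esub> w a) = x $$ (i, j)"
      unfolding x_eq using ij
      by (subst compress_diag_index[OF ms(2) _ ij]) (auto simp: \<gamma>_def w_def sc intro!: finsum_eq)
    also have "(\<Oplus>\<^bsub>V\<^esub>a\<in>{..<n}. (cnj (\<gamma> $$ (m + a, i)) * \<gamma> $$ (m + a, j)) \<odot>\<^bsub>V\<^esub> w (m + a)) = y $$ (i, j)"
      unfolding y_eq using ij
      by (subst compress_diag_index[OF nu(2) _ ij]) (auto simp: \<gamma>_def w_def uc intro!: finsum_eq)
    finally show "mat_add V x y $$ (i, j) = compress V \<gamma> (diag_matrix V (m + n) w) $$ (i, j)"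
      using matsD(1,2)[OF xm] ij by simp
  qed (intro mat_add_mats xm ym compress_mats[OF \<gamma>] diag_matrix_mats wc)+
  then show "mat_add V x y \<in> D_max V N e p k"
    unfolding D_max_def using \<gamma> w ms(1)
    by (intro CollectI exI[of _ "m + n"] exI[of _ \<gamma>] exI[of _ w]) simp
qed

text \<open>
The compression of \<open>diag(s\<^sub>0, s\<^sub>1, \<dots>)\<close> by \<open>\<alpha>\<close> is the sum of \<open>\<alpha>\<^sub>a\<^sup>* s\<^sub>a \<alpha>\<^sub>a\<close> over the rows \<open>\<alpha>\<^sub>a\<close> of \<open>\<alpha>\<close>. Each summand
is the compression of \<open>I \<otimes> s\<^sub>a\<close> by the square matrix whose first row is \<open>\<alpha>\<^sub>a\<close> and whose other rows vanish.
\<close>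

lemma compress_diag_in_cone:
  assumes C: "compress_cone k V C" and zero: "mat_zero k V \<in> C" and k: "1 \<le> k"
    and s: "\<And>i. i < m \<Longrightarrow> s i \<in> carrier V \<and> tensor V (1\<^sub>m k) (s i) \<in> C"
    and \<alpha>: "\<alpha> \<in> carrier_mat m k"
  shows "compress V \<alpha> (diag_matrix V m s) \<in> C"
  using s \<alpha>
proof (induction m arbitrary: \<alpha>)
  case 0
  then have "compress V \<alpha> (diag_matrix V 0 s) = mat_zero k V"
    by (intro eq_matI) (auto simp: compress_diag_index mat_zero_def)
  then show ?case using zero by simp
next
  case (Suc m)
  have sc: "s a \<in> carrier V" if "a < Suc m" for a using Suc.prems(1)[OF that] by simp
  define \<beta> where "\<beta> = mat m k (\<lambda>(a, i). \<alpha> $$ (a, i))"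
  define \<gamma> where "\<gamma> = mat k k (\<lambda>(a, i). if a = 0 then \<alpha> $$ (m, i) else 0)"
  have \<beta>: "\<beta> \<in> carrier_mat m k" and \<gamma>: "\<gamma> \<in> carrier_mat k k" unfolding \<beta>_def \<gamma>_def by auto
  have "compress V \<alpha> (diag_matrix V (Suc m) s)
      = mat_add V (compress V \<beta> (diag_matrix V m s)) (compress V \<gamma> (tensor V (1\<^sub>m k) (s m)))"
  proof (rule mats_eqI[of _ k])
    fix i j assume ij: "i < k" "j < k"
    have "compress V \<gamma> (tensor V (1\<^sub>m k) (s m)) $$ (i, j)
        = (\<Oplus>\<^bsub>V\<^esub>a\<in>{..<k}. (cnj (\<gamma> $$ (a, i)) * \<gamma> $$ (a, j)) \<odot>\<^bsub>V\<^esub> s m)"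
      unfolding tensor_one_diag[OF sc[OF lessI]] by (rule compress_diag_index[OF \<gamma> sc ij]) simp
    also have "\<dots> = (cnj (\<gamma> $$ (0, i)) * \<gamma> $$ (0, j)) \<odot>\<^bsub>V\<^esub> s m"
      using k ij sc by (intro finsum_single) (auto simp: \<gamma>_def)
    finally have 1: "compress V \<gamma> (tensor V (1\<^sub>m k) (s m)) $$ (i, j) = (cnj (\<alpha> $$ (m, i)) * \<alpha> $$ (m, j)) \<odot>\<^bsub>V\<^esub> s m"
      using ij by (simp add: \<gamma>_def)
    have "compress V \<alpha> (diag_matrix V (Suc m) s) $$ (i, j)
        = (\<Oplus>\<^bsub>V\<^esub>a\<in>{..<m}. (cnj (\<alpha> $$ (a, i)) * \<alpha> $$ (a, j)) \<odot>\<^bsub>V\<^esub> s a) \<oplus>\<^bsub>V\<^esub> (cnj (\<alpha> $$ (m, i)) * \<alpha> $$ (m, j)) \<odot>\<^bsub>V\<^esub> s m"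
    proof -
      have "compress V \<alpha> (diag_matrix V (Suc m) s) $$ (i, j)
          = (\<Oplus>\<^bsub>V\<^esub>a\<in>{..<Suc m}. (cnj (\<alpha> $$ (a, i)) * \<alpha> $$ (a, j)) \<odot>\<^bsub>V\<^esub> s a)"
        by (rule compress_diag_index[OF Suc.prems(2) sc ij])
      also have "\<dots> = (\<Oplus>\<^bsub>V\<^esub>a\<in>{..<m}. (cnj (\<alpha> $$ (a, i)) * \<alpha> $$ (a, j)) \<odot>\<^bsub>V\<^esub> s a)
          \<oplus>\<^bsub>V\<^esub> (cnj (\<alpha> $$ (m, i)) * \<alpha> $$ (m, j)) \<odot>\<^bsub>V\<^esub> s m"
        by (rule finsum_lessThan_Suc) (simp add: sc)
      finally show ?thesis .
    qed
    also have "(\<Oplus>\<^bsub>V\<^esub>a\<in>{..<m}. (cnj (\<alpha> $$ (a, i)) * \<alpha> $$ (a, j)) \<odot>\<^bsub>V\<^esub> s a) = compress V \<beta> (diag_matrix V m s) $$ (i, j)"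
      using ij by (subst compress_diag_index[OF \<beta> _ ij]) (auto simp: \<beta>_def sc intro!: finsum_eq)
    finally show "compress V \<alpha> (diag_matrix V (Suc m) s) $$ (i, j)
      = mat_add V (compress V \<beta> (diag_matrix V m s)) (compress V \<gamma> (tensor V (1\<^sub>m k) (s m))) $$ (i, j)"
      using 1 ij \<beta> by simp
  qed (intro mat_add_mats compress_mats[OF \<beta>] compress_mats[OF \<gamma>] compress_mats[OF Suc.prems(2)]
      tensor_mats diag_matrix_mats sc; simp)+
  also have "\<dots> \<in> C"
    using Suc.prems Suc.IH[OF _ \<beta>] by (intro compress_coneD(2)[OF C] compress_coneD(3)[OF C \<gamma>]) auto
  finally show ?case .
qed

text \<open>
The vectors \<open>v\<close> with \<open>I \<otimes> v \<in> C\<close> are closed under nonnegative combinations, hence include \<open>E_tilde\<close>; the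
passage to \<open>E_cone\<close> is absorbed by the Archimedean property of \<open>C\<close>.
\<close>

lemma E_cone_tensor_in_cone:
  assumes C: "compress_cone k V C" and arch: "arch_closure k V e C \<subseteq> C"
    and e: "e \<in> carrier V" "tensor V (1\<^sub>m k) e \<in> C"
    and p: "\<And>i. i \<in> {1..N} \<Longrightarrow> p i \<in> carrier V \<and> tensor V (1\<^sub>m k) (p i) \<in> C \<and> tensor V (1\<^sub>m k) (e \<ominus>\<^bsub>V\<^esub> p i) \<in> C"
    and s: "s \<in> E_cone V N e p"
  shows "tensor V (1\<^sub>m k) s \<in> C"
proof -
  define L where "L = {v \<in> carrier V. tensor V (1\<^sub>m k) v \<in> C}"
  have add: "v \<oplus>\<^bsub>V\<^esub> w \<in> L" if "v \<in> L" "w \<in> L" for v w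
    using that compress_coneD(2)[OF C] unfolding L_def by (auto simp: tensor_add_right)
  have scale: "complex_of_real r \<odot>\<^bsub>V\<^esub> v \<in> L" if "v \<in> L" "0 \<le> r" for r v
    using that cone_scale[OF C] unfolding L_def by (auto simp: tensor_scale)
  have eL: "e \<in> L" using e unfolding L_def by simp
  have zero: "\<zero>\<^bsub>V\<^esub> \<in> L" using scale[OF eL, of 0] e by simp
  have sum: "(\<Oplus>\<^bsub>V\<^esub>i\<in>I. v i) \<in> L" if "finite I" "\<And>i. i \<in> I \<Longrightarrow> v i \<in> L" for v :: "nat \<Rightarrow> 'v" and I
    using that
  proof (induction I rule: finite_induct)
    case (insert i I)
    moreover have "v j \<in> carrier V" if "j \<in> insert i I" for j using insert.prems[OF that] unfolding L_def by simp
    ultimately show ?case by (simp add: M.finsum_insert Pi_def add)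
  qed (use zero in simp)
  have pL: "p i \<in> L" "e \<ominus>\<^bsub>V\<^esub> p i \<in> L" if "i \<in> {1..N}" for i
    using p[OF that] e unfolding L_def by (auto intro!: M.minus_closed)
  have tilde: "E_tilde V N e p \<subseteq> L"
    unfolding E_tilde_def by (auto intro!: add scale sum eL pL)
  have sc: "s \<in> carrier V" "star V s = s" using s unfolding E_cone_def by auto
  have "tensor V (1\<^sub>m k) s \<in> arch_closure k V e C"
    unfolding arch_closure_def
  proof (intro CollectI conjI allI impI tensor_one_herm sc)
    fix \<epsilon> :: real assume "\<epsilon> > 0"
    then have "s \<oplus>\<^bsub>V\<^esub> complex_of_real \<epsilon> \<odot>\<^bsub>V\<^esub> e \<in> L" using s tilde unfolding E_cone_def by auto
    then show "mat_add V (tensor V (1\<^sub>m k) s) (mat_scale V \<epsilon> (tensor V (1\<^sub>m k) e)) \<in> C"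
      using sc e unfolding L_def by (simp add: tensor_add_right tensor_scale)
  qed
  then show ?thesis using arch by blast
qed

lemma E_max_eq: "E_max V N e p k = arch_closure k V e (D_max V N e p k)"
  unfolding E_max_def arch_closure_def ..

text \<open>
All steps of the construction are monotone, so they do not leave a cone that is stable under each of
them.
\<close>

lemma E_seq_minimal:
  assumes C: "compress_cone k V C" and k: "1 \<le> k" and N: "1 \<le> N" and arch: "arch_closure k V e C \<subseteq> C"
    and e: "e \<in> carrier V" "tensor V (1\<^sub>m k) e \<in> C"
    and p: "\<And>i. i \<in> {1..N} \<Longrightarrow> p i \<in> carrier V \<and> tensor V (1\<^sub>m k) (p i) \<in> C \<and> tensor V (1\<^sub>m k) (e \<ominus>\<^bsub>V\<^esub> p i) \<in> C"
    and proj: "\<And>i. i \<in> {1..N} \<Longrightarrow> proj_cone k V e (p i) C \<subseteq> C"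
  shows "E_seq k V N e p n \<subseteq> C"
proof (induction n)
  case 0
  have "D_max V N e p k \<subseteq> C"
  proof
    fix x assume "x \<in> D_max V N e p k"
    then obtain m \<alpha> s where ms: "\<alpha> \<in> carrier_mat m k" "\<forall>i<m. s i \<in> E_cone V N e p"
      and x_eq: "x = compress V \<alpha> (diag_matrix V m s)"
      unfolding D_max_def by blast
    show "x \<in> C"
      unfolding x_eq using ms E_cone_tensor_in_cone[OF C arch e p]
      by (intro compress_diag_in_cone[OF C cone_zero[OF C e(2)] k]) (auto simp: E_cone_def)
  qed
  then show ?case
    unfolding E_seq.simps E_max_eq by (rule subset_trans[OF arch_closure_mono arch])
next
  case (Suc n)
  have "n mod N + 1 \<in> {1..N}" using N by (simp add: Suc_leI)
  then show ?case
    unfolding E_seq.simps by (rule subset_trans[OF proj_cone_mono[OF Suc] proj])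
qed

lemma E_seq_structure:
  assumes k: "1 \<le> k" and N: "1 \<le> N" and e: "e \<in> carrier V" "star V e = e"
    and p: "\<And>i. i \<in> {1..N} \<Longrightarrow> p i \<in> carrier V" "\<And>i. i \<in> {1..N} \<Longrightarrow> star V (p i) = p i"
  shows "compress_cone k V (E_seq k V N e p n)"
    and "s \<in> E_cone V N e p \<Longrightarrow> tensor V (1\<^sub>m k) s \<in> E_seq k V N e p n"
    and "E_seq k V N e p n \<subseteq> E_seq k V N e p (Suc n)"
proof -
  have gen: "e \<in> E_cone V N e p" "i \<in> {1..N} \<Longrightarrow> p i \<in> E_cone V N e p" "i \<in> {1..N} \<Longrightarrow> e \<ominus>\<^bsub>V\<^esub> p i \<in> E_cone V N e p" for i
    using generators_in_E_cone[of e N p] e p by auto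
  have main: "compress_cone k V (E_seq k V N e p n) \<and> (\<forall>s \<in> E_cone V N e p. tensor V (1\<^sub>m k) s \<in> E_seq k V N e p n)" for n
  proof (induction n)
    case 0
    have "compress_cone k V (E_max V N e p k)"
      unfolding E_max_eq by (intro compress_cone_arch_closure compress_cone_D_max e tensor_one_in_D_max k gen)
    moreover have "D_max V N e p k \<subseteq> E_max V N e p k"
      unfolding E_max_eq by (intro cone_subset_arch_closure compress_cone_D_max tensor_one_in_D_max k gen)
    ultimately show ?case using tensor_one_in_D_max[OF k] by auto
  next
    case (Suc n)
    have i: "n mod N + 1 \<in> {1..N}" using N by (simp add: Suc_leI)
    have q: "e \<ominus>\<^bsub>V\<^esub> p (n mod N + 1) \<in> carrier V" by (rule M.minus_closed[OF e(1) p(1)[OF i]])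
    show ?case
      using compress_cone_proj_cone[of k _ "p (n mod N + 1)" e] proj_cone_extensive[of k _ "p (n mod N + 1)" e]
        Suc gen(2)[OF i] gen(3)[OF i] p(1)[OF i] q by (simp add: subset_iff)
  qed
  then show "compress_cone k V (E_seq k V N e p n)" "s \<in> E_cone V N e p \<Longrightarrow> tensor V (1\<^sub>m k) s \<in> E_seq k V N e p n"
    by blast+
  have i: "n mod N + 1 \<in> {1..N}" using N by (simp add: Suc_leI)
  have q: "e \<ominus>\<^bsub>V\<^esub> p (n mod N + 1) \<in> carrier V" by (rule M.minus_closed[OF e(1) p(1)[OF i]])
  show "E_seq k V N e p n \<subseteq> E_seq k V N e p (Suc n)"
    using proj_cone_extensive[of k "E_seq k V N e p n" "p (n mod N + 1)" e] main[of n] gen(2)[OF i] gen(3)[OF i] p(1)[OF i] q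
    by simp
qed

lemma compress_cone_Union:
  assumes "\<And>n. compress_cone k V (C n)" "\<And>n. C n \<subseteq> C (Suc n)"
  shows "compress_cone k V (\<Union>n::nat. C n)"
proof -
  have mono: "C m \<subseteq> C n" if "m \<le> n" for m n using lift_Suc_mono_le[of C, OF assms(2) that] .
  show ?thesis
    unfolding compress_cone_def
  proof (intro conjI ballI)
    show "(\<Union>n. C n) \<subseteq> herm k V" using compress_coneD(1)[OF assms(1)] by blast
    fix x y assume "x \<in> (\<Union>n. C n)" "y \<in> (\<Union>n. C n)"
    then obtain m n where "x \<in> C m" "y \<in> C n" by blast
    then have "x \<in> C (max m n)" "y \<in> C (max m n)" using mono by (meson max.cobounded1 max.cobounded2 subsetD)+
    then show "mat_add V x y \<in> (\<Union>n. C n)" using compress_coneD(2)[OF assms(1)] by blast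
  qed (use compress_coneD(3)[OF assms(1)] in blast)
qed

text \<open>
Write \<open>x = \<Sum>\<^sub>l A\<^sub>l \<otimes> g\<^sub>l\<close> with hermitian \<open>A\<^sub>l\<close>, which is possible because \<open>x\<close> and the \<open>g\<^sub>l\<close> are hermitian. If
\<open>A\<^sub>l \<le> t\<close>, then \<open>t I \<otimes> e - A\<^sub>l \<otimes> g\<^sub>l = (t - A\<^sub>l) \<otimes> g\<^sub>l + t I \<otimes> (e - g\<^sub>l)\<close> lies in the cone; the summands are added
up one at a time.
\<close>

lemma dominated_by_unit:
  assumes C: "compress_cone k V C" and e: "e \<in> carrier V" "tensor V (1\<^sub>m k) e \<in> C"
    and g: "\<And>l. l < n \<Longrightarrow> g l \<in> carrier V \<and> star V (g l) = g l"
    and gC: "\<And>l. l < n \<Longrightarrow> tensor V (1\<^sub>m k) (g l) \<in> C \<and> tensor V (1\<^sub>m k) (e \<ominus>\<^bsub>V\<^esub> g l) \<in> C"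
    and span: "\<And>v. v \<in> carrier V \<Longrightarrow> \<exists>c. v = (\<Oplus>\<^bsub>V\<^esub>l\<in>{..<n::nat}. c l \<odot>\<^bsub>V\<^esub> g l)"
    and x: "x \<in> herm k V"
  shows "\<exists>r>0. mat_add V (mat_scale V r (tensor V (1\<^sub>m k) e)) (mat_neg V x) \<in> C"
proof -
  have xc: "x $$ (i, j) \<in> carrier V" if "i < k" "j < k" for i j
    using matsD(3)[OF hermD(1)[OF x]] that by blast
  define c where "c i j = (SOME c. x $$ (i, j) = (\<Oplus>\<^bsub>V\<^esub>l\<in>{..<n}. c l \<odot>\<^bsub>V\<^esub> g l))" for i j
  have c: "x $$ (i, j) = (\<Oplus>\<^bsub>V\<^esub>l\<in>{..<n}. c i j l \<odot>\<^bsub>V\<^esub> g l)" if "i < k" "j < k" for i j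
    using someI_ex[OF span[OF xc[OF that]]] unfolding c_def .
  \<comment> \<open>Averaging the coefficients of \<open>x\<close> with those of its adjoint makes them hermitian.\<close>
  define A where "A l = mat k k (\<lambda>(i, j). (c i j l + cnj (c j i l)) / 2)" for l
  have A: "A l \<in> carrier_mat k k" "mat_adjoint (A l) = A l" for l
    unfolding A_def by (auto intro!: eq_matI)
  \<comment> \<open>The partial sum of the \<open>A l \<otimes> g l\<close> over \<open>l < m\<close>.\<close>
  define X where "X m = mat k k (\<lambda>ij. \<Oplus>\<^bsub>V\<^esub>l\<in>{..<m}. A l $$ ij \<odot>\<^bsub>V\<^esub> g l)" for m
  have Xc: "(\<Oplus>\<^bsub>V\<^esub>l\<in>{..<m}. A l $$ ij \<odot>\<^bsub>V\<^esub> g l) \<in> carrier V" if "m \<le> n" for m ij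
    using that g by (intro finsum_mem scale_closed) auto
  have X: "X m \<in> mats k V" if "m \<le> n" for m
    using Xc[OF that] by (intro matsI) (simp_all add: X_def)
  have "m \<le> n \<Longrightarrow> \<exists>r>0. mat_add V (mat_scale V r (tensor V (1\<^sub>m k) e)) (mat_neg V (X m)) \<in> C" for m
  proof (induction m)
    case 0
    have "mat_add V (mat_scale V 1 (tensor V (1\<^sub>m k) e)) (mat_neg V (X 0)) = tensor V (1\<^sub>m k) e"
      using e(1) by (intro eq_matI) (simp_all add: X_def)
    then show ?case using e(2) by (intro exI[of _ 1]) (simp only: zero_less_one simp_thms)
  next
    case (Suc m)
    then obtain r where r: "r > 0" "mat_add V (mat_scale V r (tensor V (1\<^sub>m k) e)) (mat_neg V (X m)) \<in> C" by auto
    obtain t where t: "t > 0" "psd k (complex_of_real t \<cdot>\<^sub>m 1\<^sub>m k - A m)" using psd_hermitian_bound[OF A] by blast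
    have gm: "g m \<in> carrier V" "tensor V (1\<^sub>m k) (g m) \<in> C" "tensor V (1\<^sub>m k) (e \<ominus>\<^bsub>V\<^esub> g m) \<in> C"
      using g[of m] gC[of m] Suc.prems by auto
    have "mat_add V (mat_scale V (r + t) (tensor V (1\<^sub>m k) e)) (mat_neg V (X (Suc m)))
        = mat_add V (mat_add V (mat_scale V r (tensor V (1\<^sub>m k) e)) (mat_neg V (X m)))
           (mat_add V (tensor V (complex_of_real t \<cdot>\<^sub>m 1\<^sub>m k - A m) (g m)) (mat_scale V t (tensor V (1\<^sub>m k) (e \<ominus>\<^bsub>V\<^esub> g m))))"
      (is "?L = ?R")
    proof (rule eq_matI)
      fix i j assume "i < dim_row ?R" "j < dim_col ?R"
      then have ij: "i < k" "j < k" by auto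
      let ?d = "(1\<^sub>m k :: complex mat) $$ (i, j)" and ?a = "A m $$ (i, j)"
      define Y where "Y = X m $$ (i, j)"
      have Y: "Y \<in> carrier V" using matsD(3)[OF X[of m] ij] Suc.prems unfolding Y_def by simp
      have q: "e \<ominus>\<^bsub>V\<^esub> g m \<in> carrier V" using e gm by (intro M.minus_closed)
      have XS: "X (Suc m) $$ (i, j) = Y \<oplus>\<^bsub>V\<^esub> ?a \<odot>\<^bsub>V\<^esub> g m"
        unfolding X_def Y_def using ij Suc.prems g by (simp, intro finsum_lessThan_Suc scale_closed) auto
      have e_eq: "e = g m \<oplus>\<^bsub>V\<^esub> (e \<ominus>\<^bsub>V\<^esub> g m)"
        using e gm by (simp add: a_minus_def M.a_lcomm[of "g m" e] M.r_neg)
      have L: "?L $$ (i, j) = (complex_of_real r * ?d + complex_of_real t * ?d) \<odot>\<^bsub>V\<^esub> e \<oplus>\<^bsub>V\<^esub> \<ominus>\<^bsub>V\<^esub> (Y \<oplus>\<^bsub>V\<^esub> ?a \<odot>\<^bsub>V\<^esub> g m)"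
        using ij e(1) XS by (simp add: X_def[of "Suc m"] ring_distribs)
      have R: "?R $$ (i, j) = (complex_of_real r * ?d) \<odot>\<^bsub>V\<^esub> e \<oplus>\<^bsub>V\<^esub> \<ominus>\<^bsub>V\<^esub> Y
          \<oplus>\<^bsub>V\<^esub> ((complex_of_real t * ?d + - ?a) \<odot>\<^bsub>V\<^esub> g m \<oplus>\<^bsub>V\<^esub> (complex_of_real t * ?d) \<odot>\<^bsub>V\<^esub> (e \<ominus>\<^bsub>V\<^esub> g m))"
        using ij e(1) A(1)[of m] q carrier_matD[OF A(1)[of m]] unfolding Y_def by (simp add: X_def[of m])
      have te: "(complex_of_real t * ?d) \<odot>\<^bsub>V\<^esub> e
          = (complex_of_real t * ?d) \<odot>\<^bsub>V\<^esub> g m \<oplus>\<^bsub>V\<^esub> (complex_of_real t * ?d) \<odot>\<^bsub>V\<^esub> (e \<ominus>\<^bsub>V\<^esub> g m)"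
        by (subst e_eq) (rule scale_right_distrib[OF gm(1) q])
      show "?L $$ (i, j) = ?R $$ (i, j)"
        unfolding L R scale_left_distrib[OF e(1)] scale_left_distrib[OF gm(1)] te
        using Y q gm(1) e(1) by (simp add: M.minus_add neg_scale M.a_ac)
    qed (auto simp: X_def carrier_matD[OF A(1)])
    also have "\<dots> \<in> C"
      using t by (intro compress_coneD(2)[OF C] r cone_tensor_psd[OF C gm(1,2)] cone_scale[OF C gm(3)]) auto
    finally show ?case using r(1) t(1) by (intro exI[of _ "r + t"]) auto
  qed
  then have "\<exists>r>0. mat_add V (mat_scale V r (tensor V (1\<^sub>m k) e)) (mat_neg V (X n)) \<in> C" by simp
  moreover have "X n = x"
  proof (rule mats_eqI[OF X hermD(1)[OF x]])
    fix i j assume ij: "i < k" "j < k"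
    have gl: "g l \<in> carrier V" "star V (g l) = g l" if "l \<in> {..<n}" for l using g that by auto
    have "star V (x $$ (j, i)) = (\<Oplus>\<^bsub>V\<^esub>l\<in>{..<n}. star V (c j i l \<odot>\<^bsub>V\<^esub> g l))"
      unfolding c[OF ij(2,1)] by (intro star_finsum scale_closed gl)
    also have "\<dots> = (\<Oplus>\<^bsub>V\<^esub>l\<in>{..<n}. cnj (c j i l) \<odot>\<^bsub>V\<^esub> g l)"
      by (intro finsum_eq scale_closed) (use gl in \<open>auto simp: star_smult\<close>)
    finally have "x $$ (i, j) = (\<Oplus>\<^bsub>V\<^esub>l\<in>{..<n}. cnj (c j i l) \<odot>\<^bsub>V\<^esub> g l)"
      using hermD(2)[OF x ij(2,1)] by simp
    then have "x $$ (i, j) \<oplus>\<^bsub>V\<^esub> x $$ (i, j) = (\<Oplus>\<^bsub>V\<^esub>l\<in>{..<n}. c i j l \<odot>\<^bsub>V\<^esub> g l) \<oplus>\<^bsub>V\<^esub> (\<Oplus>\<^bsub>V\<^esub>l\<in>{..<n}. cnj (c j i l) \<odot>\<^bsub>V\<^esub> g l)"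
      using c[OF ij] by simp
    also have "\<dots> = (\<Oplus>\<^bsub>V\<^esub>l\<in>{..<n}. c i j l \<odot>\<^bsub>V\<^esub> g l \<oplus>\<^bsub>V\<^esub> cnj (c j i l) \<odot>\<^bsub>V\<^esub> g l)"
      by (intro finsum_plus[symmetric] scale_closed gl)
    also have "\<dots> = (\<Oplus>\<^bsub>V\<^esub>l\<in>{..<n}. 2 \<odot>\<^bsub>V\<^esub> (A l $$ (i, j) \<odot>\<^bsub>V\<^esub> g l))"
    proof (intro finsum_eq scale_closed gl)
      fix l assume l: "l \<in> {..<n}"
      have "2 * A l $$ (i, j) = c i j l + cnj (c j i l)" using ij by (simp add: A_def)
      then show "c i j l \<odot>\<^bsub>V\<^esub> g l \<oplus>\<^bsub>V\<^esub> cnj (c j i l) \<odot>\<^bsub>V\<^esub> g l = 2 \<odot>\<^bsub>V\<^esub> (A l $$ (i, j) \<odot>\<^bsub>V\<^esub> g l)"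
        using gl[OF l] by (simp only: scale_scale scale_left_distrib)
    qed
    also have "\<dots> = 2 \<odot>\<^bsub>V\<^esub> (\<Oplus>\<^bsub>V\<^esub>l\<in>{..<n}. A l $$ (i, j) \<odot>\<^bsub>V\<^esub> g l)"
      by (intro scale_finsum[symmetric] scale_closed gl)
    also have "\<dots> = 2 \<odot>\<^bsub>V\<^esub> X n $$ (i, j)" using ij unfolding X_def by simp
    finally have "2 \<odot>\<^bsub>V\<^esub> x $$ (i, j) = 2 \<odot>\<^bsub>V\<^esub> X n $$ (i, j)"
      using scale_left_distrib[OF xc[OF ij], of 1 1] xc[OF ij] by simp
    then have "(1/2) \<odot>\<^bsub>V\<^esub> (2 \<odot>\<^bsub>V\<^esub> x $$ (i, j)) = (1/2) \<odot>\<^bsub>V\<^esub> (2 \<odot>\<^bsub>V\<^esub> X n $$ (i, j))" by simp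
    then show "X n $$ (i, j) = x $$ (i, j)"
      using xc[OF ij] matsD(3)[OF X[OF le_refl] ij] by simp
  qed simp
  ultimately show ?thesis by simp
qed

end

section \<open>Pulling cones back along star-linear maps\<close>

locale star_linear_map = V: star_vector_space V + W: star_vector_space W
  for V :: "'v star_vs" and W :: "'w star_vs" +
  fixes \<pi> :: "'v \<Rightarrow> 'w"
  assumes linear: "linear_map class_ring V W \<pi>"
    and map_star: "v \<in> carrier V \<Longrightarrow> \<pi> (star V v) = star W (\<pi> v)"
begin

lemma hom: "mod_hom class_ring V W \<pi>"
  using linear unfolding linear_map_def by simp

lemma map_closed [simp]: "v \<in> carrier V \<Longrightarrow> \<pi> v \<in> carrier W"
  using mod_hom.f_im[OF hom] .

lemma map_add: "v \<in> carrier V \<Longrightarrow> w \<in> carrier V \<Longrightarrow> \<pi> (v \<oplus>\<^bsub>V\<^esub> w) = \<pi> v \<oplus>\<^bsub>W\<^esub> \<pi> w"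
  using LinearCombinations.module_hom_add[OF mod_hom.f_hom[OF hom]] .

lemma map_scale: "v \<in> carrier V \<Longrightarrow> \<pi> (c \<odot>\<^bsub>V\<^esub> v) = c \<odot>\<^bsub>W\<^esub> \<pi> v"
  using LinearCombinations.module_hom_smult[OF mod_hom.f_hom[OF hom], of c v] by simp

lemma map_zero: "\<pi> \<zero>\<^bsub>V\<^esub> = \<zero>\<^bsub>W\<^esub>"
  using mod_hom.f0_is_0[OF hom] .

lemma map_minus: "v \<in> carrier V \<Longrightarrow> w \<in> carrier V \<Longrightarrow> \<pi> (v \<ominus>\<^bsub>V\<^esub> w) = \<pi> v \<ominus>\<^bsub>W\<^esub> \<pi> w"
  using mod_hom.f_minus[OF hom] .

lemma map_neg: "v \<in> carrier V \<Longrightarrow> \<pi> (\<ominus>\<^bsub>V\<^esub> v) = \<ominus>\<^bsub>W\<^esub> \<pi> v"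
  using mod_hom.f_neg[OF hom] .

lemma map_finsum:
  assumes "\<And>i. i \<in> I \<Longrightarrow> v i \<in> carrier V"
  shows "\<pi> (\<Oplus>\<^bsub>V\<^esub>i\<in>I. v i) = (\<Oplus>\<^bsub>W\<^esub>i\<in>I. \<pi> (v i))"
  using assms
proof (induction I rule: infinite_finite_induct)
  case (insert i I)
  then show ?case
    by (simp add: V.M.finsum_insert W.M.finsum_insert Pi_def map_add V.finsum_mem)
qed (auto simp: V.M.finsum_infinite W.M.finsum_infinite map_zero)

lemma map_mats:
  assumes "x \<in> mats n V"
  shows "map_mat \<pi> x \<in> mats n W"
  using V.matsD[OF assms] by (intro W.matsI) simp_all

lemma map_herm:
  assumes "x \<in> herm n V"
  shows "map_mat \<pi> x \<in> herm n W"
proof (rule W.hermI)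
  have x: "x \<in> mats n V" using assms by (rule V.hermD)
  show "map_mat \<pi> x \<in> mats n W" using map_mats[OF x] .
  fix i j assume ij: "i < n" "j < n"
  show "star W (map_mat \<pi> x $$ (i, j)) = map_mat \<pi> x $$ (j, i)"
    using V.matsD[OF x] ij V.hermD(2)[OF assms ij] map_star[OF V.matsD(3)[OF x ij]] by simp
qed

lemma map_mat_add:
  assumes "x \<in> mats n V" "y \<in> mats n V"
  shows "map_mat \<pi> (mat_add V x y) = mat_add W (map_mat \<pi> x) (map_mat \<pi> y)"
  using V.matsD[OF assms(1)] V.matsD[OF assms(2)] by (intro eq_matI) (simp_all add: map_add)

lemma map_mat_scale:
  assumes "x \<in> mats n V"
  shows "map_mat \<pi> (mat_scale V r x) = mat_scale W r (map_mat \<pi> x)"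
  using V.matsD[OF assms(1)] by (intro eq_matI) (simp_all add: map_scale)

lemma map_mat_neg:
  assumes "x \<in> mats n V"
  shows "map_mat \<pi> (mat_neg V x) = mat_neg W (map_mat \<pi> x)"
  using V.matsD[OF assms(1)] by (intro eq_matI) (simp_all add: map_neg)

lemma map_tensor:
  assumes "v \<in> carrier V"
  shows "map_mat \<pi> (tensor V A v) = tensor W A (\<pi> v)"
  using assms by (intro eq_matI) (simp_all add: map_scale)

lemma map_compress:
  assumes "x \<in> mats m V" "\<alpha> \<in> carrier_mat m n"
  shows "map_mat \<pi> (compress V \<alpha> x) = compress W \<alpha> (map_mat \<pi> x)"
proof (rule W.mats_eqI[of _ n])
  fix i j assume ij: "i < n" "j < n"
  have x: "x $$ (a, b) \<in> carrier V" if "a \<in> {..<m}" "b \<in> {..<m}" for a b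
    using V.matsD(3)[OF assms(1)] that by simp
  let ?c = "\<lambda>a b. cnj (\<alpha> $$ (a, i)) * \<alpha> $$ (b, j)"
  have "\<pi> (compress V \<alpha> x $$ (i, j)) = (\<Oplus>\<^bsub>W\<^esub>a\<in>{..<m}. \<pi> (\<Oplus>\<^bsub>V\<^esub>b\<in>{..<m}. ?c a b \<odot>\<^bsub>V\<^esub> x $$ (a, b)))"
    unfolding V.compress_index[OF assms(2,1) ij] V.entry_sum_def
    by (intro map_finsum V.finsum_mem V.scale_closed x)
  also have "\<dots> = (\<Oplus>\<^bsub>W\<^esub>a\<in>{..<m}. \<Oplus>\<^bsub>W\<^esub>b\<in>{..<m}. \<pi> (?c a b \<odot>\<^bsub>V\<^esub> x $$ (a, b)))"
    by (intro W.finsum_eq map_finsum W.finsum_mem map_closed V.scale_closed x)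
  also have "\<dots> = (\<Oplus>\<^bsub>W\<^esub>a\<in>{..<m}. \<Oplus>\<^bsub>W\<^esub>b\<in>{..<m}. ?c a b \<odot>\<^bsub>W\<^esub> map_mat \<pi> x $$ (a, b))"
    by (intro W.finsum_eq W.finsum_mem W.scale_closed)
       (use x V.matsD(1,2)[OF assms(1)] in \<open>simp_all add: map_scale\<close>)
  also have "\<dots> = compress W \<alpha> (map_mat \<pi> x) $$ (i, j)"
    unfolding W.compress_index[OF assms(2) map_mats[OF assms(1)] ij] W.entry_sum_def ..
  finally show "map_mat \<pi> (compress V \<alpha> x) $$ (i, j) = compress W \<alpha> (map_mat \<pi> x) $$ (i, j)"
    using assms(2) ij by simp
qed (intro map_mats V.compress_mats[OF assms(2,1)] W.compress_mats[OF assms(2)] assms(1))+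

definition preimage_cone :: "nat \<Rightarrow> 'w mat set \<Rightarrow> 'v mat set" where
  "preimage_cone k C = {x \<in> herm k V. map_mat \<pi> x \<in> C}"

lemma compress_cone_preimage:
  assumes C: "compress_cone k W C"
  shows "compress_cone k V (preimage_cone k C)"
  unfolding compress_cone_def preimage_cone_def
  using compress_coneD(2,3)[OF C]
  by (auto simp: map_mat_add[of _ k] map_compress[of _ k _ k] V.hermD(1) intro: V.mat_add_herm V.compress_herm)

lemma tensor_one_in_preimage:
  assumes "v \<in> carrier V" "star V v = v"
  shows "tensor V (1\<^sub>m k) v \<in> preimage_cone k C \<longleftrightarrow> tensor W (1\<^sub>m k) (\<pi> v) \<in> C"
  unfolding preimage_cone_def using assms V.tensor_one_herm[OF assms] by (simp add: map_tensor)

text \<open>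
This lemma and the next say that the preimage inherits stability under the steps of the construction,
since \<open>\<pi>\<close> carries the defining conditions over \<open>V\<close> to those over \<open>W\<close>.
\<close>

lemma arch_closure_preimage:
  assumes "e \<in> carrier V" "arch_closure k W (\<pi> e) C \<subseteq> C"
  shows "arch_closure k V e (preimage_cone k C) \<subseteq> preimage_cone k C"
proof
  fix x assume x: "x \<in> arch_closure k V e (preimage_cone k C)"
  then have xh: "x \<in> herm k V" unfolding arch_closure_def by simp
  have u: "tensor V (1\<^sub>m k) e \<in> mats k V" using assms(1) by (intro V.tensor_mats) auto
  have "map_mat \<pi> x \<in> arch_closure k W (\<pi> e) C"
    unfolding arch_closure_def
  proof (intro CollectI conjI allI impI map_herm xh)
    fix \<epsilon> :: real assume "\<epsilon> > 0"
    then have "map_mat \<pi> (mat_add V x (mat_scale V \<epsilon> (tensor V (1\<^sub>m k) e))) \<in> C"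
      using x unfolding arch_closure_def preimage_cone_def by auto
    then show "mat_add W (map_mat \<pi> x) (mat_scale W \<epsilon> (tensor W (1\<^sub>m k) (\<pi> e))) \<in> C"
      by (simp add: map_mat_add[OF V.hermD(1)[OF xh] V.mat_scale_mats[OF u]] map_mat_scale[OF u] map_tensor[OF assms(1)])
  qed
  then show "x \<in> preimage_cone k C" using assms(2) xh unfolding preimage_cone_def by blast
qed

lemma proj_cone_preimage:
  assumes e: "e \<in> carrier V" and p: "p \<in> carrier V" and proj: "proj_cone k W (\<pi> e) (\<pi> p) C \<subseteq> C"
  shows "proj_cone k V e p (preimage_cone k C) \<subseteq> preimage_cone k C"
proof
  fix x assume x: "x \<in> proj_cone k V e p (preimage_cone k C)"
  then have xh: "x \<in> herm k V" unfolding proj_cone_def by simp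
  have q: "e \<ominus>\<^bsub>V\<^esub> p \<in> carrier V" by (rule V.M.minus_closed[OF e p])
  have map: "map_mat \<pi> (mat_add V (mat_add V (compress V (\<alpha> + \<beta>) x) (tensor V A p)) (tensor V B (e \<ominus>\<^bsub>V\<^esub> p)))
      = mat_add W (mat_add W (compress W (\<alpha> + \<beta>) (map_mat \<pi> x)) (tensor W A (\<pi> p))) (tensor W B (\<pi> e \<ominus>\<^bsub>W\<^esub> \<pi> p))"
    if "\<alpha> \<in> carrier_mat k k" "\<beta> \<in> carrier_mat k k" "A \<in> carrier_mat k k" "B \<in> carrier_mat k k" for \<alpha> \<beta> A B
  proof -
    have ab: "\<alpha> + \<beta> \<in> carrier_mat k k" using that by simp
    have c: "compress V (\<alpha> + \<beta>) x \<in> mats k V" by (rule V.compress_mats[OF ab V.hermD(1)[OF xh]])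
    note A = V.tensor_mats[OF that(3) p] and B = V.tensor_mats[OF that(4) q]
    show ?thesis
      unfolding map_mat_add[OF V.mat_add_mats[OF c A] B] map_mat_add[OF c A] map_compress[OF V.hermD(1)[OF xh] ab]
        map_tensor[OF p] map_tensor[OF q] map_minus[OF e p] ..
  qed
  have "map_mat \<pi> x \<in> proj_cone k W (\<pi> e) (\<pi> p) C"
    unfolding proj_cone_def
  proof (intro CollectI conjI allI impI map_herm xh)
    fix \<epsilon> :: real assume "\<epsilon> > 0"
    then obtain t where t: "t > 0" and mem: "\<forall>\<alpha>\<in>carrier_mat k k. \<forall>\<beta>\<in>carrier_mat k k.
       mat_add V
         (mat_add V (compress V (\<alpha> + \<beta>) x)
           (tensor V (complex_of_real \<epsilon> \<cdot>\<^sub>m (mat_adjoint \<alpha> * \<alpha>)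
                      + complex_of_real t \<cdot>\<^sub>m (mat_adjoint \<beta> * \<beta>)) p))
         (tensor V (complex_of_real \<epsilon> \<cdot>\<^sub>m (mat_adjoint \<beta> * \<beta>)
                      + complex_of_real t \<cdot>\<^sub>m (mat_adjoint \<alpha> * \<alpha>)) (e \<ominus>\<^bsub>V\<^esub> p)) \<in> preimage_cone k C"
      using x unfolding proj_cone_def by blast
    show "\<exists>t>0. \<forall>\<alpha>\<in>carrier_mat k k. \<forall>\<beta>\<in>carrier_mat k k.
       mat_add W
         (mat_add W (compress W (\<alpha> + \<beta>) (map_mat \<pi> x))
           (tensor W (complex_of_real \<epsilon> \<cdot>\<^sub>m (mat_adjoint \<alpha> * \<alpha>)
                      + complex_of_real t \<cdot>\<^sub>m (mat_adjoint \<beta> * \<beta>)) (\<pi> p)))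
         (tensor W (complex_of_real \<epsilon> \<cdot>\<^sub>m (mat_adjoint \<beta> * \<beta>)
                      + complex_of_real t \<cdot>\<^sub>m (mat_adjoint \<alpha> * \<alpha>)) (\<pi> e \<ominus>\<^bsub>W\<^esub> \<pi> p)) \<in> C"
    proof (intro exI[of _ t] conjI t ballI)
      fix \<alpha> \<beta> :: "complex mat" assume ab: "\<alpha> \<in> carrier_mat k k" "\<beta> \<in> carrier_mat k k"
      have W: "complex_of_real a \<cdot>\<^sub>m (mat_adjoint \<alpha> * \<alpha>) + complex_of_real b \<cdot>\<^sub>m (mat_adjoint \<beta> * \<beta>) \<in> carrier_mat k k"
        "complex_of_real a \<cdot>\<^sub>m (mat_adjoint \<beta> * \<beta>) + complex_of_real b \<cdot>\<^sub>m (mat_adjoint \<alpha> * \<alpha>) \<in> carrier_mat k k" for a b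
        using ab by auto
      show "mat_add W
         (mat_add W (compress W (\<alpha> + \<beta>) (map_mat \<pi> x))
           (tensor W (complex_of_real \<epsilon> \<cdot>\<^sub>m (mat_adjoint \<alpha> * \<alpha>)
                      + complex_of_real t \<cdot>\<^sub>m (mat_adjoint \<beta> * \<beta>)) (\<pi> p)))
         (tensor W (complex_of_real \<epsilon> \<cdot>\<^sub>m (mat_adjoint \<beta> * \<beta>)
                      + complex_of_real t \<cdot>\<^sub>m (mat_adjoint \<alpha> * \<alpha>)) (\<pi> e \<ominus>\<^bsub>W\<^esub> \<pi> p)) \<in> C"
        unfolding map[OF ab W, symmetric] using bspec[OF bspec[OF mem ab(1)] ab(2)] unfolding preimage_cone_def by simp
    qed
  qed
  then show "x \<in> preimage_cone k C" using proj xh unfolding preimage_cone_def by blast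
qed

end

text \<open>
That \<open>I \<otimes> f\<close> itself lies in the cone comes from the order unit property applied to the zero matrix.
\<close>

lemma (in star_vector_space) k_AOU_properties:
  assumes "k_AOU k V C f"
  shows "compress_cone k V C" "arch_closure k V f C \<subseteq> C" "f \<in> carrier V" "tensor V (1\<^sub>m k) f \<in> C"
    "1 \<le> k \<Longrightarrow> star V f = f"
proof -
  have C: "proper_cone k V C" "\<forall>\<alpha>\<in>carrier_mat k k. \<forall>x\<in>C. compress V \<alpha> x \<in> C" "f \<in> carrier V"
    and a: "archimedean_order_unit k V C (tensor V (1\<^sub>m k) f)"
    using assms unfolding k_AOU_def by auto
  let ?u = "tensor V (1\<^sub>m k) f"
  show cc: "compress_cone k V C"
    using C unfolding compress_cone_def proper_cone_def cone_def by auto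
  show "arch_closure k V f C \<subseteq> C" using a unfolding arch_closure_def archimedean_order_unit_def by auto
  show f: "f \<in> carrier V" by fact
  have u: "?u \<in> herm k V" using a unfolding archimedean_order_unit_def by simp
  show "star V f = f" if "1 \<le> k" using tensor_one_herm_imp[OF u f that] .
  have zero: "mat_zero k V \<in> herm k V" using C(1) cc compress_coneD(1) unfolding proper_cone_def by blast
  then obtain r where r: "r > 0" "mat_add V (mat_scale V r ?u) (mat_neg V (mat_zero k V)) \<in> C"
    using a unfolding archimedean_order_unit_def by blast
  have "mat_add V (mat_scale V r ?u) (mat_neg V (mat_zero k V)) = mat_scale V r ?u"
    using f by (intro eq_matI) (simp_all add: mat_zero_def)
  then have "mat_scale V (1 / r) (mat_scale V r ?u) \<in> C"
    using cone_scale[OF cc r(2), of "1 / r"] r(1) by simp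
  moreover have "mat_scale V (1 / r) (mat_scale V r ?u) = ?u"
    using f r(1) by (intro eq_matI) simp_all
  ultimately show "?u \<in> C" by simp
qed

text \<open>
The preimage of \<open>C\<close> is one of the cones to which minimality applies: it is Archimedean because \<open>C\<close> is,
and stable under \<open>D \<mapsto> D[p\<^sub>i]\<close> because \<open>C = C[q\<^sub>i]\<close>.
\<close>

lemma (in star_linear_map) E_proj_limit_in_preimage:
  assumes k: "1 \<le> k" and N: "1 \<le> N" and aou: "k_AOU k W C (\<pi> e)"
    and q: "\<And>i. i \<in> {1..N} \<Longrightarrow> abstract_projection k W C (\<pi> e) (\<pi> (p i))"
    and e: "e \<in> carrier V" "star V e = e"
    and p: "\<And>i. i \<in> {1..N} \<Longrightarrow> p i \<in> carrier V" "\<And>i. i \<in> {1..N} \<Longrightarrow> star V (p i) = p i"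
  shows "arch_closure k V e (\<Union>n. E_seq k V N e p n) \<subseteq> preimage_cone k C"
proof -
  note C = W.k_AOU_properties[OF aou]
  let ?P = "preimage_cone k C"
  have P: "compress_cone k V ?P" using compress_cone_preimage[OF C(1)] .
  have arch: "arch_closure k V e ?P \<subseteq> ?P" using arch_closure_preimage[OF e(1) C(2)] .
  have eP: "tensor V (1\<^sub>m k) e \<in> ?P" using C(4) e by (simp add: tensor_one_in_preimage)
  have pP: "p i \<in> carrier V \<and> tensor V (1\<^sub>m k) (p i) \<in> ?P \<and> tensor V (1\<^sub>m k) (e \<ominus>\<^bsub>V\<^esub> p i) \<in> ?P" if i: "i \<in> {1..N}" for i
  proof -
    have "e \<ominus>\<^bsub>V\<^esub> p i \<in> carrier V" by (rule V.M.minus_closed[OF e(1) p(1)[OF i]])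
    then show ?thesis
      using q[OF i] e p[OF i] unfolding abstract_projection_def positive_contraction_def
      by (simp add: tensor_one_in_preimage V.star_minus map_minus)
  qed
  have proj: "proj_cone k V e (p i) ?P \<subseteq> ?P" if i: "i \<in> {1..N}" for i
    using proj_cone_preimage[OF e(1) p(1)[OF i]] q[OF i] unfolding abstract_projection_def by auto
  have "E_seq k V N e p n \<subseteq> ?P" for n
    by (rule V.E_seq_minimal[OF P k N arch e(1) eP pP proj])
  then show ?thesis
    using arch by (meson UN_least arch_closure_mono subset_trans)
qed

section \<open>The universal space of the relations\<close>

text \<open>
A nonzero vector of the kernel could be completed to a generating set of \<open>V\<close> by fewer than \<open>dim V\<close>
vectors, and the images of these would still generate \<open>W\<close>.
\<close>

lemma surj_same_dim_imp_trivial_kernel: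
  assumes lin: "linear_map K V W T" and fd: "vectorspace.fin_dim K V" and surj: "carrier W \<subseteq> T ` carrier V"
    and dim: "vectorspace.dim K V = vectorspace.dim K W"
    and v: "v \<in> carrier V" and Tv: "T v = \<zero>\<^bsub>W\<^esub>"
  shows "v = \<zero>\<^bsub>V\<^esub>"
proof (rule ccontr)
  interpret V: vectorspace K V using lin by (simp add: linear_map_def)
  interpret W: vectorspace K W using lin by (simp add: linear_map_def)
  have hom: "T \<in> LinearCombinations.module_hom K V W"
    using lin by (simp add: linear_map_def mod_hom_def mod_hom_axioms_def)
  note T = module_hom_closed[OF hom, THEN funcset_mem] LinearCombinations.module_hom_add[OF hom]
    LinearCombinations.module_hom_smult[OF hom]
  have T0: "T \<zero>\<^bsub>V\<^esub> = \<zero>\<^bsub>W\<^esub>"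
    using T(3)[of "\<zero>\<^bsub>K\<^esub>" "\<zero>\<^bsub>V\<^esub>"] T(1)[of "\<zero>\<^bsub>V\<^esub>"] by simp
  assume nz: "v \<noteq> \<zero>\<^bsub>V\<^esub>"
  obtain B where B: "finite B" "V.basis B" using V.finite_basis_exists[OF fd] by blast
  then have Bc: "B \<subseteq> carrier V" and gen: "V.span B = carrier V" unfolding V.basis_def by auto
  have li: "V.lin_indpt {v}"
  proof (rule V.finite_lin_indpt2)
    fix a assume a: "a \<in> {v} \<rightarrow> carrier K" "V.lincomb a {v} = \<zero>\<^bsub>V\<^esub>"
    then have "a v \<odot>\<^bsub>V\<^esub> v = \<zero>\<^bsub>V\<^esub>" using v by (simp add: V.lincomb_def)
    then have "a v = \<zero>\<^bsub>K\<^esub>"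
      using V.mult_inverse[of "a v" v "\<zero>\<^bsub>V\<^esub>"] a(1) v nz by auto
    then show "\<forall>w\<in>{v}. a w = \<zero>\<^bsub>K\<^esub>" by simp
  qed (use v in auto)
  obtain C where C: "finite C" "C \<subseteq> carrier V" "int (card C) \<le> int (card B) - int (card {v})"
    "V.span ({v} \<union> C) = V.span B"
    using V.replacement[of "{v}" B] B(1) Bc li v gen by auto
  have TC: "T ` C \<subseteq> carrier W" using C(2) T(1) by auto
  note sub = W.span_is_submodule[OF TC]
  define S where "S = {u \<in> carrier V. T u \<in> W.span (T ` C)}"
  have "submodule K S V"
    by (rule submodule.intro)
       (use submodule.m_closed[OF sub] submodule.zero_closed[OF sub] submodule.smult_closed[OF sub] V.module_axioms
         in \<open>auto simp: S_def T T0\<close>)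
  moreover have "{v} \<union> C \<subseteq> S"
    using W.in_own_span[OF TC] v C(2) Tv submodule.zero_closed[OF sub] unfolding S_def by auto
  ultimately have "carrier V \<subseteq> S" using V.span_is_subset C(4) gen by metis
  then have "W.span (T ` C) = carrier W"
    using surj W.span_is_subset2[OF TC] unfolding S_def by blast
  then have "W.dim \<le> card (T ` C)" using W.gen_ge_dim[OF _ TC] C(1) by simp
  also have "\<dots> \<le> card C" by (rule card_image_le[OF C(1)])
  also have "\<dots> < card B" using C(3) by simp
  also have "\<dots> = W.dim" using V.dim_basis[OF B] dim by simp
  finally show False by simp
qed

locale real_relations =
  fixes N l :: nat and M :: "real mat"
  assumes M_carrier: "M \<in> carrier_mat l (N + 1)"
begin

sublocale A: vec_space "TYPE(complex)" "N + 1" .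

abbreviation J :: "complex vec set" where "J \<equiv> rel_span N M"

abbreviation U :: "complex vec set star_vs" where "U \<equiv> univ_space N M"

definition cls :: "complex vec \<Rightarrow> complex vec set" where
  "cls v = J +>\<^bsub>ambient N\<^esub> v"

lemma relation_rows:
  "set (rows (map_mat complex_of_real M)) = {vec (N + 1) (\<lambda>j. complex_of_real (M $$ (i, j))) | i. i < l}"
proof -
  have "row (map_mat complex_of_real M) i = vec (N + 1) (\<lambda>j. complex_of_real (M $$ (i, j)))" if "i < l" for i
    using that M_carrier by (intro eq_vecI) auto
  then show ?thesis
    unfolding rows_def using M_carrier by (auto simp: image_iff)
qed

lemma J_submodule: "submodule class_ring J (ambient N)"
  unfolding rel_span_def
  by (rule A.span_is_submodule) (auto simp: relation_rows)

lemma J_closed: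
  "v \<in> J \<Longrightarrow> v \<in> carrier_vec (N + 1)"
  "v \<in> J \<Longrightarrow> w \<in> J \<Longrightarrow> v + w \<in> J"
  "0\<^sub>v (N + 1) \<in> J"
  "v \<in> J \<Longrightarrow> c \<cdot>\<^sub>v v \<in> J"
  using submodule.subset[OF J_submodule] submodule.m_closed[OF J_submodule] submodule.zero_closed[OF J_submodule]
    submodule.smult_closed[OF J_submodule]
  by (auto simp: module_vec_simps)

lemma J_least:
  assumes "\<And>i. i < l \<Longrightarrow> P (vec (N + 1) (\<lambda>j. complex_of_real (M $$ (i, j))))"
    and "P (0\<^sub>v (N + 1))"
    and "\<And>v w. v \<in> carrier_vec (N + 1) \<Longrightarrow> w \<in> carrier_vec (N + 1) \<Longrightarrow> P v \<Longrightarrow> P w \<Longrightarrow> P (v + w)"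
    and "\<And>v c. v \<in> carrier_vec (N + 1) \<Longrightarrow> P v \<Longrightarrow> P (c \<cdot>\<^sub>v v)"
    and "v \<in> J"
  shows "P v"
proof -
  let ?S = "{v \<in> carrier_vec (N + 1). P v}"
  have "submodule class_ring ?S (ambient N)"
    by (rule submodule.intro) (use assms(2-4) vec_module in \<open>auto simp: module_vec_simps\<close>)
  moreover have "set (rows (map_mat complex_of_real M)) \<subseteq> ?S"
    using assms(1) by (auto simp: relation_rows)
  ultimately have "J \<subseteq> ?S" unfolding rel_span_def by (intro A.span_is_subset)
  then show ?thesis using assms(5) by auto
qed

text \<open>
The coefficients of the relations are real, so the rows are fixed by conjugation.
\<close>

lemma J_conjugate: "v \<in> J \<Longrightarrow> conjugate v \<in> J"
proof (rule J_least[of "\<lambda>v. conjugate v \<in> J"])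
  fix i assume i: "i < l"
  let ?r = "vec (N + 1) (\<lambda>j. complex_of_real (M $$ (i, j)))"
  have "conjugate ?r = ?r" by (intro eq_vecI) (auto simp: conjugate_complex_def)
  moreover have "?r \<in> J"
  proof -
    have "set (rows (map_mat complex_of_real M)) \<subseteq> carrier (ambient N)"
      unfolding relation_rows by (auto simp: module_vec_simps)
    from A.in_own_span[OF this[unfolded module_vec_simps]] show ?thesis
      unfolding rel_span_def using i relation_rows by blast
  qed
  ultimately show "conjugate ?r \<in> J" by simp
next
  show "conjugate (0\<^sub>v (N + 1)) \<in> J" using J_closed(3) by (simp only: conjugate_zero_vec)
next
  fix v w :: "complex vec"
  assume "v \<in> carrier_vec (N + 1)" "w \<in> carrier_vec (N + 1)" "conjugate v \<in> J" "conjugate w \<in> J"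
  then show "conjugate (v + w) \<in> J" using J_closed(2) by (simp only: conjugate_add_vec)
next
  fix v :: "complex vec" and c
  assume "conjugate v \<in> J"
  then show "conjugate (c \<cdot>\<^sub>v v) \<in> J" using J_closed(4) by (simp only: conjugate_smult_vec)
qed

lemma cls_eq: "cls v = {h + v | h. h \<in> J}"
  unfolding cls_def a_r_coset_def' by (auto simp: module_vec_simps)

lemma cls_absorb:
  assumes "h \<in> J" "v \<in> carrier_vec (N + 1)"
  shows "cls (h + v) = cls v"
proof -
  have h: "h \<in> carrier_vec (N + 1)" using J_closed(1) assms(1) .
  have "\<exists>h''. h' + (h + v) = h'' + v \<and> h'' \<in> J" if "h' \<in> J" for h'
    using J_closed(1)[OF that] h assms J_closed(2)[OF that assms(1)] by (intro exI[of _ "h' + h"]) auto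
  moreover have "\<exists>h''. h' + v = h'' + (h + v) \<and> h'' \<in> J" if "h' \<in> J" for h'
  proof (intro exI[of _ "h' + (-1) \<cdot>\<^sub>v h"] conjI)
    show "h' + (-1) \<cdot>\<^sub>v h \<in> J" using J_closed(2)[OF that J_closed(4)[OF assms(1)]] .
    show "h' + v = h' + (-1) \<cdot>\<^sub>v h + (h + v)"
      using J_closed(1)[OF that] h assms(2) by (intro eq_vecI) auto
  qed
  ultimately show ?thesis unfolding cls_eq by blast
qed

lemma cls_eqD:
  assumes "cls v = cls w" "v \<in> carrier_vec (N + 1)"
  shows "\<exists>h\<in>J. v = h + w"
proof -
  have "0\<^sub>v (N + 1) + v \<in> cls v" unfolding cls_eq using J_closed(3) by blast
  then have "v \<in> cls w" using assms by simp
  then show ?thesis unfolding cls_eq by blast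
qed

lemma U_carrier: "carrier U = cls ` carrier_vec (N + 1)"
  unfolding univ_space_def Let_def by (auto simp: A_RCOSETS_def' cls_def module_vec_simps)

lemma U_zero: "\<zero>\<^bsub>U\<^esub> = cls (0\<^sub>v (N + 1))"
  unfolding univ_space_def Let_def cls_eq using J_closed(1) by force

lemma U_add:
  assumes "v \<in> carrier_vec (N + 1)" "w \<in> carrier_vec (N + 1)"
  shows "cls v \<oplus>\<^bsub>U\<^esub> cls w = cls (v + w)"
proof -
  have "cls v \<oplus>\<^bsub>U\<^esub> cls w = {(h + v) + (h' + w) | h h'. h \<in> J \<and> h' \<in> J}"
    unfolding univ_space_def Let_def cls_eq by (auto simp: set_add_def' module_vec_simps)
  also have "\<dots> = {h + (v + w) | h. h \<in> J}"
  proof (intro equalityI subsetI)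
    fix x assume "x \<in> {(h + v) + (h' + w) | h h'. h \<in> J \<and> h' \<in> J}"
    then obtain h h' where h: "h \<in> J" "h' \<in> J" "x = (h + v) + (h' + w)" by blast
    have "x = (h + h') + (v + w)"
      unfolding h(3) using assms J_closed(1)[OF h(1)] J_closed(1)[OF h(2)] by (intro eq_vecI) auto
    then show "x \<in> {h + (v + w) | h. h \<in> J}" using J_closed(2)[OF h(1,2)] by blast
  next
    fix x assume "x \<in> {h + (v + w) | h. h \<in> J}"
    then obtain h where h: "h \<in> J" "x = h + (v + w)" by blast
    have "x = (h + v) + (0\<^sub>v (N + 1) + w)"
      unfolding h(2) using assms J_closed(1)[OF h(1)] by (intro eq_vecI) auto
    then show "x \<in> {(h + v) + (h' + w) | h h'. h \<in> J \<and> h' \<in> J}" using h(1) J_closed(3) by blast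
  qed
  finally show ?thesis unfolding cls_eq .
qed

lemma U_smult:
  assumes "v \<in> carrier_vec (N + 1)"
  shows "c \<odot>\<^bsub>U\<^esub> cls v = cls (c \<cdot>\<^sub>v v)"
proof -
  have "cls (c \<cdot>\<^sub>v (h + v)) = cls (c \<cdot>\<^sub>v v)" if "h \<in> J" for h
    using cls_absorb[OF J_closed(4)[OF that, of c], of "c \<cdot>\<^sub>v v"] assms J_closed(1)[OF that]
    by (simp add: smult_add_distrib_vec[of _ "N + 1"])
  then have "(\<Union>x\<in>cls v. cls (c \<cdot>\<^sub>v x)) = cls (c \<cdot>\<^sub>v v)"
    using J_closed(3) by (auto simp: cls_eq[of v])
  then show ?thesis
    unfolding univ_space_def Let_def by (simp add: module_vec_simps cls_def)
qed

lemma U_star: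
  assumes "v \<in> carrier_vec (N + 1)"
  shows "star U (cls v) = cls (conjugate v)"
proof -
  have *: "conjugate ` cls w \<subseteq> cls (conjugate w)" if "w \<in> carrier_vec (N + 1)" for w
    unfolding cls_eq using J_conjugate J_closed(1) that by (fastforce simp: conjugate_add_vec[of _ "N + 1"])
  have "cls (conjugate v) \<subseteq> conjugate ` cls v"
  proof
    fix x assume "x \<in> cls (conjugate v)"
    then have "conjugate x \<in> cls (conjugate (conjugate v))" using *[of "conjugate v"] assms by auto
    then show "x \<in> conjugate ` cls v" by (metis conjugate_id image_eqI)
  qed
  then show ?thesis using *[OF assms] unfolding univ_space_def Let_def by simp
qed

lemma star_vector_space_U: "star_vector_space U"
proof -
  have "vectorspace class_ring U"
  proof (rule vs_criteria)
    show "field (class_ring :: complex ring)" by (rule class_field)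
    show "\<forall>v\<in>carrier U. \<exists>neg_v\<in>carrier U. v \<oplus>\<^bsub>U\<^esub> neg_v = \<zero>\<^bsub>U\<^esub>"
    proof
      fix x assume "x \<in> carrier U"
      then obtain v where v: "x = cls v" "v \<in> carrier_vec (N + 1)" unfolding U_carrier by blast
      then have "x \<oplus>\<^bsub>U\<^esub> cls (- v) = \<zero>\<^bsub>U\<^esub>" by (simp add: U_add U_zero)
      then show "\<exists>neg_v\<in>carrier U. x \<oplus>\<^bsub>U\<^esub> neg_v = \<zero>\<^bsub>U\<^esub>" using v unfolding U_carrier by auto
    qed
    show "\<forall>v w. v \<in> carrier U \<and> w \<in> carrier U \<longrightarrow> v \<oplus>\<^bsub>U\<^esub> w = w \<oplus>\<^bsub>U\<^esub> v"
      by (auto simp: U_carrier U_add simp flip: comm_add_vec[of _ "Suc N"])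
    show "\<forall>v w x. v \<in> carrier U \<and> w \<in> carrier U \<and> x \<in> carrier U \<longrightarrow>
      (v \<oplus>\<^bsub>U\<^esub> w) \<oplus>\<^bsub>U\<^esub> x = v \<oplus>\<^bsub>U\<^esub> (w \<oplus>\<^bsub>U\<^esub> x)"
      by (auto simp: U_carrier U_add assoc_add_vec[of _ "Suc N"])
  qed (auto simp: U_carrier U_zero U_add U_smult smult_smult_assoc add_smult_distrib_vec
        smult_add_distrib_vec[of _ "Suc N"])
  then interpret vectorspace class_ring U .
  show ?thesis
    by unfold_locales
       (auto simp: U_carrier U_star U_add U_smult conjugate_add_vec[of _ "N + 1"] conjugate_smult_vec conjugate_complex_def)
qed

sublocale U: star_vector_space U by (rule star_vector_space_U)

lemma univ_gen_eq: "univ_gen N M j = cls (unit_vec (N + 1) j)"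
  unfolding univ_gen_def cls_def ..

lemma gen_closed [simp]: "univ_gen N M j \<in> carrier U"
  unfolding univ_gen_eq U_carrier by simp

lemma gen_star [simp]: "star U (univ_gen N M j) = univ_gen N M j"
proof -
  have "conjugate (unit_vec (N + 1) j :: complex vec) = unit_vec (N + 1) j"
    by (intro eq_vecI) (auto simp: conjugate_complex_def unit_vec_def)
  then show ?thesis unfolding univ_gen_eq by (subst U_star) simp_all
qed

text \<open>
The truncations of \<open>v\<close> to its first \<open>m\<close> coordinates give the partial sums.
\<close>

lemma cls_expansion:
  assumes "v \<in> carrier_vec (N + 1)"
  shows "cls v = (\<Oplus>\<^bsub>U\<^esub>j\<in>{..<N + 1}. v $ j \<odot>\<^bsub>U\<^esub> univ_gen N M j)"
proof -
  define t where "t m = vec (N + 1) (\<lambda>i. if i < m then v $ i else 0)" for m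
  have "m \<le> N + 1 \<Longrightarrow> cls (t m) = (\<Oplus>\<^bsub>U\<^esub>j\<in>{..<m}. v $ j \<odot>\<^bsub>U\<^esub> univ_gen N M j)" for m
  proof (induction m)
    case 0
    have "t 0 = 0\<^sub>v (N + 1)" unfolding t_def by auto
    then show ?case by (simp add: U_zero)
  next
    case (Suc m)
    have "t (Suc m) = t m + v $ m \<cdot>\<^sub>v unit_vec (N + 1) m"
      unfolding t_def using Suc.prems by (intro eq_vecI) (auto simp: less_Suc_eq unit_vec_def)
    then have "cls (t (Suc m)) = cls (t m) \<oplus>\<^bsub>U\<^esub> v $ m \<odot>\<^bsub>U\<^esub> univ_gen N M m"
      unfolding univ_gen_eq by (subst U_smult, simp, subst U_add) (auto simp: t_def)
    then show ?case
      using Suc by (subst U.finsum_lessThan_Suc) auto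
  qed
  moreover have "t (N + 1) = v" unfolding t_def using assms by auto
  ultimately show ?thesis by (metis le_refl)
qed

lemma U_expansion:
  assumes "x \<in> carrier U"
  shows "\<exists>c. x = (\<Oplus>\<^bsub>U\<^esub>j\<in>{..<N + 1}. c j \<odot>\<^bsub>U\<^esub> univ_gen N M j)"
  using assms cls_expansion unfolding U_carrier by blast

lemma U_generated: "U.span (univ_gen N M ` {..<N + 1}) = carrier U"
proof -
  let ?G = "univ_gen N M ` {..<N + 1}"
  have G: "?G \<subseteq> carrier U" by auto
  note sub = U.span_is_submodule[OF G]
  have "carrier U \<subseteq> U.span ?G"
  proof
    fix x assume "x \<in> carrier U"
    then obtain c where x: "x = (\<Oplus>\<^bsub>U\<^esub>j\<in>{..<N + 1}. c j \<odot>\<^bsub>U\<^esub> univ_gen N M j)" using U_expansion by blast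
    have "m \<le> N + 1 \<Longrightarrow> (\<Oplus>\<^bsub>U\<^esub>j\<in>{..<m}. c j \<odot>\<^bsub>U\<^esub> univ_gen N M j) \<in> U.span ?G" for m
    proof (induction m)
      case (Suc m)
      have "univ_gen N M m \<in> U.span ?G" using U.in_own_span[OF G] Suc.prems by auto
      then have "c m \<odot>\<^bsub>U\<^esub> univ_gen N M m \<in> U.span ?G"
        using submodule.smult_closed[OF sub, of "c m"] by simp
      then show ?case
        using Suc submodule.m_closed[OF sub] by (subst U.finsum_lessThan_Suc) auto
    qed (use submodule.zero_closed[OF sub] in simp)
    then show "x \<in> U.span ?G" unfolding x by blast
  qed
  then show ?thesis using U.span_is_subset2[OF G] by blast
qed

lemma U_fin_dim: "U.fin_dim"
proof -
  have "univ_gen N M ` {..<N + 1} \<subseteq> carrier U" by auto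
  then show ?thesis unfolding U.fin_dim_def using U_generated by blast
qed

lemma U_induct [consumes 1, case_names generator zero add scale]:
  assumes "x \<in> carrier U" and "\<And>j. j \<le> N \<Longrightarrow> P (univ_gen N M j)" and "P \<zero>\<^bsub>U\<^esub>"
    and "\<And>x y. x \<in> carrier U \<Longrightarrow> y \<in> carrier U \<Longrightarrow> P x \<Longrightarrow> P y \<Longrightarrow> P (x \<oplus>\<^bsub>U\<^esub> y)"
    and "\<And>c x. x \<in> carrier U \<Longrightarrow> P x \<Longrightarrow> P (c \<odot>\<^bsub>U\<^esub> x)"
  shows "P x"
proof -
  have "submodule class_ring {x \<in> carrier U. P x} U"
    by (rule submodule.intro) (use assms(3-5) U.module_axioms in auto)
  then have "U.span (univ_gen N M ` {..<N + 1}) \<subseteq> {x \<in> carrier U. P x}"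
    using assms(2) by (intro U.span_is_subset) auto
  then show ?thesis using assms(1) unfolding U_generated by blast
qed

section \<open>The universal property and the cone of the universal space\<close>

lemma linear_map_unique:
  assumes \<rho>: "linear_map class_ring U W \<rho>" and \<pi>: "linear_map class_ring U W \<pi>"
    and eq: "\<And>j. j \<le> N \<Longrightarrow> \<rho> (univ_gen N M j) = \<pi> (univ_gen N M j)"
    and x: "x \<in> carrier U"
  shows "\<rho> x = \<pi> x"
proof -
  note r = \<rho>[unfolded linear_map_def] and p = \<pi>[unfolded linear_map_def]
  have hom: "mod_hom class_ring U W \<rho>" "mod_hom class_ring U W \<pi>" using r p by auto
  note add = LinearCombinations.module_hom_add[OF mod_hom.f_hom[OF hom(1)]]
    LinearCombinations.module_hom_add[OF mod_hom.f_hom[OF hom(2)]]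
  note smult = LinearCombinations.module_hom_smult[OF mod_hom.f_hom[OF hom(1)]]
    LinearCombinations.module_hom_smult[OF mod_hom.f_hom[OF hom(2)]]
  show ?thesis
    using x
    by (induction rule: U_induct)
       (use eq add smult mod_hom.f0_is_0[OF hom(1)] mod_hom.f0_is_0[OF hom(2)] in auto)
qed

lemma universal_map_exists:
  assumes W: "star_vector_space W" and f: "f \<in> carrier W" and q: "\<And>i. i \<in> {1..N} \<Longrightarrow> q i \<in> carrier W"
    and rel: "satisfies_relations N M W f q"
  shows "\<exists>\<pi>. linear_map class_ring U W \<pi> \<and> \<pi> (univ_unit N M) = f \<and> (\<forall>i\<in>{1..N}. \<pi> (univ_gen N M i) = q i)"
proof -
  interpret W: star_vector_space W by fact
  define h where "h j = (if j = 0 then f else q j)" for j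
  have h: "h j \<in> carrier W" if "j \<in> {..<N + 1}" for j using that f q unfolding h_def by auto
  define \<phi> where "\<phi> v = (\<Oplus>\<^bsub>W\<^esub>j\<in>{..<N + 1}. v $ j \<odot>\<^bsub>W\<^esub> h j)" for v
  have \<phi>c: "\<phi> v \<in> carrier W" for v unfolding \<phi>_def by (intro W.finsum_mem W.scale_closed h)
  have \<phi>_add: "\<phi> (v + w) = \<phi> v \<oplus>\<^bsub>W\<^esub> \<phi> w" if "v \<in> carrier_vec (N + 1)" "w \<in> carrier_vec (N + 1)" for v w
  proof -
    have "\<phi> (v + w) = (\<Oplus>\<^bsub>W\<^esub>j\<in>{..<N + 1}. v $ j \<odot>\<^bsub>W\<^esub> h j \<oplus>\<^bsub>W\<^esub> w $ j \<odot>\<^bsub>W\<^esub> h j)"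
      unfolding \<phi>_def
      by (intro W.finsum_eq W.M.a_closed W.scale_closed h) (use that h in \<open>auto simp: W.scale_left_distrib\<close>)
    then show ?thesis unfolding \<phi>_def by (simp only: W.finsum_plus[OF W.scale_closed[OF h] W.scale_closed[OF h]])
  qed
  have \<phi>_smult: "\<phi> (c \<cdot>\<^sub>v v) = c \<odot>\<^bsub>W\<^esub> \<phi> v" if "v \<in> carrier_vec (N + 1)" for c v
  proof -
    have "\<phi> (c \<cdot>\<^sub>v v) = (\<Oplus>\<^bsub>W\<^esub>j\<in>{..<N + 1}. c \<odot>\<^bsub>W\<^esub> (v $ j \<odot>\<^bsub>W\<^esub> h j))"
      unfolding \<phi>_def by (intro W.finsum_eq W.scale_closed h) (use that h in auto)
    then show ?thesis unfolding \<phi>_def by (simp only: W.scale_finsum[OF W.scale_closed[OF h]])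
  qed
  have \<phi>_zero: "\<phi> (0\<^sub>v (N + 1)) = \<zero>\<^bsub>W\<^esub>"
    using \<phi>_smult[of "0\<^sub>v (N + 1)" 0] \<phi>c by simp
  have \<phi>_J: "\<phi> v = \<zero>\<^bsub>W\<^esub>" if "v \<in> J" for v
  proof (rule J_least[OF _ _ _ _ that])
    fix i assume i: "i < l"
    let ?r = "vec (N + 1) (\<lambda>j. complex_of_real (M $$ (i, j)))"
    have dom: "{..<N + 1} = insert 0 {1..N}" by auto
    have "\<phi> ?r = (\<Oplus>\<^bsub>W\<^esub>j\<in>{..<N + 1}. complex_of_real (M $$ (i, j)) \<odot>\<^bsub>W\<^esub> h j)"
      unfolding \<phi>_def by (intro W.finsum_eq W.scale_closed h) auto
    also have "\<dots> = complex_of_real (M $$ (i, 0)) \<odot>\<^bsub>W\<^esub> h 0 \<oplus>\<^bsub>W\<^esub> (\<Oplus>\<^bsub>W\<^esub>j\<in>{1..N}. complex_of_real (M $$ (i, j)) \<odot>\<^bsub>W\<^esub> h j)"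
      unfolding dom by (rule W.M.finsum_insert) (use h in auto)
    also have "(\<Oplus>\<^bsub>W\<^esub>j\<in>{1..N}. complex_of_real (M $$ (i, j)) \<odot>\<^bsub>W\<^esub> h j) = (\<Oplus>\<^bsub>W\<^esub>j\<in>{1..N}. complex_of_real (M $$ (i, j)) \<odot>\<^bsub>W\<^esub> q j)"
      by (intro W.finsum_eq W.scale_closed q) (auto simp: h_def)
    also have "complex_of_real (M $$ (i, 0)) \<odot>\<^bsub>W\<^esub> h 0 \<oplus>\<^bsub>W\<^esub> \<dots> = \<zero>\<^bsub>W\<^esub>"
      using rel i M_carrier unfolding satisfies_relations_def h_def by simp
    finally show "\<phi> ?r = \<zero>\<^bsub>W\<^esub>" .
  qed (use \<phi>_zero \<phi>_add \<phi>_smult in auto)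
  define \<pi> where "\<pi> x = \<phi> (SOME v. v \<in> carrier_vec (N + 1) \<and> x = cls v)" for x
  have \<pi>: "\<pi> (cls v) = \<phi> v" if v: "v \<in> carrier_vec (N + 1)" for v
  proof -
    define w where "w = (SOME w. w \<in> carrier_vec (N + 1) \<and> cls v = cls w)"
    have "w \<in> carrier_vec (N + 1) \<and> cls v = cls w"
      unfolding w_def by (rule someI[of _ v]) (use v in auto)
    then obtain h where "h \<in> J" "w = h + v" "w \<in> carrier_vec (N + 1)" using cls_eqD[of w v] by auto
    then have "\<phi> w = \<phi> v" using \<phi>_add[OF J_closed(1) v] \<phi>_J \<phi>c by simp
    then show ?thesis unfolding \<pi>_def w_def .
  qed
  have "linear_map class_ring U W \<pi>"
    unfolding linear_map_def mod_hom_def mod_hom_axioms_def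
  proof (intro conjI U.vectorspace_axioms W.vectorspace_axioms U.module_axioms W.module_axioms)
    show "\<pi> \<in> LinearCombinations.module_hom class_ring U W"
      unfolding LinearCombinations.module_hom_def by (auto simp: U_carrier U_add U_smult \<pi> \<phi>_add \<phi>_smult \<phi>c)
  qed
  moreover have "\<pi> (univ_gen N M j) = h j" if "j \<le> N" for j
  proof -
    have "\<pi> (univ_gen N M j) = \<phi> (unit_vec (N + 1) j)" unfolding univ_gen_eq by (rule \<pi>) simp
    also have "\<dots> = unit_vec (N + 1) j $ j \<odot>\<^bsub>W\<^esub> h j"
      unfolding \<phi>_def using that h by (intro W.finsum_single) auto
    finally show ?thesis using that h by simp
  qed
  ultimately show ?thesis unfolding h_def by (intro exI[of _ \<pi>]) auto
qed

text \<open>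
The vectors at which \<open>\<pi>\<close> commutes with the involution form a complex subspace: the scalar is conjugated
on both sides.
\<close>

lemma star_linear_map_U:
  assumes W: "star_vector_space W" and \<pi>: "linear_map class_ring U W \<pi>"
    and h: "\<And>j. j \<le> N \<Longrightarrow> star W (\<pi> (univ_gen N M j)) = \<pi> (univ_gen N M j)"
  shows "star_linear_map U W \<pi>"
proof -
  interpret W: star_vector_space W by fact
  have hom: "mod_hom class_ring U W \<pi>" using \<pi> by (simp add: linear_map_def)
  note T = mod_hom.f_im[OF hom] LinearCombinations.module_hom_add[OF mod_hom.f_hom[OF hom]]
  have smult: "\<pi> (c \<odot>\<^bsub>U\<^esub> x) = c \<odot>\<^bsub>W\<^esub> \<pi> x" if "x \<in> carrier U" for c x
    using LinearCombinations.module_hom_smult[OF mod_hom.f_hom[OF hom], of c x] that by simp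
  have "\<pi> (star U x) = star W (\<pi> x)" if "x \<in> carrier U" for x
    using that
    by (induction rule: U_induct)
       (use h mod_hom.f0_is_0[OF hom] in \<open>auto simp: T smult U.star_add W.star_add U.star_smult W.star_smult U.star_closed\<close>)
  then show ?thesis
    unfolding star_linear_map_def star_linear_map_axioms_def using \<pi> W star_vector_space_U by simp
qed

lemma E_proj_eq:
  "E_proj k N M = arch_closure k U (univ_unit N M) (\<Union>n. E_seq k U N (univ_unit N M) (univ_gen N M) n)"
  unfolding E_proj_def Let_def arch_closure_def by auto

lemma projections_data:
  assumes k: "1 \<le> k" and aou: "k_AOU k W C f" and q: "\<forall>i\<in>{1..N}. abstract_projection k W C f (q i)"
  shows "star_vector_space W" "f \<in> carrier W" "star W f = f"
    "i \<in> {1..N} \<Longrightarrow> q i \<in> carrier W" "i \<in> {1..N} \<Longrightarrow> star W (q i) = q i"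
proof -
  show W: "star_vector_space W" using aou unfolding k_AOU_def by simp
  show "f \<in> carrier W" "star W f = f"
    using star_vector_space.k_AOU_properties(3,5)[OF W aou] k by auto
  show "i \<in> {1..N} \<Longrightarrow> q i \<in> carrier W" "i \<in> {1..N} \<Longrightarrow> star W (q i) = q i"
    using q unfolding abstract_projection_def positive_contraction_def by auto
qed

lemma E_proj_into_projections:
  assumes k: "1 \<le> k" and N: "1 \<le> N" and aou: "k_AOU k W C f"
    and q: "\<forall>i\<in>{1..N}. abstract_projection k W C f (q i)"
    and \<pi>: "linear_map class_ring U W \<pi>" "\<pi> (univ_unit N M) = f" "\<forall>i\<in>{1..N}. \<pi> (univ_gen N M i) = q i"
  shows "star_linear_map U W \<pi>" "x \<in> E_proj k N M \<Longrightarrow> map_mat \<pi> x \<in> C"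
proof -
  note d = projections_data[OF k aou q]
  have "star W (\<pi> (univ_gen N M j)) = \<pi> (univ_gen N M j)" if "j \<le> N" for j
    using \<pi>(2,3) d(3) d(5)[of j] that by (cases "j = 0") auto
  then show s: "star_linear_map U W \<pi>" using star_linear_map_U[OF d(1) \<pi>(1)] by blast
  have "E_proj k N M \<subseteq> star_linear_map.preimage_cone U \<pi> k C"
    unfolding E_proj_eq
    by (rule star_linear_map.E_proj_limit_in_preimage[OF s k N]) (use aou q \<pi> in auto)
  then show "x \<in> E_proj k N M \<Longrightarrow> map_mat \<pi> x \<in> C"
    unfolding star_linear_map.preimage_cone_def[OF s] by auto
qed

text \<open>
Properness is the one axiom that depends on the relations: without enough projections satisfying them
the cone may contain a line. It therefore enters as a hypothesis.
\<close>

lemma E_proj_k_AOU: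
  assumes k: "1 \<le> k" and N: "1 \<le> N"
    and proper: "\<And>x y. x \<in> E_proj k N M \<Longrightarrow> y \<in> E_proj k N M \<Longrightarrow> x = mat_neg U y \<Longrightarrow> x = mat_zero k U"
  shows "k_AOU k U (E_proj k N M) (univ_unit N M)"
proof -
  let ?e = "univ_unit N M" and ?p = "univ_gen N M" and ?E = "E_proj k N M"
  let ?S = "E_seq k U N ?e ?p"
  have gen: "?e \<in> carrier U" "star U ?e = ?e" "\<And>i. i \<in> {1..N} \<Longrightarrow> ?p i \<in> carrier U" "\<And>i. i \<in> {1..N} \<Longrightarrow> star U (?p i) = ?p i"
    by auto
  have S: "compress_cone k U (?S n)" "?S n \<subseteq> ?S (Suc n)" for n
    by (rule U.E_seq_structure(1)[OF k N gen(1,2)], simp, simp) (rule U.E_seq_structure(3)[OF k N gen(1,2)], simp, simp)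
  have S_tensor: "tensor U (1\<^sub>m k) s \<in> ?S n" if "s \<in> E_cone U N ?e ?p" for n s
    by (rule U.E_seq_structure(2)[OF k N gen(1,2) _ _ that]) simp_all
  have E_cone: "?e \<in> E_cone U N ?e ?p"
    by (rule U.generators_in_E_cone(1)[OF gen(1,2)]) simp_all
  have E_cone_gen: "?p i \<in> E_cone U N ?e ?p" "?e \<ominus>\<^bsub>U\<^esub> ?p i \<in> E_cone U N ?e ?p" if "i \<in> {1..N}" for i
    by (rule U.generators_in_E_cone(2)[OF gen(1,2) _ _ that], simp, simp)
       (rule U.generators_in_E_cone(3)[OF gen(1,2) _ _ that], simp, simp)
  have D: "compress_cone k U (\<Union>n. ?S n)" using U.compress_cone_Union[of k ?S] S by blast
  have eD: "tensor U (1\<^sub>m k) s \<in> (\<Union>n. ?S n)" if "s \<in> E_cone U N ?e ?p" for s using S_tensor[OF that] by blast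
  have E: "compress_cone k U ?E"
    unfolding E_proj_eq by (rule U.compress_cone_arch_closure[OF D gen(1) eD[OF E_cone]])
  have EE: "tensor U (1\<^sub>m k) s \<in> ?E" if "s \<in> E_cone U N ?e ?p" for s
    unfolding E_proj_eq using U.cone_subset_arch_closure[OF D eD[OF E_cone]] eD[OF that] by blast
  have u: "tensor U (1\<^sub>m k) ?e \<in> ?E" by (rule EE[OF E_cone])
  have zero: "mat_zero k U \<in> ?E" by (rule U.cone_zero[OF E u])
  have "proper_cone k U ?E"
    unfolding proper_cone_def
  proof (intro conjI)
    show "cone k U ?E" unfolding cone_def using compress_coneD[OF E] U.cone_scale[OF E] by auto
    have "mat_neg U (mat_zero k U) = mat_zero k U" by (intro eq_matI) (auto simp: mat_zero_def mat_neg_def)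
    then have "mat_zero k U \<in> mat_neg U ` ?E" using zero by (metis image_eqI)
    then show "?E \<inter> mat_neg U ` ?E = {mat_zero k U}" using zero proper by blast
  qed
  moreover have "archimedean_order_unit k U ?E (tensor U (1\<^sub>m k) ?e)"
    unfolding archimedean_order_unit_def
  proof (intro conjI ballI impI)
    show uh: "tensor U (1\<^sub>m k) ?e \<in> herm k U" using compress_coneD(1)[OF E u] .
    fix x assume x: "x \<in> herm k U"
    show "x \<in> ?E" if "\<forall>r>0. mat_add U x (mat_scale U r (tensor U (1\<^sub>m k) ?e)) \<in> ?E"
      using U.arch_closure_arch[OF U.hermD(1)[OF uh] x] that unfolding E_proj_eq by blast
    show "\<exists>r>0. mat_add U (mat_scale U r (tensor U (1\<^sub>m k) ?e)) (mat_neg U x) \<in> ?E"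
    proof (rule U.dominated_by_unit[OF E gen(1) u _ _ U_expansion x])
      fix j assume j: "j < N + 1"
      show "tensor U (1\<^sub>m k) (?p j) \<in> ?E \<and> tensor U (1\<^sub>m k) (?e \<ominus>\<^bsub>U\<^esub> ?p j) \<in> ?E"
      proof (cases "j = 0")
        case True
        have "tensor U (1\<^sub>m k) (?e \<ominus>\<^bsub>U\<^esub> ?e) = mat_zero k U"
          by (intro eq_matI) (auto simp: mat_zero_def a_minus_def U.M.r_neg)
        then show ?thesis using u zero True by simp
      next
        case False
        then show ?thesis using j EE E_cone_gen[of j] by auto
      qed
    qed simp_all
  qed
  ultimately show ?thesis
    unfolding k_AOU_def using star_vector_space_U compress_coneD(3)[OF E] by simp
qed

end

theorem theorem5p10:
  fixes k N l :: nat and M :: "real mat"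
  assumes "1 \<le> k" and "1 \<le> N" and "M \<in> carrier_mat l (N + 1)"
  shows
    "((\<exists>(V :: 'v star_vs) C f q.
         k_AOU k V C f \<and>
         (\<forall>i\<in>{1..N}. abstract_projection k V C f (q i)) \<and>
         satisfies_relations N M V f q \<and>
         carrier V = LinearCombinations.module.span class_ring V ({f} \<union> q ` {1..N}) \<and>
         vectorspace.dim class_ring (univ_space N M) = vectorspace.dim class_ring V)
       \<longrightarrow> k_AOU k (univ_space N M) (E_proj k N M) (univ_unit N M))
     \<and>
     (\<forall>(W :: 'w star_vs) C f q.
         k_AOU k W C f \<and>
         (\<forall>i\<in>{1..N}. abstract_projection k W C f (q i)) \<and>
         satisfies_relations N M W f q
       \<longrightarrow> (\<exists>\<pi>.
              linear_map class_ring (univ_space N M) W \<pi> \<and>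
              \<pi> (univ_unit N M) = f \<and>
              (\<forall>i\<in>{1..N}. \<pi> (univ_gen N M i) = q i) \<and>
              k_positive k (univ_space N M) (E_proj k N M) W C \<pi> \<and>
              (\<forall>\<rho>. linear_map class_ring (univ_space N M) W \<rho> \<and>
                   \<rho> (univ_unit N M) = f \<and>
                   (\<forall>i\<in>{1..N}. \<rho> (univ_gen N M i) = q i)
                 \<longrightarrow> (\<forall>x\<in>carrier (univ_space N M). \<rho> x = \<pi> x))))"
proof -
  interpret real_relations N l M using assms(3) by unfold_locales
  note k = assms(1) and N = assms(2)
  show ?thesis
  proof (intro conjI impI allI)
    fix W :: "'w star_vs" and C f q
    assume asm: "k_AOU k W C f \<and> (\<forall>i\<in>{1..N}. abstract_projection k W C f (q i)) \<and> satisfies_relations N M W f q"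
    then have aou: "k_AOU k W C f" and q: "\<forall>i\<in>{1..N}. abstract_projection k W C f (q i)"
      and rel: "satisfies_relations N M W f q" by auto
    note d = projections_data[OF k aou q]
    obtain \<pi> where \<pi>: "linear_map class_ring U W \<pi>" "\<pi> (univ_unit N M) = f" "\<forall>i\<in>{1..N}. \<pi> (univ_gen N M i) = q i"
      using universal_map_exists[OF d(1,2,4) rel] by blast
    have "k_positive k U (E_proj k N M) W C \<pi>"
      unfolding k_positive_def using \<pi>(1) E_proj_into_projections(2)[OF k N aou q \<pi>] by auto
    moreover have "\<rho> x = \<pi> x"
      if "linear_map class_ring U W \<rho>" "\<rho> (univ_unit N M) = f" "\<forall>i\<in>{1..N}. \<rho> (univ_gen N M i) = q i"
        "x \<in> carrier U" for \<rho> x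
    proof (rule linear_map_unique[OF that(1) \<pi>(1) _ that(4)])
      fix j assume "j \<le> N"
      then show "\<rho> (univ_gen N M j) = \<pi> (univ_gen N M j)" using \<pi>(2,3) that(2,3) by (cases "j = 0") auto
    qed
    ultimately show "\<exists>\<pi>. linear_map class_ring U W \<pi> \<and> \<pi> (univ_unit N M) = f \<and>
              (\<forall>i\<in>{1..N}. \<pi> (univ_gen N M i) = q i) \<and> k_positive k U (E_proj k N M) W C \<pi> \<and>
              (\<forall>\<rho>. linear_map class_ring U W \<rho> \<and> \<rho> (univ_unit N M) = f \<and>
                   (\<forall>i\<in>{1..N}. \<rho> (univ_gen N M i) = q i) \<longrightarrow> (\<forall>x\<in>carrier U. \<rho> x = \<pi> x))"
      using \<pi> by blast
  next
    assume "\<exists>(V :: 'v star_vs) C f q.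
         k_AOU k V C f \<and>
         (\<forall>i\<in>{1..N}. abstract_projection k V C f (q i)) \<and>
         satisfies_relations N M V f q \<and>
         carrier V = LinearCombinations.module.span class_ring V ({f} \<union> q ` {1..N}) \<and>
         vectorspace.dim class_ring U = vectorspace.dim class_ring V"
    then obtain V :: "'v star_vs" and C f q where aou: "k_AOU k V C f"
      and q: "\<forall>i\<in>{1..N}. abstract_projection k V C f (q i)" and rel: "satisfies_relations N M V f q"
      and span: "carrier V = LinearCombinations.module.span class_ring V ({f} \<union> q ` {1..N})"
      and dim: "vectorspace.dim class_ring U = vectorspace.dim class_ring V"
      by blast
    note d = projections_data[OF k aou q]
    interpret V: star_vector_space V by (rule d(1))
    obtain \<pi> where \<pi>: "linear_map class_ring U V \<pi>" "\<pi> (univ_unit N M) = f" "\<forall>i\<in>{1..N}. \<pi> (univ_gen N M i) = q i"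
      using universal_map_exists[OF d(1,2,4) rel] by blast
    interpret \<pi>: star_linear_map U V \<pi> by (rule E_proj_into_projections(1)[OF k N aou q \<pi>])
    have "submodule class_ring (\<pi> ` carrier U) V"
      using mod_hom.im_is_submodule[OF \<pi>.hom] unfolding mod_hom.im_def[OF \<pi>.hom] .
    moreover have "f \<in> \<pi> ` carrier U" using \<pi>(2) gen_closed by (metis image_eqI)
    moreover have "q i \<in> \<pi> ` carrier U" if "i \<in> {1..N}" for i using \<pi>(3) that gen_closed by (metis image_eqI)
    ultimately have surj: "carrier V \<subseteq> \<pi> ` carrier U"
      unfolding span by (intro V.span_is_subset) auto
    have inj: "v = \<zero>\<^bsub>U\<^esub>" if "v \<in> carrier U" "\<pi> v = \<zero>\<^bsub>V\<^esub>" for v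
      by (rule surj_same_dim_imp_trivial_kernel[OF \<pi>(1) U_fin_dim surj dim that])
    have neg: "C \<inter> mat_neg V ` C = {mat_zero k V}" using aou unfolding k_AOU_def proper_cone_def by simp
    show "k_AOU k U (E_proj k N M) (univ_unit N M)"
    proof (rule E_proj_k_AOU[OF k N])
      fix x y assume x: "x \<in> E_proj k N M" and y: "y \<in> E_proj k N M" and xy: "x = mat_neg U y"
      have xm: "x \<in> mats k U" and ym: "y \<in> mats k U"
        using x y U.hermD(1) unfolding E_proj_eq arch_closure_def by blast+
      have "map_mat \<pi> x \<in> C" "map_mat \<pi> y \<in> C"
        using E_proj_into_projections(2)[OF k N aou q \<pi>] x y by auto
      then have "map_mat \<pi> x = mat_zero k V"
        using neg \<pi>.map_mat_neg[OF ym] xy by auto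
      then have "\<pi> (x $$ (i, j)) = mat_zero k V $$ (i, j)" if "i < k" "j < k" for i j
        using that U.matsD(1,2)[OF xm] by (simp flip: \<open>map_mat \<pi> x = mat_zero k V\<close>)
      then have "\<pi> (x $$ (i, j)) = \<zero>\<^bsub>V\<^esub>" if "i < k" "j < k" for i j
        using that by (simp add: mat_zero_def)
      then show "x = mat_zero k U"
        using U.matsD[OF xm] inj by (intro eq_matI) (simp_all add: mat_zero_def)
    qed
  qed
qed

end
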